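(* Let $F$ be a finite group, let $n$ be a positive integer, let $\lambda=(\lambda_1\ge\lambda_2\ge\cdots\ge\lambda_r>0)$ be a partition of $n$, and let $S_\lambda=S_{\lambda_1}\times\cdots\times S_{\lambda_r}\leqslant S_n$ be the corresponding Young subgroup. Then $F\wr S_\lambda$ is a multiplicity-free (strong Gelfand) subgroup of $F\wr S_n$ if and only if $\lambda$ has at most two parts and its second part is $0$, $1$ or $2$ (where the second part is regarded as $0$ if $r=1$).
   Context: All groups are finite and all representations are finite-dimensional over $\mathbb{C}$. For a subgroup $K\leqslant G$, the pair $(G,K)$ is a strong Gelfand pair, and $K$ is called a strong Gelfand (or multiplicity-free) subgroup of $G$, if $\mathrm{ind}_K^G V$ is multiplicity-free for every irreducible representation $V$ of $K$. For a subgroup $B\leqslant S_n$, $F\wr B=F^n\rtimes B$, where $B$ permutes the coordinates of $F^n$; it is a subgroup of $F\wr S_n$. *)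

theory Defs
  imports
    Complex_Main
    "HOL-Algebra.Sym_Groups"
    "HOL-Algebra.Product_Groups"
    "HOL-Library.Function_Algebras"
begin

section \<open>Finite-dimensional complex representations\<close>

text \<open>
  A representation space is a finite-dimensional subspace \<open>V\<close> of an ambient complex vector space
  (a type with a scalar multiplication). The operator of a group element only matters on \<open>V\<close>.
\<close>

definition linear_on ::
  "(complex \<Rightarrow> 'v \<Rightarrow> 'v) \<Rightarrow> (complex \<Rightarrow> 'w \<Rightarrow> 'w) \<Rightarrow> 'v set \<Rightarrow>
    ('v::ab_group_add \<Rightarrow> 'w::ab_group_add) \<Rightarrow> bool" where
  "linear_on s s' V T \<longleftrightarrow>
     (\<forall>u\<in>V. \<forall>v\<in>V. T (u + v) = T u + T v) \<and> (\<forall>c. \<forall>v\<in>V. T (s c v) = s' c (T v))"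

locale fd_rep = grp: group G + vs: vector_space s
  for G :: "('g, 'm) monoid_scheme" (structure)
    and s :: "complex \<Rightarrow> 'v::ab_group_add \<Rightarrow> 'v" +
  fixes V :: "'v set" and \<rho> :: "'g \<Rightarrow> 'v \<Rightarrow> 'v"
  assumes subspace: "vs.subspace V"
    and finite_dim: "\<exists>B. finite B \<and> V = vs.span B"
    and closed: "g \<in> carrier G \<Longrightarrow> v \<in> V \<Longrightarrow> \<rho> g v \<in> V"
    and linear: "g \<in> carrier G \<Longrightarrow> linear_on s s V (\<rho> g)"
    and one: "v \<in> V \<Longrightarrow> \<rho> \<one> v = v"
    and mult: "g \<in> carrier G \<Longrightarrow> h \<in> carrier G \<Longrightarrow> v \<in> V \<Longrightarrow> \<rho> (g \<otimes> h) v = \<rho> g (\<rho> h v)"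

definition irreducible_rep ::
  "('g, 'm) monoid_scheme \<Rightarrow> (complex \<Rightarrow> 'v \<Rightarrow> 'v) \<Rightarrow> 'v::ab_group_add set \<Rightarrow>
    ('g \<Rightarrow> 'v \<Rightarrow> 'v) \<Rightarrow> bool" where
  "irreducible_rep G s V \<rho> \<longleftrightarrow>
     fd_rep G s V \<rho> \<and> V \<noteq> {0} \<and>
     (\<forall>U. U \<subseteq> V \<and> fd_rep G s U \<rho> \<longrightarrow> U = {0} \<or> U = V)"

definition isomorphic_reps ::
  "('g, 'm) monoid_scheme \<Rightarrow>
    (complex \<Rightarrow> 'v \<Rightarrow> 'v) \<Rightarrow> 'v::ab_group_add set \<Rightarrow> ('g \<Rightarrow> 'v \<Rightarrow> 'v) \<Rightarrow>
    (complex \<Rightarrow> 'w \<Rightarrow> 'w) \<Rightarrow> 'w::ab_group_add set \<Rightarrow> ('g \<Rightarrow> 'w \<Rightarrow> 'w) \<Rightarrow> bool" where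
  "isomorphic_reps G s V \<rho> s' W \<sigma> \<longleftrightarrow>
     (\<exists>T. bij_betw T V W \<and> linear_on s s' V T \<and>
          (\<forall>g\<in>carrier G. \<forall>v\<in>V. T (\<rho> g v) = \<sigma> g (T v)))"

text \<open>
  A representation is multiplicity-free if it is an (internal) direct sum of pairwise
  non-isomorphic irreducible subrepresentations.
\<close>

definition multiplicity_free ::
  "('g, 'm) monoid_scheme \<Rightarrow> (complex \<Rightarrow> 'v \<Rightarrow> 'v) \<Rightarrow> 'v::ab_group_add set \<Rightarrow>
    ('g \<Rightarrow> 'v \<Rightarrow> 'v) \<Rightarrow> bool" where
  "multiplicity_free G s V \<rho> \<longleftrightarrow>
     fd_rep G s V \<rho> \<and>
     (\<exists>\<U>. finite \<U> \<and>
       (\<forall>U\<in>\<U>. U \<subseteq> V \<and> irreducible_rep G s U \<rho>) \<and>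
       (\<forall>U\<in>\<U>. \<forall>U'\<in>\<U>. U \<noteq> U' \<longrightarrow> \<not> isomorphic_reps G s U \<rho> s U' \<rho>) \<and>
       (\<forall>v\<in>V. \<exists>!w. w \<in> (\<Pi>\<^sub>E U\<in>\<U>. U) \<and> (\<Sum>U\<in>\<U>. w U) = v))"


section \<open>Induced representations and strong Gelfand pairs\<close>

definition fun_scale :: "('c \<Rightarrow> 'v \<Rightarrow> 'v) \<Rightarrow> 'c \<Rightarrow> ('a \<Rightarrow> 'v) \<Rightarrow> 'a \<Rightarrow> 'v" where
  "fun_scale s c f = (\<lambda>x. s c (f x))"

text \<open>
  The representation of \<open>G\<close> induced from a representation \<open>(V, \<rho>)\<close> of a subgroup \<open>K\<close>, realised on
  the \<open>K\<close>-equivariant functions \<open>G \<rightarrow> V\<close>, on which \<open>G\<close> acts by left translation. Functions are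
  extended by \<open>0\<close> outside the carrier of \<open>G\<close>.
\<close>

definition ind_space ::
  "('g, 'm) monoid_scheme \<Rightarrow> 'g set \<Rightarrow> 'v set \<Rightarrow> ('g \<Rightarrow> 'v \<Rightarrow> 'v) \<Rightarrow>
    ('g \<Rightarrow> 'v::ab_group_add) set" where
  "ind_space G K V \<rho> =
     {f. (\<forall>g. g \<notin> carrier G \<longrightarrow> f g = 0) \<and>
         (\<forall>g\<in>carrier G. f g \<in> V \<and> (\<forall>k\<in>K. f (g \<otimes>\<^bsub>G\<^esub> k) = \<rho> (inv\<^bsub>G\<^esub> k) (f g)))}"

definition ind_action ::
  "('g, 'm) monoid_scheme \<Rightarrow> 'g \<Rightarrow> ('g \<Rightarrow> 'v) \<Rightarrow> 'g \<Rightarrow> 'v::ab_group_add" where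
  "ind_action G x f = (\<lambda>g. if g \<in> carrier G then f (inv\<^bsub>G\<^esub> x \<otimes>\<^bsub>G\<^esub> g) else 0)"

text \<open>
  The representations of \<open>K\<close> range over the finite-dimensional subspaces of \<open>nat \<Rightarrow> complex\<close>; up
  to isomorphism these are all finite-dimensional complex vector spaces.
\<close>

definition strong_gelfand_pair :: "('g, 'm) monoid_scheme \<Rightarrow> 'g set \<Rightarrow> bool" where
  "strong_gelfand_pair G K \<longleftrightarrow>
     subgroup K G \<and>
     (\<forall>(V :: (nat \<Rightarrow> complex) set) \<rho>.
        irreducible_rep (G\<lparr>carrier := K\<rparr>) (fun_scale (*)) V \<rho> \<longrightarrow>
        multiplicity_free G (fun_scale (fun_scale (*))) (ind_space G K V \<rho>) (ind_action G))"


section \<open>Wreath products and Young subgroups\<close>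

definition semidirect_product ::
  "('a, 'm) monoid_scheme \<Rightarrow> ('b, 'n) monoid_scheme \<Rightarrow> ('b \<Rightarrow> 'a \<Rightarrow> 'a) \<Rightarrow> ('a \<times> 'b) monoid" where
  "semidirect_product N H \<phi> =
     \<lparr>carrier = carrier N \<times> carrier H,
      monoid.mult = (\<lambda>(x, h) (y, k). (x \<otimes>\<^bsub>N\<^esub> \<phi> h y, h \<otimes>\<^bsub>H\<^esub> k)),
      one = (\<one>\<^bsub>N\<^esub>, \<one>\<^bsub>H\<^esub>)\<rparr>"

definition wreath_product ::
  "('a, 'm) monoid_scheme \<Rightarrow> nat \<Rightarrow> (nat \<Rightarrow> nat) set \<Rightarrow> ((nat \<Rightarrow> 'a) \<times> (nat \<Rightarrow> nat)) monoid" where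
  "wreath_product F n B =
     semidirect_product (product_group {1..n} (\<lambda>_. F)) ((sym_group n)\<lparr>carrier := B\<rparr>)
       (\<lambda>\<sigma> f. \<lambda>i\<in>{1..n}. f (inv' \<sigma> i))"

text \<open>
  For a partition \<open>lam\<close>, block \<open>i\<close> consists of the \<open>lam ! i\<close> consecutive points following the
  earlier blocks; the product of the symmetric groups of the blocks, as a permutation group, consists
  of the permutations preserving every block.
\<close>

definition block :: "nat list \<Rightarrow> nat \<Rightarrow> nat set" where
  "block lam i = {sum_list (take i lam) <.. sum_list (take (Suc i) lam)}"

definition young_subgroup :: "nat list \<Rightarrow> (nat \<Rightarrow> nat) set" where
  "young_subgroup lam =
     {\<sigma> \<in> carrier (sym_group (sum_list lam)). \<forall>i<length lam. \<sigma> ` block lam i = block lam i}"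

definition is_partition :: "nat list \<Rightarrow> nat \<Rightarrow> bool" where
  "is_partition lam n \<longleftrightarrow> sorted_wrt (\<ge>) lam \<and> (\<forall>x\<in>set lam. 0 < x) \<and> sum_list lam = n"

definition second_part :: "nat list \<Rightarrow> nat" where
  "second_part lam = (if 2 \<le> length lam then lam ! 1 else 0)"

end

(*
  For finite G and K \<le> G, the pair (G, K) is strong Gelfand iff the algebra C[G]^K of K-conjugation
  invariant functions on G is commutative under convolution: by Schur, Maschke, Burnside and Frobenius
  reciprocity, right convolution identifies the G-endomorphisms of an induced irreducible representation
  with the image of C[G]^K, and these images separate the elements of C[G]^K.

  For G = F wr S_n let N = F^n. For a permutation p let U p be the sum of the N-conjugates of p. The
  centralizer C[G]^N is generated over the centre Z of C[N] by the U p; moreover U p U q = r U (p q) with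
  r in Z invariant under g -> g^-1, because r is a polynomial in the squares of the U (i j). Hence
  z U p -> z U (p^-1) is an anti-automorphism of C[G]^N, although F itself need not have an
  anti-automorphism fixing its conjugacy classes. If every p is inverted by an element of the Young subgroup
  that preserves all cycles of p, the anti-automorphism fixes C[G]^K pointwise, so C[G]^K is commutative.
  Such elements (reflections of the cycles) exist when at most two points have to be preserved as a set.

  In the other cases two indicator functions of K-invariant sets of permutations do not commute.
*)
theory Submission
  imports Defs "HOL-Computational_Algebra.Fundamental_Theorem_Algebra"
begin


section \<open>Linear algebra on finite-dimensional subspaces\<close>

text \<open>Why the bound is 2: write the block labels of the points along a cycle. The cycle is
  conjugate to its inverse under the Young subgroup exactly when this cyclic word agrees with its
  reversal up to rotation. Words in A and B with at most two letters B always do. The shortest words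
  that do not are, up to symmetry, ABC and, on two letters, AABABB, which takes three points of each
  block. The two non-commuting pairs are factorizations of cycles with these words into factors
  whose own patterns are reversible.

  The obstacle on the positive side is that in z U p the coefficient z is not unique. The map z U p
  -> z U (p^-1) is therefore never introduced as a function; it is only shown that, for an invariant
  element, every coefficient of its component above p is also a coefficient above p^-1. Conjugation
  by a permutation that preserves the cycles of p may well change z, but it does not change z U p.
  The reason is that U p has a factor U (i j) whenever i and j share a cycle of p, and U (i j)
  cannot tell z from its conjugate by (i j).\<close>

locale complex_vector_space = vector_space s
  for s :: "complex \<Rightarrow> 'v::ab_group_add \<Rightarrow> 'v"
begin

lemma linear_on_zero:
  assumes "linear_on s s V T" "subspace V"
  shows "T 0 = 0"
proof -
  have "T (s 0 0) = s 0 (T 0)"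
    using assms subspace_0 unfolding linear_on_def by blast
  then show ?thesis by simp
qed

lemma linear_on_diff:
  assumes "linear_on s s V T" "subspace V" "u \<in> V" "v \<in> V"
  shows "T (u - v) = T u - T v"
proof -
  have "T (u + s (-1) v) = T u + s (-1) (T v)"
    using assms subspace_scale[OF assms(2,4)] unfolding linear_on_def by metis
  then show ?thesis by simp
qed

lemma linear_on_sum:
  assumes "linear_on s s V T" "subspace V" "\<And>i. i \<in> A \<Longrightarrow> f i \<in> V"
  shows "T (\<Sum>i\<in>A. f i) = (\<Sum>i\<in>A. T (f i))"
  using assms(3)
proof (induction A rule: infinite_finite_induct)
  case (insert x A)
  then have "(\<Sum>i\<in>A. f i) \<in> V" by (intro subspace_sum[OF assms(2)]) auto
  with insert assms(1) show ?case unfolding linear_on_def by simp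
qed (use linear_on_zero[OF assms(1,2)] in auto)

lemma linear_on_subset: "linear_on s s V T \<Longrightarrow> U \<subseteq> V \<Longrightarrow> linear_on s s U T"
  unfolding linear_on_def by blast

lemma finite_basis_of_subspace:
  assumes "subspace U" "U \<subseteq> span B" "finite B"
  obtains C where "finite C" "independent C" "C \<subseteq> U" "span C = U"
proof -
  obtain C where C: "C \<subseteq> U" "independent C" "U \<subseteq> span C"
    using maximal_independent_subset by blast
  then have "finite C"
    using independent_span_bound[of B C] assms by blast
  moreover have "span C = U"
    using C span_minimal[OF C(1) assms(1)] by auto
  ultimately show ?thesis using that C by blast
qed

lemma projection_onto_subspace:
  assumes "subspace U"
  obtains p where "linear_on s s UNIV p" "range p \<subseteq> U" "\<And>u. u \<in> U \<Longrightarrow> p u = u"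
proof -
  interpret vector_space_pair s s by unfold_locales
  obtain g where g: "g ` UNIV \<subseteq> U" "Vector_Spaces.linear s s g" "\<forall>v\<in>U. g (id v) = v"
    using linear_exists_left_inverse_on[of id U] assms linear_id by auto
  have "linear_on s s UNIV g"
    using g(2) unfolding Vector_Spaces.linear_iff linear_on_def by auto
  with g that show ?thesis by auto
qed

lemma dim_psubset_subspace:
  assumes "subspace U" "U \<subset> V" "subspace V" "V \<subseteq> span B" "finite B"
  shows "dim U < dim V"
proof -
  obtain C where C: "finite C" "independent C" "C \<subseteq> U" "span C = U"
    using finite_basis_of_subspace[of U B] assms by blast
  obtain v where v: "v \<in> V" "v \<notin> U" using assms by blast
  have ind: "independent (insert v C)" using C v independent_insertI by blast
  obtain D where D: "insert v C \<subseteq> D" "D \<subseteq> V" "independent D" "V \<subseteq> span D"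
    using maximal_independent_subset_extend[of "insert v C" V] ind C v assms(2) by blast
  have "finite D" using independent_span_bound[of B D] D assms by blast
  moreover have "v \<notin> C" using C(3) v(2) by blast
  ultimately have "card C < card D"
    using card_mono[OF \<open>finite D\<close> D(1)] C(1) by simp
  then show ?thesis
    using basis_card_eq_dim[of C U] basis_card_eq_dim[of D V] C D by auto
qed

lemma sequence_dependence:
  assumes "V \<subseteq> span B" "finite B" "\<And>i. x i \<in> V"
  obtains n :: nat and c where "\<exists>i\<le>n. c i \<noteq> 0" "(\<Sum>i\<le>n. s (c i) (x i)) = 0"
proof -
  let ?n = "card B"
  show ?thesis
  proof (cases "inj_on x {..?n}")
    case True
    have "dependent (x ` {..?n})"
    proof (rule ccontr)
      assume "independent (x ` {..?n})"
      then have "card (x ` {..?n}) \<le> card B"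
        using independent_span_bound[of B "x ` {..?n}"] assms by blast
      with True show False by (simp add: card_image)
    qed
    then obtain u where u: "\<exists>v \<in> x ` {..?n}. u v \<noteq> 0" "(\<Sum>v\<in>x ` {..?n}. s (u v) v) = 0"
      by (subst (asm) dependent_finite) auto
    show ?thesis
      by (rule that[of ?n "u \<circ> x"]) (use u True in \<open>auto simp: sum.reindex o_def\<close>)
  next
    \<comment> \<open>Dependence is a property of sets, which forget repetitions; a repeated vector
      gives the relation with coefficients 1 and -1.\<close>
    case False
    then obtain i j where ij: "i \<le> ?n" "j \<le> ?n" "i \<noteq> j" "x i = x j"
      unfolding inj_on_def by auto
    define c where "c k = (if k = i then 1 else if k = j then - 1 else 0 :: complex)" for k
    have "(\<Sum>k\<le>?n. s (c k) (x k)) = (\<Sum>k\<in>{i,j}. s (c k) (x k))"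
      using ij by (intro sum.mono_neutral_right) (auto simp: c_def)
    also have "\<dots> = 0" using ij by (simp add: c_def)
    finally show ?thesis using ij by (intro that[of ?n c]) (auto simp: c_def)
  qed
qed

end

text \<open>For \<open>x i\<close> = T^i v the sum is q(T) v, and the identity reads (T - a) q(T) v
  = p(T) v. The bound \<open>n\<close> may exceed the degree; the extra coefficients vanish.\<close>

lemma (in complex_vector_space) eigenvector_of_annihilating_poly:
  fixes x :: "nat \<Rightarrow> 'v" and q p :: "complex poly"
  assumes T: "linear_on s s V T" "subspace V" "\<And>i. x i \<in> V" "\<And>i. T (x i) = x (Suc i)"
    and p: "p = [:-a, 1:] * q" and n: "degree q \<le> n"
  shows "T (\<Sum>i\<le>n. s (coeff q i) (x i)) - s a (\<Sum>i\<le>n. s (coeff q i) (x i))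
    = (\<Sum>i\<le>Suc n. s (coeff p i) (x i))"
proof -
  have "T (\<Sum>i\<le>n. s (coeff q i) (x i)) = (\<Sum>i\<le>n. s (coeff q i) (x (Suc i)))"
    using T by (subst linear_on_sum[OF T(1,2)]) (auto simp: subspace_scale linear_on_def)
  moreover have "(\<Sum>i\<le>Suc n. s (coeff (pCons 0 q) i) (x i)) = (\<Sum>i\<le>n. s (coeff q i) (x (Suc i)))"
    by (subst sum.atMost_Suc_shift) simp
  moreover have "(\<Sum>i\<le>Suc n. s (coeff (smult a q) i) (x i)) = s a (\<Sum>i\<le>n. s (coeff q i) (x i))"
    using n by (simp add: scale_sum_right coeff_eq_0)
  moreover have "p = pCons 0 q - smult a q" unfolding p by simp
  ultimately show ?thesis
    by (simp only: coeff_diff scale_left_diff_distrib sum_subtractf)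
qed

text \<open>Fix v \<noteq> 0. A nonzero polynomial p of least degree with p(T) v = 0 has a root a;
  with p = (X - a) q, minimality gives q(T) v \<noteq> 0, and this vector is the
  eigenvector.\<close>

lemma eigenvector_exists:
  fixes s :: "complex \<Rightarrow> 'v::ab_group_add \<Rightarrow> 'v"
  assumes "vector_space s" "module.subspace s V" "V \<subseteq> module.span s B" "finite B" "V \<noteq> {0}"
    and T: "linear_on s s V T" "\<And>v. v \<in> V \<Longrightarrow> T v \<in> V"
  obtains c v where "v \<in> V" "v \<noteq> 0" "T v = s c v"
proof -
  interpret complex_vector_space s unfolding complex_vector_space_def by fact
  obtain v where v: "v \<in> V" "v \<noteq> 0" using assms(2,5) subspace_0 by blast
  define x where "x i = (T ^^ i) v" for i
  have x: "x i \<in> V" for i by (induction i) (auto simp: x_def v T)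
  have Tx: "T (x i) = x (Suc i)" for i by (simp add: x_def)
  define ann where "ann p \<longleftrightarrow> p \<noteq> 0 \<and> (\<Sum>i\<le>degree p. s (coeff p i) (x i)) = 0" for p
  obtain n c where nc: "\<exists>i\<le>n. c i \<noteq> 0" "(\<Sum>i\<le>n. s (c i) (x i)) = 0"
    using sequence_dependence[of V B x] assms x by blast
  have ext: "(\<Sum>i\<le>n. s (coeff p i) (x i)) = (\<Sum>i\<le>degree p. s (coeff p i) (x i))"
    if "degree p \<le> n" for p n
    using that by (intro sum.mono_neutral_right) (auto simp: coeff_eq_0)
  define p0 where "p0 = (\<Sum>i\<le>n. monom (c i) i)"
  have cp0: "coeff p0 i = (if i \<le> n then c i else 0)" for i
    unfolding p0_def by (simp add: coeff_sum if_distrib[of "\<lambda>f. f _"] cong: if_cong)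
  have "degree p0 \<le> n" by (intro degree_le) (simp add: cp0)
  moreover have "p0 \<noteq> 0" using nc(1) cp0 by (metis coeff_0)
  ultimately have "ann p0" using nc(2) ext[of p0 n] by (simp add: ann_def cp0)
  then obtain p where p: "ann p" and pmin: "\<And>q. ann q \<Longrightarrow> degree p \<le> degree q"
    using ex_has_least_nat[of ann p0 degree] by blast
  have "degree p > 0"
  proof (rule ccontr)
    assume "\<not> ?thesis"
    then have "degree p = 0" by simp
    then obtain a where "p = [:a:]" by (metis degree_eq_zeroE)
    with p v show False by (simp add: ann_def x_def)
  qed
  then have "\<not> constant (poly p)" by (simp add: constant_degree)
  then obtain a where "poly p a = 0" using fundamental_theorem_of_algebra by blast
  then obtain q where q: "p = [:-a, 1:] * q" by (metis poly_eq_0_iff_dvd dvdE)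
  have q0: "q \<noteq> 0" using q p by (auto simp: ann_def)
  have deg: "degree p = Suc (degree q)" unfolding q using q0 by (subst degree_mult_eq) auto
  define w where "w = (\<Sum>i\<le>degree q. s (coeff q i) (x i))"
  have "w \<noteq> 0" using pmin[of q] q0 deg by (auto simp: ann_def w_def)
  moreover have "w \<in> V" unfolding w_def using x assms(2) by (intro subspace_sum subspace_scale) auto
  moreover have "T w - s a w = 0"
    using eigenvector_of_annihilating_poly[of V T x p a q "degree q", OF T(1) assms(2) x Tx q] p deg
    by (simp add: ann_def w_def)
  ultimately show ?thesis using that by auto
qed

lemma linear_on_comp:
  assumes "linear_on s s U T" "linear_on s s V S" "\<And>u. u \<in> U \<Longrightarrow> T u \<in> V"
  shows "linear_on s s U (\<lambda>u. S (T u))"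
  using assms unfolding linear_on_def by simp

section \<open>Schur's lemma and complete reducibility\<close>

text \<open>One action serves source and target, since all maps considered go between
  subrepresentations of one ambient representation. The target is controlled separately by an
  inclusion of images.\<close>

definition equivariant_on ::
  "('g, 'm) monoid_scheme \<Rightarrow> 'v set \<Rightarrow> ('g \<Rightarrow> 'v \<Rightarrow> 'v) \<Rightarrow> ('v \<Rightarrow> 'v) \<Rightarrow> bool" where
  "equivariant_on G V \<rho> T \<longleftrightarrow> (\<forall>g\<in>carrier G. \<forall>v\<in>V. T (\<rho> g v) = \<rho> g (T v))"

sublocale fd_rep \<subseteq> cvs: complex_vector_space s
  unfolding complex_vector_space_def by (rule vs.vector_space_axioms)

context fd_rep
begin

lemma subrep:
  assumes "vs.subspace U" "U \<subseteq> V" "\<And>g u. g \<in> carrier G \<Longrightarrow> u \<in> U \<Longrightarrow> \<rho> g u \<in> U"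
  shows "fd_rep G s U \<rho>"
proof -
  obtain B where B: "finite B" "V = vs.span B" using finite_dim by blast
  have UB: "U \<subseteq> vs.span B" using assms(2) B(2) by simp
  obtain C where C: "finite C" "vs.independent C" "C \<subseteq> U" "vs.span C = U"
    using cvs.finite_basis_of_subspace[OF assms(1) UB B(1)] .
  show ?thesis
  proof (intro fd_rep.intro fd_rep_axioms.intro)
    show "\<exists>B. finite B \<and> U = vs.span B" using C by blast
    show "linear_on s s U (\<rho> g)" if "g \<in> carrier G" for g
      using cvs.linear_on_subset[OF linear[OF that] assms(2)] .
    show "\<rho> \<one> v = v" if "v \<in> U" for v using one assms(2) that by blast
    show "\<rho> (g \<otimes> h) v = \<rho> g (\<rho> h v)" if "g \<in> carrier G" "h \<in> carrier G" "v \<in> U" for g h v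
      using mult assms(2) that by blast
    show "\<rho> g v \<in> U" if "g \<in> carrier G" "v \<in> U" for g v using assms(3) that .
  qed (rule grp.is_group vs.vector_space_axioms assms(1))+
qed

lemma finite_spanning: obtains B where "finite B" "V = vs.span B" "vs.independent B" "B \<subseteq> V"
  using finite_dim cvs.finite_basis_of_subspace[OF subspace] by (metis order_refl)

lemma zero_in: "0 \<in> V" using vs.subspace_0[OF subspace] .

lemma inv_cancel: "g \<in> carrier G \<Longrightarrow> v \<in> V \<Longrightarrow> \<rho> (inv g) (\<rho> g v) = v"
  "g \<in> carrier G \<Longrightarrow> v \<in> V \<Longrightarrow> \<rho> g (\<rho> (inv g) v) = v"
  using mult[of "inv g" g v] mult[of g "inv g" v] one by auto

lemma rho_sum:
  "g \<in> carrier G \<Longrightarrow> (\<And>i. i \<in> A \<Longrightarrow> f i \<in> V) \<Longrightarrow> \<rho> g (\<Sum>i\<in>A. f i) = (\<Sum>i\<in>A. \<rho> g (f i))"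
  using cvs.linear_on_sum[OF linear subspace] .

lemma rho_scale: "g \<in> carrier G \<Longrightarrow> v \<in> V \<Longrightarrow> \<rho> g (s c v) = s c (\<rho> g v)"
  using linear unfolding linear_on_def by blast

lemma rho_add: "g \<in> carrier G \<Longrightarrow> u \<in> V \<Longrightarrow> v \<in> V \<Longrightarrow> \<rho> g (u + v) = \<rho> g u + \<rho> g v"
  using linear unfolding linear_on_def by blast

lemma rho_diff: "g \<in> carrier G \<Longrightarrow> u \<in> V \<Longrightarrow> v \<in> V \<Longrightarrow> \<rho> g (u - v) = \<rho> g u - \<rho> g v"
  using cvs.linear_on_diff[OF linear subspace] .

lemma kernel_subrep:
  assumes "linear_on s s V T" "equivariant_on G V \<rho> T"
  shows "fd_rep G s {v \<in> V. T v = 0} \<rho>"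
proof (rule subrep)
  show "vs.subspace {v \<in> V. T v = 0}"
    unfolding vs.subspace_def
    using assms(1) cvs.linear_on_zero[OF assms(1) subspace] subspace
    by (auto simp: vs.subspace_0 vs.subspace_add vs.subspace_scale linear_on_def)
  fix g u assume g: "g \<in> carrier G" and u: "u \<in> {v \<in> V. T v = 0}"
  have "\<rho> g 0 = 0" using cvs.linear_on_zero[OF linear subspace] g by blast
  then show "\<rho> g u \<in> {v \<in> V. T v = 0}"
    using g u closed assms(2) unfolding equivariant_on_def by auto
qed auto

lemma image_subrep:
  assumes "linear_on s s V T" "equivariant_on G V \<rho> T" "fd_rep G s W \<rho>" "T ` V \<subseteq> W"
  shows "fd_rep G s (T ` V) \<rho>"
proof -
  interpret W: fd_rep G s W \<rho> by fact
  have lin: "T (u + v) = T u + T v" "T (s c u) = s c (T u)" if "u \<in> V" "v \<in> V" for u v c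
    using assms(1) that unfolding linear_on_def by auto
  show ?thesis
  proof (rule W.subrep)
    show "vs.subspace (T ` V)"
      unfolding vs.subspace_def
    proof (intro conjI ballI allI)
      show "0 \<in> T ` V" using cvs.linear_on_zero[OF assms(1) subspace] zero_in by force
    next
      fix x y assume "x \<in> T ` V" "y \<in> T ` V"
      then obtain u v where uv: "u \<in> V" "v \<in> V" "x = T u" "y = T v" by blast
      then have "x + y = T (u + v)" using lin(1) by simp
      then show "x + y \<in> T ` V" using vs.subspace_add[OF subspace uv(1,2)] by blast
    next
      fix c x assume "x \<in> T ` V"
      then obtain u where u: "u \<in> V" "x = T u" by blast
      then have "s c x = T (s c u)" using lin(2)[OF u(1) u(1)] by simp
      then show "s c x \<in> T ` V" using vs.subspace_scale[OF subspace u(1)] by blast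
    qed
    fix g x assume g: "g \<in> carrier G" and "x \<in> T ` V"
    then obtain u where u: "u \<in> V" "x = T u" by blast
    then have "\<rho> g x = T (\<rho> g u)" using g assms(2) unfolding equivariant_on_def by simp
    then show "\<rho> g x \<in> T ` V" using closed[OF g u(1)] by blast
  qed (use assms in auto)
qed

end

lemma irreducible_repD:
  assumes "irreducible_rep G s V \<rho>"
  shows "fd_rep G s V \<rho>" "V \<noteq> {0}" "U \<subseteq> V \<Longrightarrow> fd_rep G s U \<rho> \<Longrightarrow> U = {0} \<or> U = V"
  using assms unfolding irreducible_rep_def by auto

lemma schur_scalar:
  assumes irr: "irreducible_rep G s V \<rho>" and T: "linear_on s s V T" "equivariant_on G V \<rho> T" "T ` V \<subseteq> V"
  obtains c where "\<And>v. v \<in> V \<Longrightarrow> T v = s c v"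
proof -
  interpret fd_rep G s V \<rho> using irr irreducible_repD by blast
  obtain B where B: "finite B" "V = vs.span B" using finite_dim by blast
  obtain c v where cv: "v \<in> V" "v \<noteq> 0" "T v = s c v"
    using eigenvector_exists[OF vs.vector_space_axioms subspace _ B(1) irreducible_repD(2)[OF irr] T(1)] T(3) B
    by blast
  define T' where "T' v = T v - s c v" for v
  have "linear_on s s V T'"
    using T(1) unfolding linear_on_def T'_def by (auto simp: vs.scale_right_distrib vs.scale_right_diff_distrib mult.commute)
  moreover have "equivariant_on G V \<rho> T'"
    using T(2,3) closed unfolding equivariant_on_def T'_def
    by (auto simp: rho_scale rho_diff vs.subspace_scale[OF subspace] image_subset_iff)
  ultimately have "fd_rep G s {v \<in> V. T' v = 0} \<rho>" by (rule kernel_subrep)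
  then have "{v \<in> V. T' v = 0} = V"
    using irreducible_repD(3)[OF irr, of "{v \<in> V. T' v = 0}"] cv by (auto simp: T'_def)
  then have "T v = s c v" if "v \<in> V" for v using that unfolding T'_def by auto
  then show ?thesis using that by blast
qed

lemma schur_zero_or_iso:
  assumes irr: "irreducible_rep G s V \<rho>" "irreducible_rep G s W \<rho>"
    and T: "linear_on s s V T" "equivariant_on G V \<rho> T" "T ` V \<subseteq> W"
    and ne: "\<not> isomorphic_reps G s V \<rho> s W \<rho>" and v: "v \<in> V"
  shows "T v = 0"
proof -
  interpret V: fd_rep G s V \<rho> using irr irreducible_repD by blast
  have k: "{v \<in> V. T v = 0} = {0} \<or> {v \<in> V. T v = 0} = V"
    using irreducible_repD(3)[OF irr(1), OF _ V.kernel_subrep[OF T(1,2)]] by blast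
  have i: "T ` V = {0} \<or> T ` V = W"
    using irreducible_repD(3)[OF irr(2) T(3)] V.image_subrep[OF T(1,2)] irr(2) T(3) irreducible_repD(1) by blast
  show ?thesis
  proof (rule ccontr)
    assume nz: "T v \<noteq> 0"
    then have ker: "{v \<in> V. T v = 0} = {0}" and im: "T ` V = W" using k i v by blast+
    have "inj_on T V"
    proof (rule inj_onI)
      fix x y assume xy: "x \<in> V" "y \<in> V" "T x = T y"
      then have "x - y \<in> {v \<in> V. T v = 0}"
        using V.cvs.linear_on_diff[OF T(1) V.subspace] V.vs.subspace_diff[OF V.subspace] by auto
      then show "x = y" using ker by auto
    qed
    then have "isomorphic_reps G s V \<rho> s W \<rho>"
      using im T unfolding isomorphic_reps_def bij_betw_def equivariant_on_def by blast
    then show False using ne by blast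
  qed
qed

text \<open>Average a linear projection onto the subrepresentation over the group; its kernel is a complement.\<close>

lemma (in fd_rep) maschke:
  assumes fin: "finite (carrier G)" and U: "fd_rep G s U \<rho>" "U \<subseteq> V"
  obtains W where "fd_rep G s W \<rho>" "W \<subseteq> V" "U \<inter> W = {0}" "\<And>v. v \<in> V \<Longrightarrow> \<exists>u\<in>U. \<exists>w\<in>W. v = u + w"
proof -
  interpret U: fd_rep G s U \<rho> by fact
  obtain p where p: "linear_on s s UNIV p" "range p \<subseteq> U" "\<And>u. u \<in> U \<Longrightarrow> p u = u"
    using cvs.projection_onto_subspace[OF U.subspace] by blast
  define n where "n = (of_nat (card (carrier G)) :: complex)"
  have n: "n \<noteq> 0" using fin grp.one_closed unfolding n_def by auto
  define q where "q v = (\<Sum>g\<in>carrier G. \<rho> g (p (\<rho> (inv g) v)))" for v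
  define P where "P v = s (1 / n) (q v)" for v
  have pU: "p v \<in> U" for v using p(2) by blast
  have pV: "p v \<in> V" for v using pU U(2) by blast
  have pl: "p (u + v) = p u + p v" "p (s c u) = s c (p u)" for u v c
    using p(1) unfolding linear_on_def by auto
  have qU: "q v \<in> U" for v
    unfolding q_def using pU by (intro vs.subspace_sum[OF U.subspace] U.closed) auto
  have PU: "P v \<in> U" for v unfolding P_def using qU vs.subspace_scale[OF U.subspace] by blast
  have Pu: "P u = u" if u: "u \<in> U" for u
  proof -
    have "q u = (\<Sum>g\<in>carrier G. u)"
      unfolding q_def using u U.closed U.inv_cancel p(3) by (intro sum.cong) auto
    also have "\<dots> = s n u" unfolding n_def by (simp add: vs.sum_constant_scale)
    finally show ?thesis unfolding P_def using n by simp
  qed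
  have Pl: "linear_on s s V P"
    unfolding linear_on_def
  proof (intro conjI ballI allI)
    fix u v assume uv: "u \<in> V" "v \<in> V"
    then have "q (u + v) = q u + q v"
      unfolding q_def by (simp add: sum.distrib[symmetric] rho_add pl pV closed)
    then show "P (u + v) = P u + P v" unfolding P_def by (simp add: vs.scale_right_distrib)
  next
    fix c v assume v: "v \<in> V"
    then have "q (s c v) = s c (q v)"
      unfolding q_def by (simp add: vs.scale_sum_right rho_scale pl pV closed)
    then show "P (s c v) = s c (P v)" unfolding P_def by (simp add: mult.commute)
  qed
  have Pe: "equivariant_on G V \<rho> P"
    unfolding equivariant_on_def
  proof (intro ballI)
    fix h v assume h: "h \<in> carrier G" and v: "v \<in> V"
    have "q (\<rho> h v) = (\<Sum>g\<in>carrier G. \<rho> (h \<otimes> g) (p (\<rho> (inv (h \<otimes> g)) (\<rho> h v))))"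
      unfolding q_def
      by (rule sum.reindex_bij_witness[where i="\<lambda>g. h \<otimes> g" and j="\<lambda>g. inv h \<otimes> g"])
        (use h in \<open>auto simp: grp.m_assoc[symmetric]\<close>)
    also have "\<dots> = (\<Sum>g\<in>carrier G. \<rho> h (\<rho> g (p (\<rho> (inv g) v))))"
    proof (rule sum.cong[OF refl])
      fix g assume g: "g \<in> carrier G"
      have "\<rho> (inv (h \<otimes> g)) (\<rho> h v) = \<rho> (inv g) v"
        using g h v by (simp add: grp.inv_mult_group mult closed inv_cancel)
      then show "\<rho> (h \<otimes> g) (p (\<rho> (inv (h \<otimes> g)) (\<rho> h v))) = \<rho> h (\<rho> g (p (\<rho> (inv g) v)))"
        using g h pV by (simp add: mult)
    qed
    also have "\<dots> = \<rho> h (q v)" unfolding q_def using h pV closed by (simp add: rho_sum)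
    finally show "P (\<rho> h v) = \<rho> h (P v)"
      unfolding P_def using h qU U(2) rho_scale by (metis subsetD)
  qed
  show ?thesis
  proof (rule that)
    show "fd_rep G s {v \<in> V. P v = 0} \<rho>" by (rule kernel_subrep[OF Pl Pe])
    show "U \<inter> {v \<in> V. P v = 0} = {0}"
      using Pu U.zero_in zero_in by auto
    fix v assume v: "v \<in> V"
    have "P (v - P v) = 0"
      using cvs.linear_on_diff[OF Pl subspace v, of "P v"] PU[of v] U(2) Pu[OF PU] by auto
    moreover have "v - P v \<in> V" using v PU U(2) vs.subspace_diff[OF subspace] by blast
    ultimately show "\<exists>u\<in>U. \<exists>w\<in>{v \<in> V. P v = 0}. v = u + w"
      using PU by (intro bexI[of _ "P v"] bexI[of _ "v - P v"]) auto
  qed auto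
qed


section \<open>Decomposition into irreducibles and commuting endomorphisms\<close>

definition direct_sum :: "'v::comm_monoid_add set \<Rightarrow> 'v set set \<Rightarrow> bool" where
  "direct_sum V \<U> \<longleftrightarrow> (\<forall>v\<in>V. \<exists>!w. w \<in> (\<Pi>\<^sub>E U\<in>\<U>. U) \<and> (\<Sum>U\<in>\<U>. w U) = v)"

lemma direct_sumI:
  fixes \<U> :: "'v::ab_group_add set set"
  assumes ex: "\<And>v. v \<in> V \<Longrightarrow> \<exists>w. (\<forall>U\<in>\<U>. w U \<in> U) \<and> (\<Sum>U\<in>\<U>. w U) = v"
    and ind: "\<And>w. \<forall>U\<in>\<U>. w U \<in> U \<Longrightarrow> (\<Sum>U\<in>\<U>. w U) = 0 \<Longrightarrow> \<forall>U\<in>\<U>. w U = 0"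
    and diff: "\<And>U x y. U \<in> \<U> \<Longrightarrow> x \<in> U \<Longrightarrow> y \<in> U \<Longrightarrow> x - y \<in> U"
  shows "direct_sum V \<U>"
  unfolding direct_sum_def
proof
  fix v assume "v \<in> V"
  then obtain w where w: "\<forall>U\<in>\<U>. w U \<in> U" "(\<Sum>U\<in>\<U>. w U) = v" using ex by blast
  show "\<exists>!w. w \<in> (\<Pi>\<^sub>E U\<in>\<U>. U) \<and> (\<Sum>U\<in>\<U>. w U) = v"
  proof (rule ex1I[of _ "restrict w \<U>"])
    show "restrict w \<U> \<in> (\<Pi>\<^sub>E U\<in>\<U>. U) \<and> (\<Sum>U\<in>\<U>. restrict w \<U> U) = v"
      using w by auto
    fix w' assume w': "w' \<in> (\<Pi>\<^sub>E U\<in>\<U>. U) \<and> (\<Sum>U\<in>\<U>. w' U) = v"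
    have "\<forall>U\<in>\<U>. w' U - w U \<in> U" using w(1) w' diff by (simp add: PiE_iff)
    moreover have "(\<Sum>U\<in>\<U>. w' U - w U) = 0" using w(2) w' by (simp add: sum_subtractf)
    ultimately have "\<forall>U\<in>\<U>. w' U - w U = 0" by (rule ind)
    then show "w' = restrict w \<U>"
      using w' by (intro ext) (auto simp: PiE_iff extensional_def restrict_def)
  qed
qed

lemma (in fd_rep) irreducible_decomposition:
  assumes "finite (carrier G)"
  obtains \<U> where "finite \<U>" "\<forall>U\<in>\<U>. U \<subseteq> V \<and> irreducible_rep G s U \<rho>" "direct_sum V \<U>"
proof -
  \<comment> \<open>Existence and independence of components are stated separately and without
    extensional functions: in this form two decompositions combine over the union of the
    families.\<close>
  define decomp where "decomp W \<U> \<longleftrightarrow> finite \<U> \<and> (\<forall>U\<in>\<U>. U \<subseteq> W \<and> irreducible_rep G s U \<rho>) \<and>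
      (\<forall>v\<in>W. \<exists>w. (\<forall>U\<in>\<U>. w U \<in> U) \<and> (\<Sum>U\<in>\<U>. w U) = v) \<and>
      (\<forall>w. (\<forall>U\<in>\<U>. w U \<in> U) \<longrightarrow> (\<Sum>U\<in>\<U>. w U) = 0 \<longrightarrow> (\<forall>U\<in>\<U>. w U = 0))" for W \<U>
  have "\<exists>\<U>. decomp W \<U>"
    if "fd_rep G s W \<rho>" for W
    using that
  proof (induction "vs.dim W" arbitrary: W rule: less_induct)
    case less
    interpret W: fd_rep G s W \<rho> by fact
    obtain B where B: "finite B" "W = vs.span B" using W.finite_dim by blast
    consider "W = {0}" | "irreducible_rep G s W \<rho>"
      | U where "U \<subseteq> W" "fd_rep G s U \<rho>" "U \<noteq> {0}" "U \<noteq> W"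
      using less(2) unfolding irreducible_rep_def by blast
    then show ?case
    proof cases
      case 1
      then show ?thesis unfolding decomp_def by (intro exI[of _ "{}"]) auto
    next
      case 2
      then show ?thesis unfolding decomp_def by (intro exI[of _ "{W}"]) auto
    next
      case U: 3
      interpret U: fd_rep G s U \<rho> by fact
      obtain X where X: "fd_rep G s X \<rho>" "X \<subseteq> W" "U \<inter> X = {0}" "\<And>v. v \<in> W \<Longrightarrow> \<exists>u\<in>U. \<exists>w\<in>X. v = u + w"
        using W.maschke[OF assms U(2,1)] by metis
      interpret X: fd_rep G s X \<rho> by fact
      have "X \<noteq> W" using X(3) U by auto
      then have dX: "vs.dim X < vs.dim W"
        using cvs.dim_psubset_subspace[OF X.subspace _ W.subspace _ B(1)] X(2) B(2) by blast
      have dU: "vs.dim U < vs.dim W"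
        using cvs.dim_psubset_subspace[OF U.subspace _ W.subspace _ B(1)] U B(2) by blast
      obtain \<X> where "decomp X \<X>" using less(1)[OF dX X(1)] ..
      note d = this[unfolded decomp_def]
      note \<X> = conjunct1[OF d] conjunct1[OF conjunct2[OF d]]
        conjunct1[OF conjunct2[OF conjunct2[OF d]]] conjunct2[OF conjunct2[OF conjunct2[OF d]]]
      obtain \<Y> where "decomp U \<Y>" using less(1)[OF dU U(2)] ..
      note d = this[unfolded decomp_def]
      note \<Y> = conjunct1[OF d] conjunct1[OF conjunct2[OF d]]
        conjunct1[OF conjunct2[OF conjunct2[OF d]]] conjunct2[OF conjunct2[OF conjunct2[OF d]]]
      \<comment> \<open>Families are indexed by the subspaces themselves, so a summand occurring in
        both would be counted only once in the union. Such a summand would lie in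
        \<open>U \<inter> X\<close>, which is zero.\<close>
      have disj: "\<X> \<inter> \<Y> = {}"
      proof (rule ccontr)
        assume "\<not> ?thesis"
        then obtain Z where Z: "Z \<in> \<X>" "Z \<in> \<Y>" by blast
        then have irr: "irreducible_rep G s Z \<rho>" using \<X> by blast
        have "Z \<subseteq> {0}" using Z \<X>(2) \<Y>(2) X(3) by blast
        moreover have "0 \<in> Z" using fd_rep.zero_in[OF irreducible_repD(1)[OF irr]] .
        ultimately show False using irreducible_repD(2)[OF irr] by blast
      qed
      show ?thesis
        unfolding decomp_def
      proof (intro exI[of _ "\<X> \<union> \<Y>"] conjI ballI allI impI)
        fix v assume "v \<in> W"
        then obtain u x where ux: "u \<in> U" "x \<in> X" "v = u + x" using X(4) by blast
        obtain w1 where w1: "\<forall>U\<in>\<X>. w1 U \<in> U" "(\<Sum>U\<in>\<X>. w1 U) = x"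
          using bspec[OF \<X>(3) ux(2)] by blast
        obtain w2 where w2: "\<forall>U\<in>\<Y>. w2 U \<in> U" "(\<Sum>U\<in>\<Y>. w2 U) = u"
          using bspec[OF \<Y>(3) ux(1)] by blast
        let ?w = "\<lambda>U. if U \<in> \<X> then w1 U else w2 U"
        have "(\<Sum>U\<in>\<X>. ?w U) = x" using w1(2) by simp
        moreover have "(\<Sum>U\<in>\<Y>. ?w U) = u" using w2(2) disj by (subst w2(2)[symmetric]) (intro sum.cong, auto)
        ultimately have "(\<Sum>U\<in>\<X> \<union> \<Y>. ?w U) = v"
          using \<X>(1) \<Y>(1) disj ux(3) by (simp add: sum.union_disjoint add.commute)
        then show "\<exists>w. (\<forall>U\<in>\<X> \<union> \<Y>. w U \<in> U) \<and> (\<Sum>U\<in>\<X> \<union> \<Y>. w U) = v"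
          using w1(1) w2(1) by (intro exI[of _ ?w]) auto
      next
        fix w Z assume w: "\<forall>U\<in>\<X> \<union> \<Y>. w U \<in> U" "(\<Sum>U\<in>\<X> \<union> \<Y>. w U) = 0" and Z: "Z \<in> \<X> \<union> \<Y>"
        have x: "(\<Sum>U\<in>\<X>. w U) \<in> X" using w(1) \<X>(2) by (intro vs.subspace_sum[OF X.subspace]) blast
        have y: "(\<Sum>U\<in>\<Y>. w U) \<in> U" using w(1) \<Y>(2) by (intro vs.subspace_sum[OF U.subspace]) blast
        have s0: "(\<Sum>U\<in>\<X>. w U) + (\<Sum>U\<in>\<Y>. w U) = 0"
          using w(2) \<X>(1) \<Y>(1) disj by (simp add: sum.union_disjoint)
        then have "(\<Sum>U\<in>\<Y>. w U) = - (\<Sum>U\<in>\<X>. w U)" by (simp add: add_eq_0_iff)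
        then have "(\<Sum>U\<in>\<Y>. w U) \<in> X" using x vs.subspace_neg[OF X.subspace] by simp
        then have "(\<Sum>U\<in>\<Y>. w U) = 0" using y X(3) by blast
        moreover from this have "(\<Sum>U\<in>\<X>. w U) = 0" using s0 by simp
        ultimately show "w Z = 0" using \<X>(4) \<Y>(4) w(1) Z by blast
      next
        show "finite (\<X> \<union> \<Y>)" using \<X>(1) \<Y>(1) by simp
      next
        fix Z assume "Z \<in> \<X> \<union> \<Y>"
        then show "Z \<subseteq> W" "irreducible_rep G s Z \<rho>" using \<X>(2) \<Y>(2) X(2) U(1) by blast+
      qed
    qed
  qed
  then obtain \<U> where "decomp V \<U>" using fd_rep_axioms by blast
  note d = this[unfolded decomp_def]
  note \<U> = conjunct1[OF d] conjunct1[OF conjunct2[OF d]]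
    conjunct1[OF conjunct2[OF conjunct2[OF d]]] conjunct2[OF conjunct2[OF conjunct2[OF d]]]
  have "direct_sum V \<U>"
  proof (rule direct_sumI)
    show "\<exists>w. (\<forall>U\<in>\<U>. w U \<in> U) \<and> (\<Sum>U\<in>\<U>. w U) = v" if "v \<in> V" for v
      using bspec[OF \<U>(3) that] .
    show "\<forall>U\<in>\<U>. w U = 0" if "\<forall>U\<in>\<U>. w U \<in> U" "(\<Sum>U\<in>\<U>. w U) = 0" for w
      using \<U>(4)[rule_format, of w] that by blast
  next
    fix U x y assume U: "U \<in> \<U>" and xy: "x \<in> U" "y \<in> U"
    have "fd_rep G s U \<rho>" using \<U>(2) U irreducible_repD(1) by blast
    then show "x - y \<in> U" using vs.subspace_diff[OF fd_rep.subspace xy] by blast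
  qed
  then show ?thesis using that[OF \<U>(1,2)] by blast
qed

text \<open>Components are unique, so additivity, homogeneity and equivariance of the projections
  each follow by exhibiting a second decomposition of the same vector; \<open>uniq\<close> packages
  this argument.\<close>

lemma (in fd_rep) direct_sum_projections:
  assumes fin: "finite \<U>" and sub: "\<And>U. U \<in> \<U> \<Longrightarrow> U \<subseteq> V \<and> fd_rep G s U \<rho>" and ds: "direct_sum V \<U>"
  obtains pr where
    "\<forall>U\<in>\<U>. linear_on s s V (pr U)"
    "\<forall>U\<in>\<U>. equivariant_on G V \<rho> (pr U)"
    "\<forall>U\<in>\<U>. \<forall>v\<in>V. pr U v \<in> U"
    "\<forall>U\<in>\<U>. \<forall>u\<in>U. pr U u = u"
    "\<forall>U\<in>\<U>. \<forall>U'\<in>\<U>. U \<noteq> U' \<longrightarrow> (\<forall>u\<in>U'. pr U u = 0)"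
    "\<forall>v\<in>V. (\<Sum>U\<in>\<U>. pr U v) = v"
proof -
  define c where "c v = (THE w. w \<in> (\<Pi>\<^sub>E U\<in>\<U>. U) \<and> (\<Sum>U\<in>\<U>. w U) = v)" for v
  have c: "c v \<in> (\<Pi>\<^sub>E U\<in>\<U>. U)" "(\<Sum>U\<in>\<U>. c v U) = v" if "v \<in> V" for v
  proof -
    have "\<exists>!w. w \<in> (\<Pi>\<^sub>E U\<in>\<U>. U) \<and> (\<Sum>U\<in>\<U>. w U) = v"
      using ds that unfolding direct_sum_def by (rule bspec)
    from theI'[OF this] show "c v \<in> (\<Pi>\<^sub>E U\<in>\<U>. U)" "(\<Sum>U\<in>\<U>. c v U) = v"
      unfolding c_def by (rule conjunct1, rule conjunct2)
  qed
  have uniq: "c v U = w U" if "\<And>U. U \<in> \<U> \<Longrightarrow> w U \<in> U" "(\<Sum>U\<in>\<U>. w U) = v" "v \<in> V" "U \<in> \<U>" for v w U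
  proof -
    have "restrict w \<U> \<in> (\<Pi>\<^sub>E U\<in>\<U>. U) \<and> (\<Sum>U\<in>\<U>. restrict w \<U> U) = v" using that by auto
    moreover have "\<exists>!w. w \<in> (\<Pi>\<^sub>E U\<in>\<U>. U) \<and> (\<Sum>U\<in>\<U>. w U) = v"
      using ds that(3) unfolding direct_sum_def by (rule bspec)
    ultimately have "restrict w \<U> = c v" using c[OF that(3)] by (elim ex1E) metis
    then show ?thesis using restrict_apply'[OF that(4), of w] by simp
  qed
  have cU: "c v U \<in> U" if "v \<in> V" "U \<in> \<U>" for v U using c(1)[OF that(1)] that(2) by (auto simp: PiE_iff)
  have cV: "c v U \<in> V" if "v \<in> V" "U \<in> \<U>" for v U using cU that sub by blast
  have sU: "vs.subspace U" if "U \<in> \<U>" for U using sub[OF that] fd_rep.subspace by blast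
  have single: "c u U = (if U = U' then u else 0)" if "U \<in> \<U>" "U' \<in> \<U>" "u \<in> U'" for u U U'
    by (rule uniq) (use that fin sub vs.subspace_0[OF sU] in \<open>auto simp: sum.delta if_distrib\<close>)
  have "linear_on s s V (\<lambda>v. c v U) \<and> equivariant_on G V \<rho> (\<lambda>v. c v U)" if U: "U \<in> \<U>" for U
  proof
    show "linear_on s s V (\<lambda>v. c v U)"
      unfolding linear_on_def
    proof (intro conjI ballI allI)
      fix u v assume uv: "u \<in> V" "v \<in> V"
      show "c (u + v) U = c u U + c v U"
        by (rule uniq) (use uv U c cU vs.subspace_add[OF sU] vs.subspace_add[OF subspace] in \<open>auto simp: sum.distrib\<close>)
    next
      fix a v assume v: "v \<in> V"
      show "c (s a v) U = s a (c v U)"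
        by (rule uniq) (use v U c cU vs.subspace_scale[OF sU] vs.subspace_scale[OF subspace] in
            \<open>auto simp: vs.scale_sum_right[symmetric]\<close>)
    qed
    show "equivariant_on G V \<rho> (\<lambda>v. c v U)"
      unfolding equivariant_on_def
    proof (intro ballI)
      fix g v assume g: "g \<in> carrier G" and v: "v \<in> V"
      show "c (\<rho> g v) U = \<rho> g (c v U)"
      proof (rule uniq)
        show "\<rho> g (c v U') \<in> U'" if "U' \<in> \<U>" for U'
          using fd_rep.closed[OF conjunct2[OF sub[OF that]] g cU[OF v that]] .
        show "(\<Sum>U\<in>\<U>. \<rho> g (c v U)) = \<rho> g v"
          using rho_sum[OF g, of \<U> "c v"] cV[OF v] c(2)[OF v] by simp
      qed (use g v closed U in auto)
    qed
  qed
  then show ?thesis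
    by (intro that[of "\<lambda>U v. c v U"]) (simp_all add: c cU single)
qed

text \<open>An equivariant endomorphism has no component between distinct summands, as these are not
  isomorphic, and it is a scalar on each summand.\<close>

lemma equivariant_endos_commute:
  assumes mf: "multiplicity_free G s V \<rho>"
    and S: "linear_on s s V S" "equivariant_on G V \<rho> S" "S ` V \<subseteq> V"
    and T: "linear_on s s V T" "equivariant_on G V \<rho> T" "T ` V \<subseteq> V"
    and v: "v \<in> V"
  shows "S (T v) = T (S v)"
proof -
  interpret fd_rep G s V \<rho> using mf unfolding multiplicity_free_def by (rule conjunct1)
  \<comment> \<open>\<open>direct_sum\<close> is verbatim the last clause of
    \<open>multiplicity_free\<close>, so it can be folded into that definition.\<close>
  obtain \<U> where d: "finite \<U> \<and> (\<forall>U\<in>\<U>. U \<subseteq> V \<and> irreducible_rep G s U \<rho>) \<and>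
      (\<forall>U\<in>\<U>. \<forall>U'\<in>\<U>. U \<noteq> U' \<longrightarrow> \<not> isomorphic_reps G s U \<rho> s U' \<rho>) \<and> direct_sum V \<U>"
    using conjunct2[OF mf[unfolded multiplicity_free_def, folded direct_sum_def]] by (rule exE)
  have \<U>: "finite \<U>" "\<And>U. U \<in> \<U> \<Longrightarrow> U \<subseteq> V \<and> irreducible_rep G s U \<rho>"
    "\<And>U U'. U \<in> \<U> \<Longrightarrow> U' \<in> \<U> \<Longrightarrow> U \<noteq> U' \<Longrightarrow> \<not> isomorphic_reps G s U \<rho> s U' \<rho>" "direct_sum V \<U>"
    using conjunct1[OF d] conjunct1[OF conjunct2[OF d]] conjunct1[OF conjunct2[OF conjunct2[OF d]]]
      conjunct2[OF conjunct2[OF conjunct2[OF d]]] by auto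
  have sub: "U \<subseteq> V \<and> fd_rep G s U \<rho>" if "U \<in> \<U>" for U
    using \<U>(2)[OF that] irreducible_repD(1) by blast
  obtain pr where prs:
    "\<forall>U\<in>\<U>. linear_on s s V (pr U)"
    "\<forall>U\<in>\<U>. equivariant_on G V \<rho> (pr U)"
    "\<forall>U\<in>\<U>. \<forall>v\<in>V. pr U v \<in> U"
    "\<forall>U\<in>\<U>. \<forall>u\<in>U. pr U u = u"
    "\<forall>U\<in>\<U>. \<forall>U'\<in>\<U>. U \<noteq> U' \<longrightarrow> (\<forall>u\<in>U'. pr U u = 0)"
    "\<forall>v\<in>V. (\<Sum>U\<in>\<U>. pr U v) = v"
    using direct_sum_projections[OF \<U>(1) sub \<U>(4)] .
  note pr = prs[rule_format]
  have stable: "T u \<in> U" if T: "linear_on s s V T" "equivariant_on G V \<rho> T" "T ` V \<subseteq> V"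
    and U: "U \<in> \<U>" and u: "u \<in> U" for T U u
  proof -
    have uV: "u \<in> V" using U u \<U>(2) by blast
    have "pr U' (T u) = 0" if U': "U' \<in> \<U>" "U' \<noteq> U" for U'
    proof (rule schur_zero_or_iso[where T="\<lambda>v. pr U' (T v)"])
      show "linear_on s s U (\<lambda>v. pr U' (T v))"
        using linear_on_comp[OF cvs.linear_on_subset[OF T(1)] pr(1)[OF U'(1)]] \<U>(2)[OF U] T(3) by blast
      show "equivariant_on G U \<rho> (\<lambda>v. pr U' (T v))"
        using T(2,3) pr(2)[OF U'(1)] \<U>(2)[OF U] unfolding equivariant_on_def image_subset_iff by auto
      show "(\<lambda>v. pr U' (T v)) ` U \<subseteq> U'"
        using T(3) pr(3)[OF U'(1)] \<U>(2)[OF U] by (auto simp: image_subset_iff)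
    qed (use \<U> U U' u in auto)
    then have "(\<Sum>U'\<in>\<U>. pr U' (T u)) = pr U (T u)"
      using U \<U>(1) by (subst sum.remove[of _ U]) auto
    then show ?thesis using pr(3,6) T(3) uV U by (metis image_subset_iff)
  qed
  have comm: "S (T u) = T (S u)" if U: "U \<in> \<U>" and u: "u \<in> U" for U u
  proof -
    have irr: "irreducible_rep G s U \<rho>" and UV: "U \<subseteq> V" using \<U> U by auto
    have "\<exists>c. \<forall>v\<in>U. T v = s c v"
      if T: "linear_on s s V T" "equivariant_on G V \<rho> T" "T ` V \<subseteq> V" for T
      using schur_scalar[OF irr cvs.linear_on_subset[OF T(1) UV], of thesis for thesis] stable[OF T U] T(2) UV
      unfolding equivariant_on_def by (metis image_subsetI subsetD)
    then obtain a b where a: "\<forall>v\<in>U. S v = s a v" and b: "\<forall>v\<in>U. T v = s b v" using S T by metis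
    show ?thesis using a b u stable[OF S U u] stable[OF T U u] by (simp add: mult.commute)
  qed
  have prV: "pr U v \<in> V" if "U \<in> \<U>" for U using pr(3)[OF that v] \<U>(2)[OF that] by blast
  have "S (T v) = (\<Sum>U\<in>\<U>. S (T (pr U v)))"
    using cvs.linear_on_sum[OF T(1) subspace, of \<U> "\<lambda>U. pr U v"]
      cvs.linear_on_sum[OF S(1) subspace, of \<U> "\<lambda>U. T (pr U v)"] prV T(3) pr(6)[OF v]
    by (simp add: image_subset_iff)
  also have "\<dots> = (\<Sum>U\<in>\<U>. T (S (pr U v)))" using comm pr(3)[OF _ v] by (intro sum.cong) auto
  also have "\<dots> = T (S v)"
    using cvs.linear_on_sum[OF S(1) subspace, of \<U> "\<lambda>U. pr U v"]
      cvs.linear_on_sum[OF T(1) subspace, of \<U> "\<lambda>U. S (pr U v)"] prV S(3) pr(6)[OF v]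
    by (simp add: image_subset_iff)
  finally show ?thesis .
qed

text \<open>If distinct summands U and U' were isomorphic, then the projection to U followed by the
  isomorphism to U' would not commute with the projection to U: on U one composite is the
  isomorphism and the other is zero.\<close>

lemma multiplicity_freeI:
  assumes rep: "fd_rep G s V \<rho>" and fin: "finite (carrier G)"
    and comm: "\<And>S T v. linear_on s s V S \<Longrightarrow> equivariant_on G V \<rho> S \<Longrightarrow> S ` V \<subseteq> V \<Longrightarrow>
      linear_on s s V T \<Longrightarrow> equivariant_on G V \<rho> T \<Longrightarrow> T ` V \<subseteq> V \<Longrightarrow> v \<in> V \<Longrightarrow> S (T v) = T (S v)"
  shows "multiplicity_free G s V \<rho>"
proof -
  interpret fd_rep G s V \<rho> by fact
  obtain \<U> where Us: "finite \<U>" "\<forall>U\<in>\<U>. U \<subseteq> V \<and> irreducible_rep G s U \<rho>" "direct_sum V \<U>"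
    using irreducible_decomposition[OF fin] .
  note \<U> = Us[rule_format]
  have sub: "U \<subseteq> V \<and> fd_rep G s U \<rho>" if "U \<in> \<U>" for U
    using \<U>(2)[OF that] irreducible_repD(1) by blast
  obtain pr where prs:
    "\<forall>U\<in>\<U>. linear_on s s V (pr U)"
    "\<forall>U\<in>\<U>. equivariant_on G V \<rho> (pr U)"
    "\<forall>U\<in>\<U>. \<forall>v\<in>V. pr U v \<in> U"
    "\<forall>U\<in>\<U>. \<forall>u\<in>U. pr U u = u"
    "\<forall>U\<in>\<U>. \<forall>U'\<in>\<U>. U \<noteq> U' \<longrightarrow> (\<forall>u\<in>U'. pr U u = 0)"
    "\<forall>v\<in>V. (\<Sum>U\<in>\<U>. pr U v) = v"
    using direct_sum_projections[OF \<U>(1) sub \<U>(3)] .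
  note pr = prs[rule_format]
  have "\<not> isomorphic_reps G s U \<rho> s U' \<rho>" if U: "U \<in> \<U>" "U' \<in> \<U>" "U \<noteq> U'" for U U'
  proof
    assume "isomorphic_reps G s U \<rho> s U' \<rho>"
    then obtain T where T: "bij_betw T U U'" "linear_on s s U T"
      "\<forall>g\<in>carrier G. \<forall>v\<in>U. T (\<rho> g v) = \<rho> g (T v)"
      unfolding isomorphic_reps_def by blast
    have UV: "U \<subseteq> V" "U' \<subseteq> V" and irr: "irreducible_rep G s U \<rho>" using \<U>(2) U by auto
    interpret U: fd_rep G s U \<rho> using irreducible_repD(1)[OF irr] .
    have TU: "T u \<in> U'" if "u \<in> U" for u using T(1) that unfolding bij_betw_def by blast
    define E where "E v = T (pr U v)" for v
    have E: "linear_on s s V E" "equivariant_on G V \<rho> E" "E ` V \<subseteq> V"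
      using pr(1-3)[OF U(1)] T(2,3) TU UV unfolding E_def linear_on_def equivariant_on_def by auto
    obtain u where u: "u \<in> U" "u \<noteq> 0" using irreducible_repD(2)[OF irr] U.zero_in by blast
    have "E (pr U u) = pr U (E u)"
      by (rule comm[OF E pr(1,2)[OF U(1)]]) (use pr(3)[OF U(1)] UV u in auto)
    then have "T u = 0"
      using pr(4)[OF U(1) u(1)] pr(5)[OF U TU[OF u(1)]] unfolding E_def by simp
    moreover have "T 0 = 0" using cvs.linear_on_zero[OF T(2) U.subspace] .
    ultimately show False
      using T(1) u U.zero_in unfolding bij_betw_def inj_on_def by metis
  qed
  then show ?thesis
    unfolding multiplicity_free_def direct_sum_def[symmetric]
    by (intro conjI exI[of _ \<U>] rep ballI impI) (simp_all add: \<U>)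
qed

text \<open>
  For a functional \<open>\<mu>\<close>, the average of \<open>\<rho> k (x \<otimes> \<mu>) \<rho> (k\<^sup>-\<^sup>1)\<close> is a scalar by Schur's lemma, and the
  scalar is found by taking traces. Hence every rank one operator lies in the span of the \<open>\<rho> k\<close>.
\<close>

lemma burnside:
  fixes G (structure)
  assumes irr: "irreducible_rep G s V \<rho>" and fin: "finite (carrier G)"
    and A: "linear_on s s V A" "A ` V \<subseteq> V"
  obtains a where "\<forall>x\<in>V. A x = (\<Sum>k\<in>carrier G. s (a k) (\<rho> k x))"
proof -
  interpret fd_rep G s V \<rho> using irreducible_repD(1)[OF irr] .
  obtain B where B: "finite B" "V = vs.span B" "vs.independent B" "B \<subseteq> V" using finite_spanning .
  define \<mu> where "\<mu> b v = vs.representation B v b" for b v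
  have exp: "(\<Sum>b\<in>B. s (\<mu> b v) b) = v" if "v \<in> V" for v
    unfolding \<mu>_def using vs.sum_representation_eq[OF B(3) _ B(1) order_refl] that B(2) by auto
  have mu_add: "\<mu> b (u + v) = \<mu> b u + \<mu> b v" if "u \<in> V" "v \<in> V" for b u v
    unfolding \<mu>_def using vs.representation_add[OF B(3)] that B(2) by auto
  have mu_scale: "\<mu> b (s c v) = c * \<mu> b v" if "v \<in> V" for b c v
    unfolding \<mu>_def using vs.representation_scale[OF B(3)] that B(2) by auto
  have mu_sum: "\<mu> b (\<Sum>i\<in>I. f i) = (\<Sum>i\<in>I. \<mu> b (f i))" if "\<And>i. i \<in> I \<Longrightarrow> f i \<in> V"
    for b and I :: "'x set" and f
    unfolding \<mu>_def using vs.representation_sum[OF B(3), of I f] that B(2) by auto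
  define n where "n = (of_nat (card (carrier G)) :: complex)"
  define d where "d = (of_nat (card B) :: complex)"
  have n: "n \<noteq> 0" using fin grp.one_closed unfolding n_def by auto
  have "B \<noteq> {}" using irreducible_repD(2)[OF irr] B(2) by auto
  then have d: "d \<noteq> 0" using B(1) unfolding d_def by auto
  have avg: "(\<Sum>k\<in>carrier G. s (\<mu> b (\<rho> (inv k) w)) (\<rho> k x)) = s (n / d * \<mu> b x) w"
    if x: "x \<in> V" and w: "w \<in> V" for b x w
  proof -
    define L where "L w = (\<Sum>k\<in>carrier G. s (\<mu> b (\<rho> (inv k) w)) (\<rho> k x))" for w
    have "linear_on s s V L"
      unfolding linear_on_def L_def
      using x by (auto simp: rho_add mu_add mu_scale rho_scale closed vs.scale_left_distrib sum.distrib vs.scale_sum_right)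
    moreover have "equivariant_on G V \<rho> L"
      unfolding equivariant_on_def
    proof (intro ballI)
      fix g v assume g: "g \<in> carrier G" and v: "v \<in> V"
      have "L (\<rho> g v) = (\<Sum>k\<in>carrier G. s (\<mu> b (\<rho> (inv (g \<otimes> k)) (\<rho> g v))) (\<rho> (g \<otimes> k) x))"
        unfolding L_def
        by (rule sum.reindex_bij_witness[where i="\<lambda>k. g \<otimes> k" and j="\<lambda>k. inv g \<otimes> k"])
          (use g in \<open>auto simp: grp.m_assoc[symmetric]\<close>)
      also have "\<dots> = (\<Sum>k\<in>carrier G. \<rho> g (s (\<mu> b (\<rho> (inv k) v)) (\<rho> k x)))"
        using g v x by (intro sum.cong) (auto simp: grp.inv_mult_group mult closed inv_cancel rho_scale)
      also have "\<dots> = \<rho> g (L v)"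
        unfolding L_def using g x closed vs.subspace_scale[OF subspace] by (subst rho_sum) auto
      finally show "L (\<rho> g v) = \<rho> g (L v)" .
    qed
    moreover have "L ` V \<subseteq> V"
      unfolding L_def using x closed by (auto intro!: vs.subspace_sum[OF subspace] vs.subspace_scale[OF subspace])
    ultimately obtain c where c: "\<And>v. v \<in> V \<Longrightarrow> L v = s c v" using schur_scalar[OF irr] by metis
    have muB: "\<mu> e e = 1" if "e \<in> B" for e
      unfolding \<mu>_def using vs.representation_basis[OF B(3) that] by simp
    have "(\<Sum>e\<in>B. \<mu> e (L e)) = (\<Sum>e\<in>B. c)"
      using c B(4) muB by (intro sum.cong) (auto simp: mu_scale)
    then have "c * d = (\<Sum>e\<in>B. \<mu> e (L e))" by (simp add: d_def)
    also have "\<dots> = (\<Sum>e\<in>B. \<Sum>k\<in>carrier G. \<mu> b (\<rho> (inv k) e) * \<mu> e (\<rho> k x))"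
      unfolding L_def using x closed vs.subspace_scale[OF subspace]
      by (intro sum.cong refl) (subst mu_sum, auto simp: mu_scale)
    also have "\<dots> = (\<Sum>k\<in>carrier G. \<Sum>e\<in>B. \<mu> b (\<rho> (inv k) (s (\<mu> e (\<rho> k x)) e)))"
      using B(4) x closed by (subst sum.swap) (intro sum.cong refl, auto simp: rho_scale mu_scale subset_iff)
    also have "\<dots> = (\<Sum>k\<in>carrier G. \<mu> b x)"
    proof (rule sum.cong[OF refl])
      fix k assume k: "k \<in> carrier G"
      have in_V: "s (\<mu> e (\<rho> k x)) e \<in> V" if "e \<in> B" for e
        using that B(4) vs.subspace_scale[OF subspace] by blast
      have "(\<Sum>e\<in>B. \<mu> b (\<rho> (inv k) (s (\<mu> e (\<rho> k x)) e))) = \<mu> b (\<rho> (inv k) (\<Sum>e\<in>B. s (\<mu> e (\<rho> k x)) e))"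
        using in_V k closed by (subst rho_sum) (auto simp: mu_sum)
      also have "\<dots> = \<mu> b x" using exp[OF closed[OF k x]] inv_cancel(1)[OF k x] by simp
      finally show "(\<Sum>e\<in>B. \<mu> b (\<rho> (inv k) (s (\<mu> e (\<rho> k x)) e))) = \<mu> b x" .
    qed
    finally have "c = n / d * \<mu> b x" using d by (simp add: n_def field_simps)
    then show ?thesis using c[OF w] unfolding L_def by simp
  qed
  \<comment> \<open>The operator A is the sum over b of the rank one operators x -> \<mu> b x times
    A b; \<open>avg\<close> with w = A b expands each of them.\<close>
  define a where "a k = (\<Sum>b\<in>B. d / n * \<mu> b (\<rho> (inv k) (A b)))" for k
  have AV: "A v \<in> V" if "v \<in> V" for v using A(2) that by blast
  have "A x = (\<Sum>k\<in>carrier G. s (a k) (\<rho> k x))" if x: "x \<in> V" for x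
  proof -
    have "(\<Sum>k\<in>carrier G. s (a k) (\<rho> k x)) =
        (\<Sum>b\<in>B. s (d / n) (\<Sum>k\<in>carrier G. s (\<mu> b (\<rho> (inv k) (A b))) (\<rho> k x)))"
      unfolding a_def vs.scale_sum_left by (subst sum.swap) (simp add: vs.scale_sum_right)
    also have "\<dots> = (\<Sum>b\<in>B. s (\<mu> b x) (A b))"
      using B(4) AV x n d by (intro sum.cong refl) (subst avg, auto)
    also have "\<dots> = A (\<Sum>b\<in>B. s (\<mu> b x) b)"
      using B(4) A(1) by (subst cvs.linear_on_sum[OF A(1) subspace])
        (auto simp: linear_on_def intro!: sum.cong vs.subspace_scale[OF subspace])
    also have "\<dots> = A x" using exp[OF x] by simp
    finally show ?thesis by simp
  qed
  then show ?thesis using that by blast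
qed


section \<open>Induced representations and invariant functions\<close>

lemma vector_space_fun_scale: "vector_space s \<Longrightarrow> vector_space (fun_scale s)"
  unfolding vector_space_def fun_scale_def by (auto simp: fun_eq_iff)

lemma vector_space_complex_mult: "vector_space ((*) :: complex \<Rightarrow> complex \<Rightarrow> complex)"
  by unfold_locales (auto simp: algebra_simps)

lemma sum_fun_apply: "(\<Sum>i\<in>A. f i) x = (\<Sum>i\<in>A. f i x)"
  by (induction A rule: infinite_finite_induct) auto

lemma functions_in_finite_span:
  fixes s :: "complex \<Rightarrow> 'v::ab_group_add \<Rightarrow> 'v" and f :: "'a \<Rightarrow> 'v"
  assumes vs: "vector_space s" and S: "finite S"
    and f: "\<And>x. x \<notin> S \<Longrightarrow> f x = 0" "\<And>x. x \<in> S \<Longrightarrow> f x \<in> module.span s B"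
  shows "f \<in> module.span (fun_scale s) ((\<lambda>(x, b) y. if y = x then b else 0) ` (S \<times> B))"
proof -
  interpret v: vector_space s by fact
  interpret w: vector_space "fun_scale s :: complex \<Rightarrow> ('a \<Rightarrow> 'v) \<Rightarrow> _" by (rule vector_space_fun_scale[OF vs])
  let ?pt = "\<lambda>x b y. if y = x then b else (0 :: 'v)"
  let ?C = "(\<lambda>(x, b). ?pt x b) ` (S \<times> B)"
  have pt: "?pt x b \<in> w.span ?C" if x: "x \<in> S" and b: "b \<in> v.span B" for x b
    using b
  proof (induction rule: v.span_induct_alt)
    case base
    have "?pt x 0 = 0" by auto
    then show ?case using w.span_zero by simp
  next
    case (step c b b')
    have eq: "?pt x (s c b + b') = fun_scale s c (?pt x b) + ?pt x b'"
      by (auto simp: fun_scale_def fun_eq_iff)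
    have "?pt x b \<in> w.span ?C" using step(1) x by (intro w.span_base) force
    then show ?case unfolding eq using step(2) by (intro w.span_add w.span_scale)
  qed
  have eq: "f = (\<Sum>x\<in>S. ?pt x (f x))"
  proof
    fix y show "f y = (\<Sum>x\<in>S. ?pt x (f x)) y"
      using f(1)[of y] S by (auto simp: sum_fun_apply)
  qed
  show ?thesis by (subst eq) (intro w.span_sum pt f(2))
qed

lemma fd_repI:
  assumes "group G" "vector_space s" "module.subspace s V" "V \<subseteq> module.span s B" "finite B"
    "\<And>g v. g \<in> carrier G \<Longrightarrow> v \<in> V \<Longrightarrow> \<rho> g v \<in> V"
    "\<And>g. g \<in> carrier G \<Longrightarrow> linear_on s s V (\<rho> g)"
    "\<And>v. v \<in> V \<Longrightarrow> \<rho> \<one>\<^bsub>G\<^esub> v = v"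
    "\<And>g h v. g \<in> carrier G \<Longrightarrow> h \<in> carrier G \<Longrightarrow> v \<in> V \<Longrightarrow> \<rho> (g \<otimes>\<^bsub>G\<^esub> h) v = \<rho> g (\<rho> h v)"
  shows "fd_rep G s V \<rho>"
proof -
  interpret complex_vector_space s unfolding complex_vector_space_def by fact
  obtain C where "finite C" "span C = V" using finite_basis_of_subspace[OF assms(3-5)] .
  then show ?thesis
    using assms by (intro fd_rep.intro fd_rep_axioms.intro) auto
qed

section \<open>Convolution and its action on induced representations\<close>

definition conv :: "('g, 'm) monoid_scheme \<Rightarrow> ('g \<Rightarrow> complex) \<Rightarrow> ('g \<Rightarrow> complex) \<Rightarrow> 'g \<Rightarrow> complex" where
  "conv G x y g = (\<Sum>h\<in>carrier G. x h * y (inv\<^bsub>G\<^esub> h \<otimes>\<^bsub>G\<^esub> g))"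

definition conj_invariant :: "('g, 'm) monoid_scheme \<Rightarrow> 'g set \<Rightarrow> ('g \<Rightarrow> complex) \<Rightarrow> bool" where
  "conj_invariant G K x \<longleftrightarrow> (\<forall>k\<in>K. \<forall>g\<in>carrier G. x (k \<otimes>\<^bsub>G\<^esub> g \<otimes>\<^bsub>G\<^esub> inv\<^bsub>G\<^esub> k) = x g)"

text \<open>The group algebra acting through right translation of the argument. It commutes with the
  left translations of \<open>ind_action\<close>, and composition corresponds to \<open>conv\<close>
  in the same order.\<close>

definition rmul :: "('g, 'm) monoid_scheme \<Rightarrow> (complex \<Rightarrow> 'v \<Rightarrow> 'v) \<Rightarrow> ('g \<Rightarrow> complex) \<Rightarrow>
    ('g \<Rightarrow> 'v::ab_group_add) \<Rightarrow> 'g \<Rightarrow> 'v" where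
  "rmul G s z f = (\<lambda>g. if g \<in> carrier G then \<Sum>h\<in>carrier G. s (z h) (f (g \<otimes>\<^bsub>G\<^esub> h)) else 0)"

locale group_with_subgroup = group G for G :: "('g, 'm) monoid_scheme" (structure) +
  fixes K
  assumes fin: "finite (carrier G)" and subgroup: "subgroup K G"
begin

abbreviation "GK \<equiv> G\<lparr>carrier := K\<rparr>"

lemma K_carrier: "k \<in> K \<Longrightarrow> k \<in> carrier G"
  using subgroup by (rule subgroup.mem_carrier)

lemma K_closed: "k \<in> K \<Longrightarrow> l \<in> K \<Longrightarrow> k \<otimes> l \<in> K" "k \<in> K \<Longrightarrow> inv k \<in> K" "\<one> \<in> K"
  using subgroup by (auto intro: subgroup.m_closed subgroup.m_inv_closed subgroup.one_closed)

lemma finK: "finite K" using fin subgroup finite_subset subgroup.subset by blast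

lemma groupK: "group GK" using subgroup by (rule subgroup_imp_group)

lemma cardK: "of_nat (card K) \<noteq> (0 :: complex)" using finK K_closed(3) by auto

lemma inv_GK: "k \<in> K \<Longrightarrow> inv\<^bsub>GK\<^esub> k = inv k"
  using m_inv_consistent[OF subgroup] .

lemma cancel: "g \<in> carrier G \<Longrightarrow> h \<in> carrier G \<Longrightarrow> inv g \<otimes> (g \<otimes> h) = h"
   "g \<in> carrier G \<Longrightarrow> h \<in> carrier G \<Longrightarrow> g \<otimes> (inv g \<otimes> h) = h"
   "g \<in> carrier G \<Longrightarrow> h \<in> carrier G \<Longrightarrow> h \<otimes> inv g \<otimes> g = h"
   "g \<in> carrier G \<Longrightarrow> h \<in> carrier G \<Longrightarrow> h \<otimes> g \<otimes> inv g = h"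
  by (simp_all add: m_assoc[symmetric]) (simp_all add: m_assoc)

lemma sum_left_translate: "a \<in> carrier G \<Longrightarrow> (\<Sum>g\<in>carrier G. F (a \<otimes> g)) = (\<Sum>g\<in>carrier G. F g)"
  by (rule sum.reindex_bij_witness[where i="\<lambda>g. inv a \<otimes> g" and j="\<lambda>g. a \<otimes> g"]) (auto simp: cancel)

lemma sum_right_translate: "a \<in> carrier G \<Longrightarrow> (\<Sum>g\<in>carrier G. F (g \<otimes> a)) = (\<Sum>g\<in>carrier G. F g)"
  by (rule sum.reindex_bij_witness[where i="\<lambda>g. g \<otimes> inv a" and j="\<lambda>g. g \<otimes> a"]) (auto simp: cancel)

lemma sum_conj: "a \<in> carrier G \<Longrightarrow> (\<Sum>g\<in>carrier G. F (a \<otimes> g \<otimes> inv a)) = (\<Sum>g\<in>carrier G. F g)"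
  using sum_left_translate[of a "\<lambda>g. F (g \<otimes> inv a)"] sum_right_translate[of "inv a" F] by simp

lemma rmul_rmul:
  assumes "vector_space s" and g: "g \<in> carrier G"
  shows "rmul G s x (rmul G s y f) g = rmul G s (conv G x y) f g"
proof -
  interpret vector_space s by fact
  have "rmul G s x (rmul G s y f) g = (\<Sum>h\<in>carrier G. \<Sum>k\<in>carrier G. s (x h * y k) (f (g \<otimes> h \<otimes> k)))"
    using g by (simp add: rmul_def scale_sum_right)
  also have "\<dots> = (\<Sum>h\<in>carrier G. \<Sum>m\<in>carrier G. s (x h * y (inv h \<otimes> m)) (f (g \<otimes> m)))"
  proof (rule sum.cong[OF refl])
    fix h assume h: "h \<in> carrier G"
    have "(\<Sum>k\<in>carrier G. s (x h * y k) (f (g \<otimes> h \<otimes> k))) =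
        (\<Sum>k\<in>carrier G. s (x h * y (inv h \<otimes> (h \<otimes> k))) (f (g \<otimes> (h \<otimes> k))))"
      using g h by (intro sum.cong) (auto simp: cancel m_assoc)
    then show "(\<Sum>k\<in>carrier G. s (x h * y k) (f (g \<otimes> h \<otimes> k))) =
        (\<Sum>m\<in>carrier G. s (x h * y (inv h \<otimes> m)) (f (g \<otimes> m)))"
      using sum_left_translate[OF h, of "\<lambda>m. s (x h * y (inv h \<otimes> m)) (f (g \<otimes> m))"] by simp
  qed
  also have "\<dots> = rmul G s (conv G x y) f g"
    using g by (subst sum.swap) (simp add: rmul_def conv_def scale_sum_left)
  finally show ?thesis .
qed

end

locale induction_datum = group_with_subgroup G K + rep: fd_rep "G\<lparr>carrier := K\<rparr>" s V \<rho>
  for G :: "('g, 'm) monoid_scheme" (structure) and K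
    and s :: "complex \<Rightarrow> 'v::ab_group_add \<Rightarrow> 'v" and V \<rho>
begin

abbreviation "Ind \<equiv> ind_space G K V \<rho>"

lemma IndD:
  assumes "f \<in> Ind"
  shows "g \<notin> carrier G \<Longrightarrow> f g = 0" "g \<in> carrier G \<Longrightarrow> f g \<in> V"
    "g \<in> carrier G \<Longrightarrow> k \<in> K \<Longrightarrow> f (g \<otimes> k) = \<rho> (inv k) (f g)"
  using assms unfolding ind_space_def by auto

lemma lin: "k \<in> K \<Longrightarrow> u \<in> V \<Longrightarrow> v \<in> V \<Longrightarrow> \<rho> k (u + v) = \<rho> k u + \<rho> k v"
  "k \<in> K \<Longrightarrow> u \<in> V \<Longrightarrow> \<rho> k (s c u) = s c (\<rho> k u)"
  "k \<in> K \<Longrightarrow> \<rho> k 0 = 0"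
  using rep.linear[of k] rep.cvs.linear_on_zero[OF rep.linear rep.subspace, of k] unfolding linear_on_def by auto

lemma rho_sum: "k \<in> K \<Longrightarrow> (\<And>i. i \<in> A \<Longrightarrow> f i \<in> V) \<Longrightarrow> \<rho> k (\<Sum>i\<in>A. f i) = (\<Sum>i\<in>A. \<rho> k (f i))"
  using rep.rho_sum[of k A f] by simp

lemma rho_mult: "k \<in> K \<Longrightarrow> l \<in> K \<Longrightarrow> v \<in> V \<Longrightarrow> \<rho> k (\<rho> l v) = \<rho> (k \<otimes> l) v"
  using rep.mult[of k l v] by simp

lemma rho_one: "v \<in> V \<Longrightarrow> \<rho> \<one> v = v" using rep.one by simp

lemma rho_closed: "k \<in> K \<Longrightarrow> v \<in> V \<Longrightarrow> \<rho> k v \<in> V" using rep.closed by simp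

lemma ind_rep: "fd_rep G (fun_scale s) Ind (ind_action G)"
proof -
  obtain B where B: "finite B" "V = rep.vs.span B" using rep.finite_dim by blast
  interpret w: vector_space "fun_scale s :: complex \<Rightarrow> ('g \<Rightarrow> 'v) \<Rightarrow> _"
    by (rule vector_space_fun_scale[OF rep.vs.vector_space_axioms])
  show ?thesis
  proof (rule fd_repI)
    show "w.subspace Ind"
      unfolding w.subspace_def ind_space_def fun_scale_def
      using rep.zero_in lin K_closed
      by (auto simp: rep.vs.subspace_add[OF rep.subspace] rep.vs.subspace_scale[OF rep.subspace])
    show "Ind \<subseteq> w.span ((\<lambda>(x, b) y. if y = x then b else 0) ` (carrier G \<times> B))"
    proof
      fix f assume "f \<in> Ind"
      then show "f \<in> w.span ((\<lambda>(x, b) y. if y = x then b else 0) ` (carrier G \<times> B))"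
        using IndD[of f] B(2) by (intro functions_in_finite_span[OF rep.vs.vector_space_axioms fin]) auto
    qed
    show "finite ((\<lambda>(x, b) y. if y = x then b else (0 :: 'v)) ` (carrier G \<times> B))"
      using fin B(1) by blast
  next
    fix g f assume "g \<in> carrier G" "f \<in> Ind"
    then show "ind_action G g f \<in> Ind"
      using K_carrier unfolding ind_space_def ind_action_def by (auto simp: m_assoc[symmetric])
  next
    fix g assume "g \<in> carrier G"
    show "linear_on (fun_scale s) (fun_scale s) Ind (ind_action G g)"
      unfolding linear_on_def ind_action_def fun_scale_def by auto
  next
    fix f assume f: "f \<in> Ind"
    show "ind_action G \<one> f = f"
      using IndD(1)[OF f] by (auto simp: ind_action_def fun_eq_iff)
  next
    fix g h f assume "g \<in> carrier G" "h \<in> carrier G"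
    then show "ind_action G (g \<otimes> h) f = ind_action G g (ind_action G h f)"
      by (auto simp: ind_action_def fun_eq_iff inv_mult_group m_assoc)
  qed (rule is_group w.vector_space_axioms)+
qed

text \<open>Substituting k h k^-1 for h turns f (g h k) into f (g k h), and the invariance of z
  absorbs the substitution in the coefficient.\<close>

lemma rmul_in_Ind:
  assumes z: "conj_invariant G K z" and f: "f \<in> Ind"
  shows "rmul G s z f \<in> Ind"
proof -
  have inV: "s (z h) (f (g \<otimes> h)) \<in> V" if "g \<in> carrier G" "h \<in> carrier G" for g h
    using IndD(2)[OF f] that rep.vs.subspace_scale[OF rep.subspace] by simp
  have eq: "rmul G s z f (g \<otimes> k) = \<rho> (inv k) (rmul G s z f g)" if g: "g \<in> carrier G" and k: "k \<in> K" for g k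
  proof -
    have "\<rho> (inv k) (rmul G s z f g) = (\<Sum>h\<in>carrier G. s (z h) (\<rho> (inv k) (f (g \<otimes> h))))"
      using g k inV K_closed IndD(2)[OF f] by (simp add: rmul_def rho_sum lin)
    also have "\<dots> = (\<Sum>h\<in>carrier G. s (z h) (f (g \<otimes> h \<otimes> k)))"
      using g k IndD(3)[OF f] by simp
    also have "\<dots> = (\<Sum>h\<in>carrier G. s (z (k \<otimes> h \<otimes> inv k)) (f (g \<otimes> (k \<otimes> h \<otimes> inv k) \<otimes> k)))"
      using sum_conj[OF K_carrier[OF k], of "\<lambda>h. s (z h) (f (g \<otimes> h \<otimes> k))"] by simp
    also have "\<dots> = (\<Sum>h\<in>carrier G. s (z h) (f (g \<otimes> k \<otimes> h)))"
    proof (rule sum.cong[OF refl])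
      fix h assume h: "h \<in> carrier G"
      have "z (k \<otimes> h \<otimes> inv k) = z h" using z k h unfolding conj_invariant_def by blast
      moreover have "g \<otimes> (k \<otimes> h \<otimes> inv k) \<otimes> k = g \<otimes> k \<otimes> h"
        using g h K_carrier[OF k] by (simp add: m_assoc)
      ultimately show "s (z (k \<otimes> h \<otimes> inv k)) (f (g \<otimes> (k \<otimes> h \<otimes> inv k) \<otimes> k)) = s (z h) (f (g \<otimes> k \<otimes> h))"
        by simp
    qed
    finally show ?thesis using g K_carrier[OF k] by (simp add: rmul_def)
  qed
  have "rmul G s z f g \<in> V" if "g \<in> carrier G" for g
    using that inV by (auto simp: rmul_def intro!: rep.vs.subspace_sum[OF rep.subspace])
  then show ?thesis using eq unfolding ind_space_def by (auto simp: rmul_def)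
qed

lemma rmul_linear: "linear_on (fun_scale s) (fun_scale s) Ind (rmul G s z)"
  unfolding linear_on_def fun_scale_def rmul_def
  by (auto simp: fun_eq_iff rep.vs.scale_right_distrib sum.distrib rep.vs.scale_sum_right mult.commute)

lemma rmul_equivariant: "equivariant_on G Ind (ind_action G) (rmul G s z)"
  unfolding equivariant_on_def ind_action_def rmul_def
  by (auto simp: fun_eq_iff m_assoc intro!: sum.cong)

text \<open>The element of the induced space that is supported on the coset hK and has value v at h;
  its other values are forced by equivariance.\<close>

definition pt :: "'g \<Rightarrow> 'v \<Rightarrow> 'g \<Rightarrow> 'v" where
  "pt h v g = (if g \<in> carrier G \<and> inv h \<otimes> g \<in> K then \<rho> (inv (inv h \<otimes> g)) v else 0)"

lemma pt_in_Ind: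
  assumes h: "h \<in> carrier G" and v: "v \<in> V"
  shows "pt h v \<in> Ind"
proof -
  have "pt h v (g \<otimes> k) = \<rho> (inv k) (pt h v g)" if g: "g \<in> carrier G" and k: "k \<in> K" for g k
  proof (cases "inv h \<otimes> g \<in> K")
    case True
    then have "inv h \<otimes> (g \<otimes> k) \<in> K" using g h k K_carrier K_closed by (simp add: m_assoc[symmetric])
    moreover have "inv (inv h \<otimes> (g \<otimes> k)) = inv k \<otimes> inv (inv h \<otimes> g)"
      using g h K_carrier[OF k] by (subst m_assoc[symmetric]) (simp_all add: inv_mult_group)
    ultimately show ?thesis using True g v K_carrier[OF k] k K_closed by (simp add: pt_def rho_mult)
  next
    case False
    have "inv h \<otimes> (g \<otimes> k) \<notin> K"
    proof
      assume "inv h \<otimes> (g \<otimes> k) \<in> K"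
      then have "inv h \<otimes> (g \<otimes> k) \<otimes> inv k \<in> K" using k K_closed by blast
      then show False using False g h K_carrier[OF k] by (simp add: m_assoc)
    qed
    then show ?thesis using False k K_closed lin(3) by (simp add: pt_def)
  qed
  moreover have "pt h v g \<in> V" for g
    using v rho_closed K_closed rep.zero_in by (simp add: pt_def)
  moreover have "pt h v g = 0" if "g \<notin> carrier G" for g using that by (simp add: pt_def)
  ultimately show ?thesis unfolding ind_space_def by blast
qed

text \<open>\<open>pt h (f h)\<close> is the restriction of f to the coset hK, so every coset is
  counted once for each of its elements.\<close>

lemma sum_of_points:
  assumes f: "f \<in> Ind"
  shows "fun_scale s (of_nat (card K)) f = (\<Sum>h\<in>carrier G. pt h (f h))"
proof
  fix g
  show "fun_scale s (of_nat (card K)) f g = (\<Sum>h\<in>carrier G. pt h (f h)) g"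
  proof (cases "g \<in> carrier G")
    case False
    then show ?thesis using IndD(1)[OF f] by (simp add: fun_scale_def sum_fun_apply pt_def)
  next
    case g: True
    have "(\<Sum>h\<in>carrier G. pt h (f h)) g = (\<Sum>h\<in>carrier G. if inv h \<otimes> g \<in> K then f g else 0)"
      unfolding sum_fun_apply
    proof (rule sum.cong[OF refl])
      fix h assume h: "h \<in> carrier G"
      show "pt h (f h) g = (if inv h \<otimes> g \<in> K then f g else 0)"
        using IndD(3)[OF f h, of "inv h \<otimes> g"] g h by (simp add: pt_def cancel)
    qed
    also have "\<dots> = (\<Sum>h\<in>{h \<in> carrier G. inv h \<otimes> g \<in> K}. f g)"
      using fin by (simp add: sum.inter_filter)
    also have "\<dots> = (\<Sum>k\<in>K. f g)"
      by (rule sum.reindex_bij_witness[where i="\<lambda>k. g \<otimes> inv k" and j="\<lambda>h. inv h \<otimes> g"])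
        (use g K_carrier in \<open>auto simp: inv_mult_group m_assoc cancel\<close>)
    finally show ?thesis by (simp add: fun_scale_def rep.vs.sum_constant_scale)
  qed
qed

text \<open>
  By Frobenius reciprocity \<open>\<Phi>\<close> is determined by \<open>f \<mapsto> \<Phi> f \<one>\<close>, and Burnside's theorem turns this map
  into a linear combination of evaluations.
\<close>

lemma endo_is_rmul:
  assumes irr: "irreducible_rep GK s V \<rho>"
    and \<Phi>: "linear_on (fun_scale s) (fun_scale s) Ind \<Phi>" "equivariant_on G Ind (ind_action G) \<Phi>" "\<Phi> ` Ind \<subseteq> Ind"
  obtains z where "conj_invariant G K z" "\<forall>f\<in>Ind. \<Phi> f = rmul G s z f"
proof -
  interpret I: fd_rep G "fun_scale s" Ind "ind_action G" by (rule ind_rep)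
  define n where "n = (of_nat (card K) :: complex)"
  have n: "n \<noteq> 0" using cardK by (simp add: n_def)
  have \<Phi>I: "\<Phi> f \<in> Ind" if "f \<in> Ind" for f using \<Phi>(3) that by blast
  have ptlin: "pt h (u + v) = pt h u + pt h v" "pt h (s c u) = fun_scale s c (pt h u)"
    if "u \<in> V" "v \<in> V" for h u v c
    using that by (auto simp: pt_def fun_eq_iff fun_scale_def lin K_closed)
  have "\<exists>a. \<forall>x\<in>V. \<Phi> (pt h x) \<one> = (\<Sum>k\<in>K. s (a k) (\<rho> k x))" if h: "h \<in> carrier G" for h
  proof -
    have lin\<Phi>: "linear_on s s V (\<lambda>x. \<Phi> (pt h x) \<one>)"
      using \<Phi>(1) pt_in_Ind[OF h] unfolding linear_on_def by (auto simp: ptlin) (simp_all add: fun_scale_def)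
    have im\<Phi>: "(\<lambda>x. \<Phi> (pt h x) \<one>) ` V \<subseteq> V"
      using \<Phi>I pt_in_Ind[OF h] IndD(2) by auto
    have "finite (carrier GK)" using finK by simp
    from burnside[OF irr this lin\<Phi> im\<Phi>] obtain a where
      "\<forall>x\<in>V. \<Phi> (pt h x) \<one> = (\<Sum>k\<in>carrier GK. s (a k) (\<rho> k x))" .
    then show ?thesis by auto
  qed
  then obtain a where a: "\<And>h x. h \<in> carrier G \<Longrightarrow> x \<in> V \<Longrightarrow> \<Phi> (pt h x) \<one> = (\<Sum>k\<in>K. s (a h k) (\<rho> k x))"
    by metis
  \<comment> \<open>By equivariance of f, the coefficient a h k belongs to f (h k^-1); collecting
    the terms with g = h k^-1 gives this formula. The factor 1/n undoes the overcounting in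
    \<open>sum_of_points\<close>.\<close>
  define z0 where "z0 g = (\<Sum>k\<in>K. a (g \<otimes> k) k / n)" for g
  have ev0: "\<Phi> f \<one> = (\<Sum>g\<in>carrier G. s (z0 g) (f g))" if f: "f \<in> Ind" for f
  proof -
    have fV: "f h \<in> V" if "h \<in> carrier G" for h using IndD(2)[OF f that] .
    have "s n (\<Phi> f \<one>) = \<Phi> (fun_scale s n f) \<one>"
      using \<Phi>(1) f unfolding linear_on_def by (simp add: fun_scale_def)
    also have "\<dots> = \<Phi> (\<Sum>h\<in>carrier G. pt h (f h)) \<one>" using sum_of_points[OF f] by (simp add: n_def)
    also have "\<dots> = (\<Sum>h\<in>carrier G. \<Phi> (pt h (f h)) \<one>)"
      using I.cvs.linear_on_sum[OF \<Phi>(1) I.subspace, of "carrier G" "\<lambda>h. pt h (f h)"] pt_in_Ind fV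
      by (simp add: sum_fun_apply)
    also have "\<dots> = (\<Sum>h\<in>carrier G. \<Sum>k\<in>K. s (a h k) (f (h \<otimes> inv k)))"
      using a fV IndD(3)[OF f] K_closed K_carrier by (intro sum.cong refl) simp
    also have "\<dots> = (\<Sum>k\<in>K. \<Sum>g\<in>carrier G. s (a (g \<otimes> k) k) (f g))"
    proof (subst sum.swap, rule sum.cong[OF refl])
      fix k assume k: "k \<in> K"
      show "(\<Sum>h\<in>carrier G. s (a h k) (f (h \<otimes> inv k))) = (\<Sum>g\<in>carrier G. s (a (g \<otimes> k) k) (f g))"
        using sum_right_translate[OF K_carrier[OF k], of "\<lambda>h. s (a h k) (f (h \<otimes> inv k))"] K_carrier[OF k]
        by (simp add: cancel)
    qed
    also have "\<dots> = s n (\<Sum>g\<in>carrier G. s (z0 g) (f g))"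
      using n by (subst sum.swap) (simp add: z0_def rep.vs.scale_sum_right rep.vs.scale_sum_left)
    finally show ?thesis using n by simp
  qed
  \<comment> \<open>\<open>z0\<close> need not be invariant under conjugation. Equivariance of
    \<Phi> and of the functions shows that each K-conjugate of \<open>z0\<close> defines the same
    functional, so it may be averaged.\<close>
  define z where "z g = (\<Sum>k\<in>K. z0 (k \<otimes> g \<otimes> inv k) / n)" for g
  have ev: "\<Phi> f \<one> = (\<Sum>g\<in>carrier G. s (z g) (f g))" if f: "f \<in> Ind" for f
  proof -
    have "\<Phi> f \<one> = (\<Sum>g\<in>carrier G. s (z0 (k \<otimes> g \<otimes> inv k)) (f g))" if k: "k \<in> K" for k
    proof -
      have kG: "k \<in> carrier G" and ik: "inv k \<in> K" using k K_carrier K_closed by auto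
      have fI: "ind_action G k f \<in> Ind" using I.closed[OF kG f] .
      have "\<Phi> (ind_action G k f) \<one> = \<Phi> f (\<one> \<otimes> inv k)"
        using \<Phi>(2) kG f unfolding equivariant_on_def by (simp add: ind_action_def)
      also have "\<dots> = \<rho> k (\<Phi> f \<one>)" using IndD(3)[OF \<Phi>I[OF f] one_closed ik] kG by simp
      finally have "\<Phi> f \<one> = \<rho> (inv k) (\<Phi> (ind_action G k f) \<one>)"
        using k ik kG IndD(2)[OF \<Phi>I[OF f] one_closed] by (simp add: rho_mult rho_one)
      also have "\<dots> = (\<Sum>g\<in>carrier G. s (z0 g) (\<rho> (inv k) (f (inv k \<otimes> g))))"
        using ik kG IndD(2)[OF f] ev0[OF fI] rep.vs.subspace_scale[OF rep.subspace]
        by (simp add: rho_sum lin ind_action_def)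
      also have "\<dots> = (\<Sum>g\<in>carrier G. s (z0 g) (f (inv k \<otimes> g \<otimes> k)))"
        using IndD(3)[OF f _ k] kG by (intro sum.cong refl) simp
      also have "\<dots> = (\<Sum>g\<in>carrier G. s (z0 (k \<otimes> g \<otimes> inv k)) (f (inv k \<otimes> (k \<otimes> g \<otimes> inv k) \<otimes> k)))"
        using sum_conj[OF kG, of "\<lambda>g. s (z0 g) (f (inv k \<otimes> g \<otimes> k))"] by simp
      also have "\<dots> = (\<Sum>g\<in>carrier G. s (z0 (k \<otimes> g \<otimes> inv k)) (f g))"
        using kG by (intro sum.cong refl) (simp add: m_assoc cancel)
      finally show ?thesis .
    qed
    then have "(\<Sum>k\<in>K. \<Phi> f \<one>) = (\<Sum>k\<in>K. \<Sum>g\<in>carrier G. s (z0 (k \<otimes> g \<otimes> inv k)) (f g))" by simp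
    also have "\<dots> = s n (\<Sum>g\<in>carrier G. s (z g) (f g))"
      using n by (subst sum.swap) (simp add: z_def rep.vs.scale_sum_right rep.vs.scale_sum_left)
    finally have "s n (\<Phi> f \<one>) = s n (\<Sum>g\<in>carrier G. s (z g) (f g))"
      by (simp add: n_def rep.vs.sum_constant_scale)
    then show ?thesis using n by simp
  qed
  show ?thesis
  proof (rule that[of z])
    show "conj_invariant G K z"
      unfolding conj_invariant_def
    proof (intro ballI)
      fix l g assume l: "l \<in> K" and g: "g \<in> carrier G"
      show "z (l \<otimes> g \<otimes> inv l) = z g"
        unfolding z_def
        by (rule sum.reindex_bij_witness[where i="\<lambda>k. k \<otimes> inv l" and j="\<lambda>k. k \<otimes> l"])
          (use l g K_closed K_carrier in \<open>auto simp: m_assoc cancel inv_mult_group\<close>)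
    qed
    show "\<forall>f\<in>Ind. \<Phi> f = rmul G s z f"
    proof (intro ballI ext)
      fix f g assume f: "f \<in> Ind"
      show "\<Phi> f g = rmul G s z f g"
      proof (cases "g \<in> carrier G")
        case False
        then show ?thesis using IndD(1)[OF \<Phi>I[OF f]] by (simp add: rmul_def)
      next
        case g: True
        then have "\<Phi> f g = \<Phi> (ind_action G (inv g) f) \<one>"
          using \<Phi>(2) f unfolding equivariant_on_def by (simp add: ind_action_def)
        also have "\<dots> = (\<Sum>h\<in>carrier G. s (z h) (f (g \<otimes> h)))"
          using ev[OF I.closed[OF _ f, of "inv g"]] g by (simp add: ind_action_def)
        finally show ?thesis using g by (simp add: rmul_def)
      qed
    qed
  qed
qed

end

section \<open>Strong Gelfand pairs and commutativity of invariant functions\<close>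

context group_with_subgroup
begin

theorem strong_gelfand_pairI:
  assumes comm: "\<And>x y g. conj_invariant G K x \<Longrightarrow> conj_invariant G K y \<Longrightarrow> g \<in> carrier G \<Longrightarrow>
    conv G x y g = conv G y x g"
  shows "strong_gelfand_pair G K"
  unfolding strong_gelfand_pair_def
proof (intro conjI allI impI)
  fix V :: "(nat \<Rightarrow> complex) set" and \<rho>
  assume irr: "irreducible_rep GK (fun_scale (*)) V \<rho>"
  interpret induction_datum G K "fun_scale (*)" V \<rho>
    by (intro induction_datum.intro group_with_subgroup_axioms irreducible_repD(1)[OF irr])
  show "multiplicity_free G (fun_scale (fun_scale (*))) Ind (ind_action G)"
  proof (rule multiplicity_freeI[OF ind_rep fin])
    let ?s = "fun_scale (*) :: complex \<Rightarrow> (nat \<Rightarrow> complex) \<Rightarrow> _" and ?S = "fun_scale (fun_scale (*))"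
    fix S T f
    assume S: "linear_on ?S ?S Ind S"
        "equivariant_on G Ind (ind_action G) S" "S ` Ind \<subseteq> Ind"
      and T: "linear_on ?S ?S Ind T"
        "equivariant_on G Ind (ind_action G) T" "T ` Ind \<subseteq> Ind" and f: "f \<in> Ind"
    obtain x where x: "conj_invariant G K x" "\<forall>f\<in>Ind. S f = rmul G ?s x f"
      using endo_is_rmul[OF irr S] .
    obtain y where y: "conj_invariant G K y" "\<forall>f\<in>Ind. T f = rmul G ?s y f"
      using endo_is_rmul[OF irr T] .
    have "rmul G ?s x (rmul G ?s y f) g = rmul G ?s y (rmul G ?s x f) g" for g
    proof (cases "g \<in> carrier G")
      case True
      have "rmul G ?s (conv G x y) f g = rmul G ?s (conv G y x) f g"
        using comm[OF x(1) y(1)] by (simp add: rmul_def)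
      then show ?thesis using rmul_rmul[OF rep.vs.vector_space_axioms True] by metis
    qed (simp add: rmul_def)
    then have "rmul G ?s x (rmul G ?s y f) = rmul G ?s y (rmul G ?s x f)"
      by (rule ext)
    then show "S (T f) = T (S f)"
      using x(2) y(2) f rmul_in_Ind[OF x(1) f] rmul_in_Ind[OF y(1) f] by simp
  qed
qed (rule subgroup)

end

text \<open>The regular representation, transported to \<open>nat \<Rightarrow> complex\<close> along an injection \<open>e\<close>.\<close>

lemma regular_rep:
  fixes e :: "'g \<Rightarrow> nat" and H :: "('g, 'm) monoid_scheme"
  assumes "group H" and fin: "finite (carrier H)" and e: "inj_on e (carrier H)"
  defines "V \<equiv> {f. \<forall>n. n \<notin> e ` carrier H \<longrightarrow> f n = (0 :: complex)}"
    and "\<rho> \<equiv> (\<lambda>k f n. if n \<in> e ` carrier H then f (e (inv\<^bsub>H\<^esub> k \<otimes>\<^bsub>H\<^esub> inv_into (carrier H) e n)) else 0)"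
  shows "fd_rep H (fun_scale (*)) V \<rho>"
proof -
  interpret group H by fact
  interpret w: vector_space "fun_scale (*) :: complex \<Rightarrow> (nat \<Rightarrow> complex) \<Rightarrow> _"
    by (rule vector_space_fun_scale[OF vector_space_complex_mult])
  interpret c: vector_space "(*) :: complex \<Rightarrow> complex \<Rightarrow> complex" by (rule vector_space_complex_mult)
  have one_span: "a \<in> c.span {1}" for a :: complex
    using c.span_scale[OF c.span_base[of 1 "{1}"], of a] by simp
  show ?thesis
  proof (rule fd_repI)
    show "V \<subseteq> w.span ((\<lambda>(x, b) y. if y = x then b else 0) ` (e ` carrier H \<times> {1}))"
      unfolding V_def using fin one_span
      by (intro subsetI functions_in_finite_span[OF vector_space_complex_mult]) auto
    fix g h f assume gh: "g \<in> carrier H" "h \<in> carrier H" "f \<in> V"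
    show "\<rho> (g \<otimes>\<^bsub>H\<^esub> h) f = \<rho> g (\<rho> h f)"
    proof
      fix n
      show "\<rho> (g \<otimes>\<^bsub>H\<^esub> h) f n = \<rho> g (\<rho> h f) n"
      proof (cases "n \<in> e ` carrier H")
        case True
        then obtain l where l: "l \<in> carrier H" "n = e l" by blast
        have "e (inv\<^bsub>H\<^esub> g \<otimes>\<^bsub>H\<^esub> l) \<in> e ` carrier H" using gh l by simp
        then show ?thesis
          using gh l e by (simp add: \<rho>_def inv_into_f_f inv_mult_group m_assoc)
      qed (simp add: \<rho>_def)
    qed
  next
    fix f assume "f \<in> V"
    then show "\<rho> \<one>\<^bsub>H\<^esub> f = f" using e by (auto simp: \<rho>_def V_def fun_eq_iff)
  qed (use fin in \<open>auto simp: V_def \<rho>_def w.subspace_def fun_scale_def linear_on_def fun_eq_iff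
      is_group w.vector_space_axioms\<close>)
qed

context group_with_subgroup
begin

text \<open>Let c be the commutator of x and y. Evaluation on functions concentrated on one coset
  shows that the sum of c (g k) \<rho> (k^-1) over k in K annihilates every irreducible
  representation. It therefore annihilates the regular representation, which is a sum of irreducible
  ones; applied to the point mass at \<one>, it has the value c g at \<one>.\<close>

theorem strong_gelfand_pairD:
  assumes sg: "strong_gelfand_pair G K" and x: "conj_invariant G K x" and y: "conj_invariant G K y"
    and g: "g \<in> carrier G"
  shows "conv G x y g = conv G y x g"
proof -
  define c where "c m = conv G x y m - conv G y x m" for m
  have key: "(\<Sum>k\<in>K. fun_scale (*) (c (g \<otimes> k)) (\<rho> (inv k) v)) = 0"
    if irr: "irreducible_rep GK (fun_scale (*)) V \<rho>" and v: "v \<in> V" for V :: "(nat \<Rightarrow> complex) set" and \<rho> v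
  proof -
    interpret induction_datum G K "fun_scale (*)" V \<rho>
      by (intro induction_datum.intro group_with_subgroup_axioms irreducible_repD(1)[OF irr])
    have mf: "multiplicity_free G (fun_scale (fun_scale (*))) Ind (ind_action G)"
      using sg irr unfolding strong_gelfand_pair_def by blast
    let ?s = "fun_scale (*) :: complex \<Rightarrow> (nat \<Rightarrow> complex) \<Rightarrow> _" and ?f = "pt \<one> v"
    have f: "?f \<in> Ind" using pt_in_Ind[OF one_closed v] .
    have im: "rmul G ?s z ` Ind \<subseteq> Ind" if "conj_invariant G K z" for z
    proof
      fix h assume "h \<in> rmul G ?s z ` Ind"
      then obtain f' where "f' \<in> Ind" "h = rmul G ?s z f'" by (rule imageE)
      then show "h \<in> Ind" using rmul_in_Ind[OF that] by simp
    qed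
    have "rmul G ?s x (rmul G ?s y ?f) = rmul G ?s y (rmul G ?s x ?f)"
      by (rule equivariant_endos_commute[OF mf rmul_linear rmul_equivariant im[OF x]
            rmul_linear rmul_equivariant im[OF y] f])
    \<comment> \<open>At g^-1 the sum involves \<open>?f (inv g \<otimes> h)\<close>, which vanishes
      unless h lies in gK; the substitution h = g k then leaves a sum over K.\<close>
    then have "rmul G ?s (conv G x y) ?f (inv g) = rmul G ?s (conv G y x) ?f (inv g)"
      by (simp only: rmul_rmul[OF rep.vs.vector_space_axioms inv_closed[OF g], symmetric])
    then have "(\<Sum>h\<in>carrier G. ?s (c h) (?f (inv g \<otimes> h))) = 0"
      using g by (simp add: rmul_def c_def rep.vs.scale_left_diff_distrib sum_subtractf)
    then have "0 = (\<Sum>h\<in>carrier G. ?s (c (g \<otimes> h)) (?f (inv g \<otimes> (g \<otimes> h))))"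
      using sum_left_translate[OF g, of "\<lambda>h. ?s (c h) (?f (inv g \<otimes> h))"] by simp
    also have "\<dots> = (\<Sum>h\<in>carrier G. if h \<in> K then ?s (c (g \<otimes> h)) (\<rho> (inv h) v) else 0)"
      using g by (intro sum.cong refl) (simp add: cancel pt_def)
    also have "\<dots> = (\<Sum>k\<in>K. ?s (c (g \<otimes> k)) (\<rho> (inv k) v))"
      using K_carrier by (intro sum.mono_neutral_cong_right fin) auto
    finally show ?thesis by simp
  qed
  have finGK: "finite (carrier GK)" using finK by simp
  obtain e :: "'g \<Rightarrow> nat" where e: "inj_on e (carrier GK)"
    using finite_imp_inj_to_nat_seg[OF finGK] by blast
  define V where "V = {f. \<forall>n. n \<notin> e ` carrier GK \<longrightarrow> f n = (0 :: complex)}"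
  define \<rho> where "\<rho> = (\<lambda>k f n. if n \<in> e ` carrier GK then
      f (e (inv\<^bsub>GK\<^esub> k \<otimes>\<^bsub>GK\<^esub> inv_into (carrier GK) e n)) else (0 :: complex))"
  interpret R: fd_rep GK "fun_scale (*)" V \<rho>
    unfolding V_def \<rho>_def by (rule regular_rep[OF groupK finGK e])
  obtain \<U> where \<U>: "finite \<U>" "\<forall>U\<in>\<U>. U \<subseteq> V \<and> irreducible_rep GK (fun_scale (*)) U \<rho>" "direct_sum V \<U>"
    using R.irreducible_decomposition[OF finGK] .
  define v where "v n = (if n = e \<one> then 1 else 0 :: complex)" for n
  have vV: "v \<in> V" using K_closed by (auto simp: V_def v_def)
  obtain w where w: "w \<in> (\<Pi>\<^sub>E U\<in>\<U>. U)" "(\<Sum>U\<in>\<U>. w U) = v"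
    using bspec[OF \<U>(3)[unfolded direct_sum_def] vV] by (elim ex1E conjE)
  have wV: "w U \<in> V" "w U \<in> U" if "U \<in> \<U>" for U
    using PiE_mem[OF w(1) that] bspec[OF \<U>(2) that] by auto
  have "(\<Sum>k\<in>K. fun_scale (*) (c (g \<otimes> k)) (\<rho> (inv k) v)) =
      (\<Sum>k\<in>K. \<Sum>U\<in>\<U>. fun_scale (*) (c (g \<otimes> k)) (\<rho> (inv k) (w U)))"
    using wV K_closed by (intro sum.cong refl) (simp add: w(2)[symmetric] R.rho_sum R.vs.scale_sum_right)
  also have "\<dots> = (\<Sum>U\<in>\<U>. \<Sum>k\<in>K. fun_scale (*) (c (g \<otimes> k)) (\<rho> (inv k) (w U)))" by (rule sum.swap)
  also have "\<dots> = 0"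
  proof (rule sum.neutral, rule ballI)
    fix U assume U: "U \<in> \<U>"
    show "(\<Sum>k\<in>K. fun_scale (*) (c (g \<otimes> k)) (\<rho> (inv k) (w U))) = 0"
      by (rule key[OF conjunct2[OF bspec[OF \<U>(2) U]] wV(2)[OF U]])
  qed
  finally have "(\<Sum>k\<in>K. fun_scale (*) (c (g \<otimes> k)) (\<rho> (inv k) v)) (e \<one>) = 0" by simp
  moreover have "fun_scale (*) (c (g \<otimes> k)) (\<rho> (inv k) v) (e \<one>) = (if k = \<one> then c g else 0)" if k: "k \<in> K" for k
  proof -
    have "inv_into K e (e \<one>) = \<one>" using e K_closed by (simp add: inv_into_f_f)
    moreover have "e k = e \<one> \<longleftrightarrow> k = \<one>" using e k K_closed by (auto simp: inj_on_def)
    ultimately show ?thesis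
      using k K_closed K_carrier g by (auto simp: fun_scale_def \<rho>_def inv_GK v_def)
  qed
  ultimately have "(\<Sum>k\<in>K. if k = \<one> then c g else 0) = 0" by (simp add: sum_fun_apply)
  then have "c g = 0" using finK K_closed by simp
  then show ?thesis by (simp add: c_def)
qed

text \<open>Convolving two indicator functions counts the factorizations of an element with one
  factor from each set, in the given order. Commutativity equates the counts for the two orders, and
  one of them is positive.\<close>

corollary strong_gelfand_pair_set_product:
  assumes sg: "strong_gelfand_pair G K"
    and P: "\<And>k p. k \<in> K \<Longrightarrow> p \<in> carrier G \<Longrightarrow> P p \<Longrightarrow> P (k \<otimes> p \<otimes> inv k)"
    and Q: "\<And>k p. k \<in> K \<Longrightarrow> p \<in> carrier G \<Longrightarrow> Q p \<Longrightarrow> Q (k \<otimes> p \<otimes> inv k)"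
    and pq: "p \<in> carrier G" "q \<in> carrier G" "P p" "Q q"
  obtains p' q' where "p' \<in> carrier G" "q' \<in> carrier G" "P p'" "Q q'" "q' \<otimes> p' = p \<otimes> q"
proof -
  have inv: "conj_invariant G K (\<lambda>g. if R g then 1 else 0)"
    if R: "\<And>k p. k \<in> K \<Longrightarrow> p \<in> carrier G \<Longrightarrow> R p \<Longrightarrow> R (k \<otimes> p \<otimes> inv k)" for R
  proof -
    have "R p" if "k \<in> K" "p \<in> carrier G" "R (k \<otimes> p \<otimes> inv k)" for k p
      using R[of "inv k" "k \<otimes> p \<otimes> inv k"] that K_closed K_carrier by (simp add: m_assoc cancel)
    then show ?thesis using R unfolding conj_invariant_def by auto
  qed
  have count: "conv G (\<lambda>g. if R g then 1 else 0) (\<lambda>g. if S g then 1 else 0) g =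
      of_nat (card {h \<in> carrier G. R h \<and> S (inv h \<otimes> g)})" for R S g
  proof -
    have "conv G (\<lambda>g. if R g then 1 else 0) (\<lambda>g. if S g then 1 else 0) g =
        (\<Sum>h\<in>carrier G. if R h \<and> S (inv h \<otimes> g) then 1 else 0)"
      unfolding conv_def by (intro sum.cong) auto
    then show ?thesis using fin by (simp add: sum.inter_filter[symmetric])
  qed
  let ?g = "p \<otimes> q"
  have "card {h \<in> carrier G. P h \<and> Q (inv h \<otimes> ?g)} = card {h \<in> carrier G. Q h \<and> P (inv h \<otimes> ?g)}"
    using strong_gelfand_pairD[OF sg inv[where R = P, OF P] inv[where R = Q, OF Q], of ?g] pq unfolding count by simp
  moreover have "p \<in> {h \<in> carrier G. P h \<and> Q (inv h \<otimes> ?g)}" using pq by (simp add: cancel)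
  ultimately have "{h \<in> carrier G. Q h \<and> P (inv h \<otimes> ?g)} \<noteq> {}"
    using fin by (metis (no_types, lifting) card.empty card_gt_0_iff empty_iff finite_Collect_conjI less_irrefl finite_subset mem_Collect_eq subsetI)
  then obtain h where "h \<in> carrier G" "Q h" "P (inv h \<otimes> ?g)" by blast
  with that[of "inv h \<otimes> ?g" h] pq show ?thesis by (simp add: cancel)
qed

end


section \<open>The group algebra\<close>

context group_with_subgroup
begin

text \<open>Cutting \<open>conv\<close> off outside the carrier turns identities on the group into
  equalities of functions, as rewriting needs.\<close>

definition star :: "('g \<Rightarrow> complex) \<Rightarrow> ('g \<Rightarrow> complex) \<Rightarrow> 'g \<Rightarrow> complex" (infixl "\<star>" 70) where
  "x \<star> y = (\<lambda>g. if g \<in> carrier G then conv G x y g else 0)"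

definition sc :: "complex \<Rightarrow> ('g \<Rightarrow> complex) \<Rightarrow> 'g \<Rightarrow> complex" where
  "sc c x = (\<lambda>g. c * x g)"

definition d :: "'g \<Rightarrow> 'g \<Rightarrow> complex" where
  "d g = (\<lambda>h. if h = g then 1 else 0)"

definition cj :: "'g \<Rightarrow> ('g \<Rightarrow> complex) \<Rightarrow> 'g \<Rightarrow> complex" where
  "cj k x = (\<lambda>g. if g \<in> carrier G then x (inv k \<otimes> g \<otimes> k) else 0)"

text \<open>The linear extension of inversion, without complex conjugation; by
  \<open>bar_star\<close> it is an anti-automorphism.\<close>

definition bar :: "('g \<Rightarrow> complex) \<Rightarrow> 'g \<Rightarrow> complex" where
  "bar x = (\<lambda>g. if g \<in> carrier G then x (inv g) else 0)"

definition CG :: "('g \<Rightarrow> complex) set" where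
  "CG = {x. \<forall>g. g \<notin> carrier G \<longrightarrow> x g = 0}"

lemma CG_intros [simp]: "x \<star> y \<in> CG" "cj k x \<in> CG" "bar x \<in> CG" "g \<in> carrier G \<Longrightarrow> d g \<in> CG"
  "x \<in> CG \<Longrightarrow> sc c x \<in> CG" "x \<in> CG \<Longrightarrow> y \<in> CG \<Longrightarrow> x + y \<in> CG"
  by (auto simp: CG_def star_def cj_def bar_def d_def sc_def)

lemma CG_sum [simp]: "(\<And>i. i \<in> A \<Longrightarrow> f i \<in> CG) \<Longrightarrow> (\<Sum>i\<in>A. f i) \<in> CG"
  by (auto simp: CG_def sum_fun_apply intro!: sum.neutral)

lemma star_assoc: "x \<star> y \<star> z = x \<star> (y \<star> z)"
proof
  fix g
  show "(x \<star> y \<star> z) g = (x \<star> (y \<star> z)) g"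
  proof (cases "g \<in> carrier G")
    case g: True
    have "(x \<star> y \<star> z) g = (\<Sum>h\<in>carrier G. \<Sum>k\<in>carrier G. x k * y (inv k \<otimes> h) * z (inv h \<otimes> g))"
      using g by (simp add: star_def conv_def sum_distrib_right)
    also have "\<dots> = (\<Sum>k\<in>carrier G. \<Sum>h\<in>carrier G. x k * y (inv k \<otimes> h) * z (inv h \<otimes> g))"
      by (rule sum.swap)
    also have "\<dots> = (\<Sum>k\<in>carrier G. \<Sum>h\<in>carrier G. x k * y h * z (inv h \<otimes> (inv k \<otimes> g)))"
    proof (rule sum.cong[OF refl])
      fix k assume k: "k \<in> carrier G"
      have "(\<Sum>h\<in>carrier G. x k * y (inv k \<otimes> h) * z (inv h \<otimes> g)) =
          (\<Sum>h\<in>carrier G. x k * y (inv k \<otimes> (k \<otimes> h)) * z (inv (k \<otimes> h) \<otimes> g))"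
        using sum_left_translate[OF k, of "\<lambda>h. x k * y (inv k \<otimes> h) * z (inv h \<otimes> g)"] by simp
      also have "\<dots> = (\<Sum>h\<in>carrier G. x k * y h * z (inv h \<otimes> (inv k \<otimes> g)))"
        using k g by (intro sum.cong refl) (simp add: cancel inv_mult_group m_assoc)
      finally show "(\<Sum>h\<in>carrier G. x k * y (inv k \<otimes> h) * z (inv h \<otimes> g)) =
          (\<Sum>h\<in>carrier G. x k * y h * z (inv h \<otimes> (inv k \<otimes> g)))" .
    qed
    also have "\<dots> = (x \<star> (y \<star> z)) g"
      using g by (simp add: star_def conv_def sum_distrib_left mult.assoc)
    finally show ?thesis .
  qed (simp add: star_def)
qed

lemma star_sum_left: "(\<Sum>i\<in>A. f i) \<star> y = (\<Sum>i\<in>A. f i \<star> y)"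
proof
  fix g show "((\<Sum>i\<in>A. f i) \<star> y) g = (\<Sum>i\<in>A. f i \<star> y) g"
    by (simp add: star_def conv_def sum_fun_apply sum_distrib_right) (intro impI sum.swap)
qed

lemma star_sum_right: "y \<star> (\<Sum>i\<in>A. f i) = (\<Sum>i\<in>A. y \<star> f i)"
proof
  fix g show "(y \<star> (\<Sum>i\<in>A. f i)) g = (\<Sum>i\<in>A. y \<star> f i) g"
    by (simp add: star_def conv_def sum_fun_apply sum_distrib_left) (intro impI sum.swap)
qed

lemma star_sc [simp]: "sc c x \<star> y = sc c (x \<star> y)" "x \<star> sc c y = sc c (x \<star> y)"
  by (auto simp: star_def conv_def sc_def sum_distrib_left fun_eq_iff algebra_simps intro!: sum.cong)

lemma sc_sc [simp]: "sc a (sc b x) = sc (a * b) x" "sc 1 x = x"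
  by (auto simp: sc_def)

lemma sc_sum: "sc c (\<Sum>i\<in>A. f i) = (\<Sum>i\<in>A. sc c (f i))"
  by (auto simp: sc_def sum_fun_apply sum_distrib_left fun_eq_iff)

lemma d_star:
  assumes "g \<in> carrier G" "h \<in> carrier G"
  shows "(d g \<star> x) h = x (inv g \<otimes> h)" "(x \<star> d g) h = x (h \<otimes> inv g)"
proof -
  have "(d g \<star> x) h = (\<Sum>k\<in>carrier G. if k = g then x (inv k \<otimes> h) else 0)"
    using assms by (simp add: star_def conv_def d_def if_distrib[of "\<lambda>a. a * _"] cong: if_cong)
  then show "(d g \<star> x) h = x (inv g \<otimes> h)" using assms fin by simp
  have "(x \<star> d g) h = (\<Sum>k\<in>carrier G. if k = h \<otimes> inv g then x k else 0)"
    unfolding star_def conv_def d_def using assms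
    by (auto intro!: sum.cong simp: inv_mult_group m_assoc cancel if_distrib[of "\<lambda>a. _ * a"])
  then show "(x \<star> d g) h = x (h \<otimes> inv g)" using assms fin by simp
qed

lemma d_star_d: "g \<in> carrier G \<Longrightarrow> h \<in> carrier G \<Longrightarrow> d g \<star> d h = d (g \<otimes> h)"
proof
  fix k assume gh: "g \<in> carrier G" "h \<in> carrier G"
  show "(d g \<star> d h) k = d (g \<otimes> h) k"
  proof (cases "k \<in> carrier G")
    case True
    then have "inv g \<otimes> k = h \<longleftrightarrow> k = g \<otimes> h" using gh by (auto simp: cancel)
    then show ?thesis using d_star(1)[OF gh(1) True] by (simp add: d_def)
  qed (use gh in \<open>auto simp: star_def d_def\<close>)
qed

lemma d_one_star [simp]: "x \<in> CG \<Longrightarrow> d \<one> \<star> x = x"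
proof
  fix k assume x: "x \<in> CG"
  show "(d \<one> \<star> x) k = x k"
    using d_star(1)[of \<one> k x] x by (cases "k \<in> carrier G") (auto simp: star_def CG_def)
qed

lemma cj_star: "k \<in> carrier G \<Longrightarrow> cj k (x \<star> y) = cj k x \<star> cj k y"
proof
  fix g assume k: "k \<in> carrier G"
  show "cj k (x \<star> y) g = (cj k x \<star> cj k y) g"
  proof (cases "g \<in> carrier G")
    case g: True
    have "cj k (x \<star> y) g = (\<Sum>h\<in>carrier G. x h * y (inv h \<otimes> (inv k \<otimes> g \<otimes> k)))"
      using g k by (simp add: cj_def star_def conv_def)
    also have "\<dots> = (\<Sum>h\<in>carrier G. x (inv k \<otimes> h \<otimes> k) * y (inv (inv k \<otimes> h \<otimes> k) \<otimes> (inv k \<otimes> g \<otimes> k)))"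
      using sum_conj[of "inv k" "\<lambda>h. x h * y (inv h \<otimes> (inv k \<otimes> g \<otimes> k))"] k by simp
    also have "\<dots> = (cj k x \<star> cj k y) g"
      using g k by (auto simp: cj_def star_def conv_def inv_mult_group m_assoc cancel intro!: sum.cong)
    finally show ?thesis .
  qed (simp add: cj_def star_def)
qed

lemma cj_d: "k \<in> carrier G \<Longrightarrow> g \<in> carrier G \<Longrightarrow> cj k (d g) = d (k \<otimes> g \<otimes> inv k)"
proof
  fix h assume kg: "k \<in> carrier G" "g \<in> carrier G"
  have "inv k \<otimes> h \<otimes> k = g \<longleftrightarrow> h = k \<otimes> g \<otimes> inv k" if "h \<in> carrier G"
    using kg that by (auto simp: m_assoc cancel)
  then show "cj k (d g) h = d (k \<otimes> g \<otimes> inv k) h" using kg by (auto simp: cj_def d_def)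
qed

lemma cj_sum: "cj k (\<Sum>i\<in>A. f i) = (\<Sum>i\<in>A. cj k (f i))"
  by (auto simp: cj_def sum_fun_apply fun_eq_iff)

lemma cj_sc: "cj k (sc c x) = sc c (cj k x)"
  by (auto simp: cj_def sc_def fun_eq_iff)

lemma cj_cj: "k \<in> carrier G \<Longrightarrow> l \<in> carrier G \<Longrightarrow> cj k (cj l x) = cj (k \<otimes> l) x"
  by (auto simp: cj_def fun_eq_iff inv_mult_group m_assoc)

lemma cj_one: "x \<in> CG \<Longrightarrow> cj \<one> x = x"
  by (auto simp: cj_def CG_def fun_eq_iff)

lemma cj_swap: "k \<in> carrier G \<Longrightarrow> x \<in> CG \<Longrightarrow> cj k x \<star> d k = d k \<star> x"
proof
  fix g assume k: "k \<in> carrier G" and x: "x \<in> CG"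
  show "(cj k x \<star> d k) g = (d k \<star> x) g"
  proof (cases "g \<in> carrier G")
    case True
    then show ?thesis using k by (simp add: d_star cj_def m_assoc)
  qed (simp add: star_def)
qed

lemma bar_star: "bar (x \<star> y) = bar y \<star> bar x"
proof
  fix g
  show "bar (x \<star> y) g = (bar y \<star> bar x) g"
  proof (cases "g \<in> carrier G")
    case g: True
    have "bar (x \<star> y) g = (\<Sum>h\<in>carrier G. x h * y (inv h \<otimes> inv g))"
      using g by (simp add: bar_def star_def conv_def)
    also have "\<dots> = (\<Sum>h\<in>carrier G. x (inv g \<otimes> h) * y (inv (inv g \<otimes> h) \<otimes> inv g))"
      using sum_left_translate[of "inv g" "\<lambda>h. x h * y (inv h \<otimes> inv g)"] g by simp
    also have "\<dots> = (bar y \<star> bar x) g"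
      using g by (auto simp: bar_def star_def conv_def inv_mult_group m_assoc cancel mult.commute intro!: sum.cong)
    finally show ?thesis .
  qed (simp add: bar_def star_def)
qed

lemma bar_d: "g \<in> carrier G \<Longrightarrow> bar (d g) = d (inv g)"
  by (auto simp: bar_def d_def fun_eq_iff)

lemma bar_sum: "bar (\<Sum>i\<in>A. f i) = (\<Sum>i\<in>A. bar (f i))"
  by (auto simp: bar_def sum_fun_apply fun_eq_iff)

lemma bar_sc: "bar (sc c x) = sc c (bar x)"
  by (auto simp: bar_def sc_def fun_eq_iff)

lemma bar_cj: "k \<in> carrier G \<Longrightarrow> bar (cj k x) = cj k (bar x)"
  by (auto simp: bar_def cj_def fun_eq_iff inv_mult_group m_assoc)

end

text \<open>
  \<open>Inv\<close> is the centralizer of the algebra of the normal subgroup \<open>N\<close>, and \<open>Z\<close> is the centre of that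
  algebra; \<open>u g\<close> is the sum of the \<open>N\<close>-conjugates of \<open>g\<close>.
\<close>

locale group_with_normal = group_with_subgroup G N for G :: "('g, 'm) monoid_scheme" (structure) and N +
  assumes normal: "g \<in> carrier G \<Longrightarrow> h \<in> N \<Longrightarrow> g \<otimes> h \<otimes> inv g \<in> N"
begin

text \<open>Not divided by the order of N: after division by \<open>cN\<close> it is the projection
  onto \<open>Inv\<close>. Many factors \<open>cN\<close> in later identities originate
  here.\<close>

definition E :: "('g \<Rightarrow> complex) \<Rightarrow> 'g \<Rightarrow> complex" where
  "E x = (\<Sum>h\<in>N. cj h x)"

definition u :: "'g \<Rightarrow> 'g \<Rightarrow> complex" where
  "u g = E (d g)"

definition Inv :: "('g \<Rightarrow> complex) set" where
  "Inv = {x \<in> CG. \<forall>h\<in>N. cj h x = x}"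

definition Z :: "('g \<Rightarrow> complex) set" where
  "Z = {x \<in> Inv. \<forall>g. g \<notin> N \<longrightarrow> x g = 0}"

abbreviation cN :: complex where "cN \<equiv> of_nat (card N)"

lemma Inv_CG: "x \<in> Inv \<Longrightarrow> x \<in> CG" and Z_Inv: "z \<in> Z \<Longrightarrow> z \<in> Inv"
  by (auto simp: Inv_def Z_def)

lemma Z_CG: "z \<in> Z \<Longrightarrow> z \<in> CG" using Inv_CG Z_Inv by blast

lemma E_CG [simp]: "E x \<in> CG" unfolding E_def by simp

lemma E_sum: "E (\<Sum>i\<in>A. f i) = (\<Sum>i\<in>A. E (f i))"
  unfolding E_def cj_sum by (rule sum.swap)

lemma E_sc: "E (sc c x) = sc c (E x)"
  unfolding E_def by (simp add: cj_sc sc_sum)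

lemma E_cj: "h \<in> N \<Longrightarrow> E (cj h x) = E x"
  unfolding E_def
  by (rule sum.reindex_bij_witness[where j="\<lambda>k. k \<otimes> h" and i="\<lambda>k. k \<otimes> inv h"])
    (auto simp: cj_cj K_carrier K_closed cancel)

lemma cj_E:
  assumes k: "k \<in> carrier G"
  shows "cj k (E x) = E (cj k x)"
proof -
  have "inv k \<otimes> h \<otimes> k \<in> N" if "h \<in> N" for h using normal[of "inv k" h] k that by simp
  then show ?thesis
    unfolding E_def cj_sum
    by (intro sum.reindex_bij_witness[where j="\<lambda>h. k \<otimes> h \<otimes> inv k" and i="\<lambda>h. inv k \<otimes> h \<otimes> k"])
      (use k normal K_carrier in \<open>auto simp: cj_cj m_assoc cancel\<close>)
qed

lemma E_Inv [simp]: "E x \<in> Inv"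
  unfolding Inv_def by (auto simp: cj_E E_cj K_carrier)

lemma u_Inv [simp]: "u g \<in> Inv" unfolding u_def by simp

lemma E_of_Inv: "x \<in> Inv \<Longrightarrow> E x = sc cN x"
  unfolding E_def Inv_def by (auto simp: sc_def fun_eq_iff sum_fun_apply)

lemma Inv_star [simp]: "x \<in> Inv \<Longrightarrow> y \<in> Inv \<Longrightarrow> x \<star> y \<in> Inv"
  unfolding Inv_def by (auto simp: cj_star K_carrier)

lemma Inv_sc [simp]: "x \<in> Inv \<Longrightarrow> sc c x \<in> Inv"
  unfolding Inv_def by (auto simp: cj_sc)

lemma Inv_sum: "(\<And>i. i \<in> A \<Longrightarrow> f i \<in> Inv) \<Longrightarrow> (\<Sum>i\<in>A. f i) \<in> Inv"
  unfolding Inv_def by (auto simp: cj_sum intro!: sum.cong)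

text \<open>Elements of \<open>Inv\<close> are fixed by every \<open>cj h\<close> and can thus be
  pulled out of the average.\<close>

lemma star_E: "x \<in> Inv \<Longrightarrow> x \<star> E y = E (x \<star> y)" "x \<in> Inv \<Longrightarrow> E y \<star> x = E (y \<star> x)"
  unfolding E_def star_sum_left star_sum_right
  by (auto simp: Inv_def cj_star K_carrier intro!: sum.cong)

lemma Z_sc [simp]: "z \<in> Z \<Longrightarrow> sc c z \<in> Z"
  unfolding Z_def by (simp add: sc_def[symmetric]) (simp add: sc_def)

lemma Z_sum: "(\<And>i. i \<in> A \<Longrightarrow> f i \<in> Z) \<Longrightarrow> (\<Sum>i\<in>A. f i) \<in> Z"
  unfolding Z_def by (auto simp: Inv_sum sum_fun_apply)

lemma star_supp: "(x \<star> y) g \<noteq> 0 \<Longrightarrow> \<exists>h\<in>carrier G. x h \<noteq> 0 \<and> y (inv h \<otimes> g) \<noteq> 0"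
  unfolding star_def conv_def by (auto split: if_splits dest: sum.not_neutral_contains_not_neutral)

lemma Z_star [simp]:
  assumes "x \<in> Z" "y \<in> Z"
  shows "x \<star> y \<in> Z"
proof -
  have "(x \<star> y) g = 0" if g: "g \<notin> N" for g
  proof (rule ccontr)
    assume nz: "(x \<star> y) g \<noteq> 0"
    then have gG: "g \<in> carrier G" by (auto simp: star_def split: if_splits)
    obtain h where h: "h \<in> carrier G" "x h \<noteq> 0" "y (inv h \<otimes> g) \<noteq> 0" using star_supp[OF nz] by blast
    then have "h \<in> N" "inv h \<otimes> g \<in> N" using assms unfolding Z_def by blast+
    then have "h \<otimes> (inv h \<otimes> g) \<in> N" by (rule K_closed)
    then show False using g gG h by (simp add: cancel)
  qed
  then show ?thesis using assms unfolding Z_def by simp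
qed

lemma Z_cj [simp]:
  assumes z: "z \<in> Z" and k: "k \<in> carrier G"
  shows "cj k z \<in> Z"
proof -
  have "cj h (cj k z) = cj k z" if h: "h \<in> N" for h
  proof -
    have hh: "inv k \<otimes> h \<otimes> k \<in> N" using normal[of "inv k" h] k h by simp
    have "cj h (cj k z) = cj k (cj (inv k \<otimes> h \<otimes> k) z)"
      using k h K_carrier[OF h] by (simp add: cj_cj m_assoc cancel)
    then show ?thesis using z hh unfolding Z_def Inv_def by simp
  qed
  moreover have "cj k z g = 0" if g: "g \<notin> N" for g
  proof (cases "g \<in> carrier G")
    case True
    have "inv k \<otimes> g \<otimes> k \<notin> N"
    proof
      assume "inv k \<otimes> g \<otimes> k \<in> N"
      then have "k \<otimes> (inv k \<otimes> g \<otimes> k) \<otimes> inv k \<in> N" by (rule normal[OF k])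
      then show False using g k True by (simp add: m_assoc cancel)
    qed
    then show ?thesis using z unfolding Z_def cj_def by simp
  qed (simp add: cj_def)
  ultimately show ?thesis unfolding Z_def Inv_def by simp
qed

text \<open>x commutes with every element of N, and z is a linear combination of elements of
  N.\<close>

lemma Z_commute:
  assumes z: "z \<in> Z" and x: "x \<in> Inv"
  shows "x \<star> z = z \<star> x"
proof
  fix g
  show "(x \<star> z) g = (z \<star> x) g"
  proof (cases "g \<in> carrier G")
    case g: True
    have "(x \<star> z) g = (\<Sum>h\<in>carrier G. x h * z (inv h \<otimes> g))"
      using g by (simp add: star_def conv_def)
    also have "\<dots> = (\<Sum>h\<in>carrier G. x (g \<otimes> inv h) * z h)"
      by (rule sum.reindex_bij_witness[where j="\<lambda>h. inv h \<otimes> g" and i="\<lambda>h. g \<otimes> inv h"])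
        (use g in \<open>auto simp: inv_mult_group m_assoc cancel\<close>)
    also have "\<dots> = (\<Sum>h\<in>carrier G. z h * x (inv h \<otimes> g))"
    proof (rule sum.cong[OF refl])
      fix h assume h: "h \<in> carrier G"
      show "x (g \<otimes> inv h) * z h = z h * x (inv h \<otimes> g)"
      proof (cases "h \<in> N")
        case True
        then have "x (g \<otimes> inv h) = cj h x (g \<otimes> inv h)" using x unfolding Inv_def by simp
        also have "\<dots> = x (inv h \<otimes> g)" using g h by (simp add: cj_def m_assoc)
        finally show ?thesis by simp
      next
        case False
        then show ?thesis using z unfolding Z_def by simp
      qed
    qed
    also have "\<dots> = (z \<star> x) g" using g by (simp add: star_def conv_def)
    finally show ?thesis .
  qed (simp add: star_def)
qed

lemma bar_E: "bar (E x) = E (bar x)"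
  unfolding E_def bar_sum by (simp add: bar_cj K_carrier)

lemma bar_u: "g \<in> carrier G \<Longrightarrow> bar (u g) = u (inv g)"
  unfolding u_def by (simp add: bar_E bar_d)

lemma u_conj: "h \<in> N \<Longrightarrow> g \<in> carrier G \<Longrightarrow> u (h \<otimes> g \<otimes> inv h) = u g"
  unfolding u_def using E_cj[of h "d g"] by (simp add: cj_d K_carrier)

lemma cj_u: "k \<in> carrier G \<Longrightarrow> g \<in> carrier G \<Longrightarrow> cj k (u g) = u (k \<otimes> g \<otimes> inv k)"
  unfolding u_def by (simp add: cj_E cj_d)

lemma u_expand: "g \<in> carrier G \<Longrightarrow> u g = (\<Sum>h\<in>N. d (h \<otimes> g \<otimes> inv h))"
  unfolding u_def E_def by (simp add: cj_d K_carrier)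

lemma u_supp:
  assumes "g \<in> carrier G" "u g x \<noteq> 0"
  obtains h where "h \<in> N" "x = h \<otimes> g \<otimes> inv h"
proof -
  have "(\<Sum>h\<in>N. d (h \<otimes> g \<otimes> inv h) x) \<noteq> 0" using assms u_expand by (simp add: sum_fun_apply)
  then obtain h where "h \<in> N" "d (h \<otimes> g \<otimes> inv h) x \<noteq> 0"
    by (rule sum.not_neutral_contains_not_neutral)
  then show ?thesis using that by (auto simp: d_def split: if_splits)
qed

lemma u_N:
  assumes g: "g \<in> N"
  shows "u g \<in> Z"
proof -
  have "u g x = 0" if x: "x \<notin> N" for x
  proof (rule ccontr)
    assume "u g x \<noteq> 0"
    then obtain h where "h \<in> N" "x = h \<otimes> g \<otimes> inv h" using u_supp[OF K_carrier[OF g]] by blast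
    then show False using x normal[OF K_carrier g] by simp
  qed
  then show ?thesis unfolding Z_def by simp
qed

lemma u_one: "u \<one> = sc cN (d \<one>)"
  using u_expand[of \<one>] by (simp add: K_carrier sc_def fun_eq_iff sum_fun_apply)

lemma d_one_Z: "d \<one> \<in> Z"
  unfolding Z_def Inv_def using K_closed by (auto simp: cj_d K_carrier) (auto simp: d_def)

text \<open>Expanding the second factor gives the sum of u (g h s h^-1) over h in N; the hypothesis
  puts all these arguments into the N-conjugacy class of g s, so no other class occurs.\<close>

lemma u_star_u:
  assumes g: "g \<in> carrier G" and s: "s \<in> carrier G"
    and conj: "\<And>h. h \<in> N \<Longrightarrow> \<exists>k\<in>N. g \<otimes> (h \<otimes> s \<otimes> inv h) = k \<otimes> (g \<otimes> s) \<otimes> inv k"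
  shows "u g \<star> u s = sc cN (u (g \<otimes> s))"
proof -
  have "u g \<star> u s = E (d g \<star> u s)" unfolding u_def[of g] by (simp add: star_E)
  also have "\<dots> = (\<Sum>h\<in>N. u (g \<otimes> (h \<otimes> s \<otimes> inv h)))"
    using g s K_carrier by (simp add: u_expand[OF s] star_sum_right E_sum d_star_d u_def[symmetric])
  also have "\<dots> = (\<Sum>h\<in>N. u (g \<otimes> s))"
  proof (rule sum.cong[OF refl])
    fix h assume "h \<in> N"
    then obtain k where "k \<in> N" "g \<otimes> (h \<otimes> s \<otimes> inv h) = k \<otimes> (g \<otimes> s) \<otimes> inv k" using conj by blast
    then show "u (g \<otimes> (h \<otimes> s \<otimes> inv h)) = u (g \<otimes> s)" using u_conj[of k "g \<otimes> s"] g s by simp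
  qed
  also have "\<dots> = sc cN (u (g \<otimes> s))" by (auto simp: sc_def fun_eq_iff sum_fun_apply)
  finally show ?thesis .
qed

text \<open>As s is its own inverse, a product of two of its N-conjugates has the form h (s (h^-1 k)
  s^-1) k^-1, which lies in N by normality.\<close>

lemma u_square_Z:
  assumes s: "s \<in> carrier G" "s \<otimes> s = \<one>"
  shows "u s \<star> u s \<in> Z"
proof -
  have "(u s \<star> u s) g = 0" if g: "g \<notin> N" for g
  proof (rule ccontr)
    assume nz: "(u s \<star> u s) g \<noteq> 0"
    then have gG: "g \<in> carrier G" by (auto simp: star_def split: if_splits)
    obtain x where x: "x \<in> carrier G" "u s x \<noteq> 0" "u s (inv x \<otimes> g) \<noteq> 0" using star_supp[OF nz] by blast
    obtain h where h: "h \<in> N" "x = h \<otimes> s \<otimes> inv h" using u_supp[OF s(1) x(2)] .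
    obtain k where k: "k \<in> N" "inv x \<otimes> g = k \<otimes> s \<otimes> inv k" using u_supp[OF s(1) x(3)] .
    have ss: "inv s = s" using s by (simp add: inv_equality)
    have "g = x \<otimes> (inv x \<otimes> g)" using x gG by (simp add: cancel)
    also have "\<dots> = (h \<otimes> s \<otimes> inv h) \<otimes> (k \<otimes> s \<otimes> inv k)" by (simp only: k(2)) (simp only: h(2))
    also have "\<dots> = h \<otimes> (s \<otimes> (inv h \<otimes> k) \<otimes> inv s) \<otimes> inv k"
      unfolding ss using K_carrier[OF h(1)] K_carrier[OF k(1)] s(1) by (simp add: m_assoc)
    also have "\<dots> \<in> N" using h k s(1) by (intro K_closed normal)
    finally show False using g by simp
  qed
  then show ?thesis unfolding Z_def by simp
qed

text \<open>Before averaging, (s z s^-1) s = s z. Averaging over N replaces s by u s, and z commutes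
  with u s.\<close>

lemma cj_star_u:
  assumes z: "z \<in> Z" and s: "s \<in> carrier G"
  shows "cj s z \<star> u s = z \<star> u s"
proof -
  have "cj s z \<star> u s = E (cj s z \<star> d s)" unfolding u_def using z s by (intro star_E Z_Inv) simp
  also have "\<dots> = E (d s) \<star> z" using z s by (simp add: cj_swap Z_CG star_E Z_Inv)
  also have "\<dots> = z \<star> u s" unfolding u_def using z by (simp add: Z_commute)
  finally show ?thesis .
qed

end

section \<open>Permutations\<close>

text \<open>If p moves i and j = p^-1 i, then \<open>p \<circ> transpose i j\<close> fixes i and
  moves fewer points. Read backwards, every permutation arises from the identity by inserting one
  fixed point at a time into a cycle. At each such step {i} is an invariant set that separates i
  from j.\<close>

lemma permutes_fixed_induct [consumes 2, case_names id swap]: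
  assumes p: "p permutes S" and fin: "finite S"
    and id: "P id"
    and swap: "\<And>p i j. p permutes S \<Longrightarrow> i \<in> S \<Longrightarrow> j \<in> S \<Longrightarrow> i \<noteq> j \<Longrightarrow> p i = i \<Longrightarrow> P p \<Longrightarrow> P (p \<circ> transpose i j)"
  shows "P p"
  using p
proof (induction "card {x. p x \<noteq> x}" arbitrary: p rule: less_induct)
  case less
  show ?case
  proof (cases "p = id")
    case False
    then obtain i where i: "p i \<noteq> i" by (auto simp: fun_eq_iff)
    then have iS: "i \<in> S" using less(2) permutes_not_in by metis
    define j where "j = inv' p i"
    have pj: "p j = i" unfolding j_def using permutes_inverses(1)[OF less(2)] .
    have jS: "j \<in> S" using pj iS less(2) by (metis permutes_not_in)
    have ij: "i \<noteq> j" using pj i by auto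
    let ?q = "p \<circ> transpose i j"
    have q: "?q permutes S" by (intro permutes_compose permutes_swap_id iS jS less(2))
    have qi: "?q i = i" using pj by simp
    have "{x. ?q x \<noteq> x} \<subset> {x. p x \<noteq> x}"
    proof
      show "{x. ?q x \<noteq> x} \<subseteq> {x. p x \<noteq> x}" using pj ij i by (auto simp: transpose_def split: if_splits)
      show "{x. ?q x \<noteq> x} \<noteq> {x. p x \<noteq> x}" using qi i by blast
    qed
    moreover have "{x. p x \<noteq> x} \<subseteq> S" using permutes_not_in[OF less(2)] by blast
    ultimately have "card {x. ?q x \<noteq> x} < card {x. p x \<noteq> x}"
      using fin by (meson finite_subset psubset_card_mono)
    then have "P (?q \<circ> transpose i j)" using swap[OF q iS jS ij qi] less(1) q by blast
    moreover have "?q \<circ> transpose i j = p" by (simp add: comp_assoc)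
    ultimately show ?thesis by simp
  qed (use id in simp)
qed

text \<open>For a permutation of a finite set this says that i and j lie in different cycles. It is
  phrased by an invariant set because that set will be the support of a conjugating element of the
  wreath product.\<close>

definition separated :: "'a set \<Rightarrow> ('a \<Rightarrow> 'a) \<Rightarrow> 'a \<Rightarrow> 'a \<Rightarrow> bool" where
  "separated S p i j \<longleftrightarrow> (\<exists>C\<subseteq>S. p ` C = C \<and> i \<in> C \<and> j \<notin> C)"

lemma permutes_image_eqI:
  assumes "p permutes S" "finite S" "C \<subseteq> S" "p ` C \<subseteq> C"
  shows "p ` C = C"
  using assms by (meson endo_inj_surj finite_subset permutes_inj inj_on_subset subset_UNIV)

lemma funpow_closed: "p ` C \<subseteq> C \<Longrightarrow> x \<in> C \<Longrightarrow> (p ^^ k) x \<in> C"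
  by (induction k) auto

text \<open>Only forward iterates are taken; for a permutation of a finite set they already form the
  whole cycle.\<close>

definition orb :: "('a \<Rightarrow> 'a) \<Rightarrow> 'a \<Rightarrow> 'a set" where
  "orb p x = range (\<lambda>k. (p ^^ k) x)"

lemma orb_closed: "p ` orb p x \<subseteq> orb p x"
proof
  fix y assume "y \<in> p ` orb p x"
  then obtain k where "y = p ((p ^^ k) x)" unfolding orb_def by blast
  then have "y = (p ^^ Suc k) x" by simp
  then show "y \<in> orb p x" unfolding orb_def by blast
qed

lemma orb_self: "x \<in> orb p x" unfolding orb_def by (metis funpow_0 rangeI)

lemma orb_least: "p ` C \<subseteq> C \<Longrightarrow> x \<in> C \<Longrightarrow> orb p x \<subseteq> C"
  unfolding orb_def using funpow_closed[of p C x] by (auto simp del: image_subset_iff)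

lemma funpow_image: "p ` C = C \<Longrightarrow> (p ^^ k) ` C = C"
proof (induction k)
  case (Suc k)
  have "(p ^^ Suc k) ` C = p ` ((p ^^ k) ` C)" by (simp only: funpow.simps image_comp)
  with Suc show ?case by simp
qed simp

lemma orb_in: "p permutes S \<Longrightarrow> x \<in> S \<Longrightarrow> orb p x \<subseteq> S"
  using orb_least[of p S x] permutes_image by fastforce

lemma orb_eq:
  assumes p: "p permutes S" and fin: "finite S" and x: "x \<in> S" and y: "y \<in> orb p x"
  shows "orb p y = orb p x"
proof
  show "orb p y \<subseteq> orb p x" using orb_least[OF orb_closed y] .
  obtain k where k: "y = (p ^^ k) x" using y unfolding orb_def by blast
  have yS: "y \<in> S" using orb_in[OF p x] y by blast
  have "p ` orb p y = orb p y" by (rule permutes_image_eqI[OF p fin orb_in[OF p yS] orb_closed])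
  then have "(p ^^ k) ` orb p y = orb p y" by (rule funpow_image)
  then obtain w where w: "w \<in> orb p y" "(p ^^ k) w = y" using orb_self[of y p] by (metis imageE)
  then have "w = x" using k inj_fn[OF permutes_inj[OF p], of k] by (auto dest: injD)
  then have "x \<in> orb p y" using w(1) by simp
  then show "orb p x \<subseteq> orb p y" by (rule orb_least[OF orb_closed])
qed

text \<open>Multiplication by a transposition merges two cycles or splits one. If j = p^m i with m
  least, then \<open>p \<circ> transpose i j\<close> sends j to p i, so the stretch p i, ..., p^m i
  = j is closed under it; the complement of this stretch contains i and not j.\<close>

lemma separated_or:
  assumes p: "p permutes S" and fin: "finite S" and ij: "i \<in> S" "j \<in> S" "i \<noteq> j"
  shows "separated S p i j \<or> separated S (p \<circ> transpose i j) i j"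
proof (cases "j \<in> orb p i")
  case False
  then show ?thesis
    using permutes_image_eqI[OF p fin orb_in[OF p ij(1)] orb_closed] orb_in[OF p ij(1)] orb_self[of i p]
    unfolding separated_def by (intro disjI1 exI[of _ "orb p i"]) simp
next
  case True
  define m where "m = (LEAST m. j = (p ^^ m) i)"
  have m: "j = (p ^^ m) i" unfolding m_def using True unfolding orb_def by (auto intro: LeastI)
  have min: "j \<noteq> (p ^^ k) i" if "k < m" for k using not_less_Least that unfolding m_def by blast
  have m0: "0 < m" using m ij(3) by (cases m) auto
  define C where "C = (\<lambda>k. (p ^^ k) i) ` {1..m}"
  have CS: "C \<subseteq> S" unfolding C_def using orb_in[OF p ij(1)] unfolding orb_def by blast
  have iC: "i \<notin> C"
  proof
    assume "i \<in> C"
    then obtain k where k: "1 \<le> k" "k \<le> m" "i = (p ^^ k) i" unfolding C_def by auto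
    have "j = (p ^^ (m - k)) ((p ^^ k) i)"
      using m k(2) by (simp add: funpow_add[symmetric, THEN fun_cong, unfolded comp_apply])
    then show False using min[of "m - k"] k m0 by simp
  qed
  have jC: "j \<in> C" unfolding C_def using m m0 by auto
  let ?t = "p \<circ> transpose i j"
  have t: "?t permutes S" by (intro permutes_compose permutes_swap_id ij p)
  have "?t ` C \<subseteq> C"
  proof
    fix y assume "y \<in> ?t ` C"
    then obtain k where k: "1 \<le> k" "k \<le> m" "y = ?t ((p ^^ k) i)" unfolding C_def by auto
    show "y \<in> C"
    proof (cases "k = m")
      case True
      then have "y = (p ^^ 1) i" using k m by simp
      then show ?thesis unfolding C_def using m0 by (intro image_eqI[of _ _ 1]) auto
    next
      case False
      then have "(p ^^ k) i \<noteq> j" using min[of k] k by auto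
      moreover have "(p ^^ k) i \<in> C" unfolding C_def using k by auto
      then have "(p ^^ k) i \<noteq> i" using iC by auto
      ultimately have "y = (p ^^ Suc k) i" using k by simp
      then show ?thesis unfolding C_def using k False by (intro image_eqI[of _ _ "Suc k"]) auto
    qed
  qed
  then have "?t ` C = C" by (rule permutes_image_eqI[OF t fin CS])
  then have "?t ` (S - C) = S - C"
    using permutes_image[OF t] image_set_diff[OF permutes_inj[OF t], of S C] by simp
  then show ?thesis unfolding separated_def using iC jC ij by blast
qed

lemma separated_inv:
  assumes "p permutes S" "separated S p i j"
  shows "separated S (inv' p) i j"
proof -
  obtain C where C: "C \<subseteq> S" "p ` C = C" "i \<in> C" "j \<notin> C" using assms(2) unfolding separated_def by blast
  have "inv' p ` C = inv' p ` (p ` C)" using C by simp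
  also have "\<dots> = C" using permutes_inverses(2)[OF assms(1)] by (simp add: image_image)
  finally show ?thesis using C unfolding separated_def by blast
qed

text \<open>
  On each orbit choose base points \<open>r\<close>, \<open>t\<close> (with \<open>{r, t} = {b, c}\<close> on an orbit containing both
  \<open>b\<close> and \<open>c\<close>) and reflect: \<open>p\<^sup>k r \<mapsto> p\<^sup>-\<^sup>k t\<close>.
\<close>

lemma inverting_permutation:
  assumes p: "p permutes S" and fin: "finite S" and b: "b \<in> S" and c: "c \<in> S"
  obtains q where "q permutes S" "q \<circ> p \<circ> inv' q = inv' p" "\<forall>C. C \<subseteq> S \<and> p ` C = C \<longrightarrow> q ` C = C"
    "q b = b \<and> q c = c \<or> q b = c \<and> q c = b"
proof -
  define r where "r x = (if b \<in> orb p x then b else if c \<in> orb p x then c else SOME y. y \<in> orb p x)" for x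
  define t where "t x = (if b \<in> orb p x \<and> c \<in> orb p x then c else r x)" for x
  have r: "r x \<in> orb p x" for x unfolding r_def using someI[of "\<lambda>y. y \<in> orb p x", OF orb_self] by simp
  have t: "t x \<in> orb p x" for x unfolding t_def using r by simp
  have eq: "orb p y = orb p x" if "x \<in> S" "y \<in> orb p x" for x y using orb_eq[OF p fin that] .
  have rt: "r y = r x" "t y = t x" if "x \<in> S" "y \<in> orb p x" for x y
    using eq[OF that] unfolding r_def t_def by auto
  have inj: "inj (p ^^ k)" for k using inj_fn[OF permutes_inj[OF p]] .
  have surj: "\<exists>y. z = (p ^^ k) y" for k z
  proof -
    have "bij (p ^^ k)" using permutes_bij[OF p] by (induction k) (auto simp: bij_comp)
    then show ?thesis using bij_pointE[of "p ^^ k" z] by blast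
  qed
  have add: "(p ^^ (k + l)) x = (p ^^ k) ((p ^^ l) x)" for k l x by (simp add: funpow_add)
  \<comment> \<open>\<open>R x y\<close> says that y is p^-k (t x) for some k with x = p^k (r x). A
    relation is used because k is determined only modulo the length of the cycle;
    \<open>uniq\<close> shows that y does not depend on the choice.\<close>
  define R where "R x y \<longleftrightarrow> (\<exists>k. x = (p ^^ k) (r x) \<and> t x = (p ^^ k) y)" for x y
  have ex: "\<exists>y. R x y" if x: "x \<in> S" for x
  proof -
    have "x \<in> orb p (r x)" using eq[OF x r] orb_self[of x p] by simp
    then obtain k where k: "x = (p ^^ k) (r x)" unfolding orb_def by blast
    obtain y where "t x = (p ^^ k) y" using surj[of "t x" k] by blast
    with k show ?thesis unfolding R_def by blast
  qed
  have uniq: "y = y'" if x: "x \<in> S" and R: "R x y" "R x y'" for x y y'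
  proof -
    obtain k where k: "x = (p ^^ k) (r x)" "t x = (p ^^ k) y" using R unfolding R_def by blast
    obtain l where l: "x = (p ^^ l) (r x)" "t x = (p ^^ l) y'" using R unfolding R_def by blast
    have "t x \<in> orb p (r x)" using eq[OF x r] t by simp
    then obtain m where m: "t x = (p ^^ m) (r x)" unfolding orb_def by blast
    have "(p ^^ (k + l)) y = (p ^^ m) x"
      using k(2) l(1) m by (metis add add.commute)
    moreover have "(p ^^ (k + l)) y' = (p ^^ m) x"
      using k(1) l(2) m by (metis add add.commute)
    ultimately show ?thesis using injD[OF inj[of "k + l"], of y y'] by simp
  qed
  define q where "q x = (if x \<in> S then THE y. R x y else x)" for x
  have q: "R x (q x)" if "x \<in> S" for x
    using ex[OF that] uniq[OF that] that unfolding q_def by (metis theI)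
  have qI: "q x = y" if "x \<in> S" "R x y" for x y using q uniq that by blast
  have torb: "t x \<in> orb p (q x)" if "x \<in> S" for x using q[OF that] unfolding R_def orb_def by blast
  have pres: "q x \<in> C" if C: "C \<subseteq> S" "p ` C = C" and x: "x \<in> C" for C x
  proof -
    obtain k where k: "t x = (p ^^ k) (q x)" using q x C unfolding R_def by blast
    have "(p ^^ k) ` C = C" using C(2) by (rule funpow_image)
    moreover have "t x \<in> C" using t orb_least[of p C x] C x by blast
    ultimately obtain w where "w \<in> C" "(p ^^ k) w = t x" by (metis imageE)
    then show ?thesis using k injD[OF inj[of k], of w "q x"] by simp
  qed
  have qS: "q x \<in> S" if "x \<in> S" for x using pres[of S x] permutes_image[OF p] that by blast
  have q_orb: "orb p (q x) = orb p x" if "x \<in> S" for x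
    using eq[OF qS[OF that] torb[OF that]] eq[OF that t] by simp
  have injq: "inj_on q S"
  proof (rule inj_onI)
    fix x x' assume x: "x \<in> S" "x' \<in> S" and qq: "q x = q x'"
    have "x' \<in> orb p x" using q_orb[OF x(1)] q_orb[OF x(2)] qq orb_self[of x' p] by simp
    then have rr: "r x' = r x" "t x' = t x" using rt[OF x(1)] by auto
    obtain k where k: "x = (p ^^ k) (r x)" "t x = (p ^^ k) (q x)" using q[OF x(1)] unfolding R_def by blast
    obtain l where l: "x' = (p ^^ l) (r x)" "t x = (p ^^ l) (q x)"
      using q[OF x(2)] unfolding R_def rr qq[symmetric] by blast
    have "r x \<in> orb p (t x)" using eq[OF x(1) t] r by simp
    then obtain m where m: "r x = (p ^^ m) (t x)" unfolding orb_def by blast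
    have "x = (p ^^ (k + m + l)) (q x)" using k(1) m l(2) by (metis add)
    moreover have "x' = (p ^^ (k + m + l)) (q x)" using l(1) m k(2) by (metis add add.commute add.left_commute)
    ultimately show "x = x'" by simp
  qed
  have "q ` S = S" using endo_inj_surj[OF fin _ injq] qS by blast
  then have "q permutes S"
    using injq by (intro bij_imp_permutes) (auto simp: bij_betw_def q_def)
  moreover have "q \<circ> p \<circ> inv' q = inv' p"
  proof -
    have "p (q (p x)) = q x" if x: "x \<in> S" for x
    proof -
      have px: "p x \<in> S" using x permutes_in_image[OF p] by simp
      have po: "p x \<in> orb p x" using orb_closed orb_self by fast
      obtain k where k: "x = (p ^^ k) (r x)" "t x = (p ^^ k) (q x)" using q[OF x] unfolding R_def by blast
      have "p (inv' p (q x)) = q x" using permutes_inverses(1)[OF p] .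
      then have "(p ^^ Suc k) (inv' p (q x)) = (p ^^ k) (q x)" by (metis funpow_swap1 funpow.simps(2) comp_apply)
      moreover have "p x = (p ^^ Suc k) (r x)" using k(1) by (metis funpow.simps(2) comp_apply)
      ultimately have "R (p x) (inv' p (q x))" unfolding R_def rt[OF x po] using k(2) by metis
      then have "q (p x) = inv' p (q x)" by (rule qI[OF px])
      then show ?thesis using permutes_inverses(1)[OF p] by simp
    qed
    moreover have "p (q (p x)) = q x" if "x \<notin> S" for x
      using that permutes_not_in[OF p] by (simp add: q_def)
    ultimately have "q (p x) = inv' p (q x)" for x using permutes_inverses(2)[OF p] by metis
    then have "q \<circ> p = inv' p \<circ> q" by auto
    then have "q \<circ> p \<circ> inv' q = inv' p \<circ> (q \<circ> inv' q)" by (simp add: comp_assoc)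
    then show ?thesis using permutes_inv_o(1)[OF \<open>q permutes S\<close>] by simp
  qed
  moreover have "\<forall>C. C \<subseteq> S \<and> p ` C = C \<longrightarrow> q ` C = C"
    using permutes_image_eqI[OF \<open>q permutes S\<close> fin] pres by blast
  moreover have "q b = b \<and> q c = c \<or> q b = c \<and> q c = b"
  proof (cases "c \<in> orb p b")
    case True
    then have ob: "orb p c = orb p b" using eq[OF b] by blast
    have rb: "r b = b" "r c = b" and tb: "t b = c" "t c = c"
      unfolding r_def t_def using ob orb_self[of b p] orb_self[of c p] by auto
    \<comment> \<open>Here r = b and t = c: the exponent 0 sends b to c, and the exponent k with p^k
      b = c sends c to p^-k c = b.\<close>
    have "R b c" unfolding R_def rb tb by (intro exI[of _ 0]) simp
    moreover obtain k where "c = (p ^^ k) b" using True unfolding orb_def by blast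
    then have "R c b" unfolding R_def rb tb by blast
    ultimately show ?thesis using qI b c by blast
  next
    case False
    then have "b \<notin> orb p c" using eq[OF c] orb_self[of c p] by blast
    then have "r b = b" "r c = c" "t b = b" "t c = c"
      unfolding r_def t_def using False orb_self[of b p] orb_self[of c p] by auto
    then have "R b b" "R c c" unfolding R_def by (metis funpow_0)+
    then show ?thesis using qI b c by blast
  qed
  ultimately show ?thesis using that by blast
qed


section \<open>The wreath product\<close>

lemma wreath_carrier: "carrier (wreath_product F n B) = (\<Pi>\<^sub>E i\<in>{1..n}. carrier F) \<times> B"
  by (simp add: wreath_product_def semidirect_product_def)

lemma wreath_mult: "(x, p) \<otimes>\<^bsub>wreath_product F n B\<^esub> (y, q) =
    (\<lambda>i\<in>{1..n}. x i \<otimes>\<^bsub>F\<^esub> (\<lambda>i\<in>{1..n}. y (inv' p i)) i, p \<circ> q)"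
  by (simp add: wreath_product_def semidirect_product_def sym_group_def)

lemma wreath_one: "\<one>\<^bsub>wreath_product F n B\<^esub> = (\<lambda>i\<in>{1..n}. \<one>\<^bsub>F\<^esub>, id)"
  by (simp add: wreath_product_def semidirect_product_def sym_group_def)

locale wreath = F: group F for F :: "('a, 'm) monoid_scheme" (structure) and n :: nat +
  assumes finF: "finite (carrier F)"
begin

definition S :: "nat set" where "S = {1..n}"

abbreviation "Base \<equiv> (\<Pi>\<^sub>E i\<in>S. carrier F)"
abbreviation "Perm \<equiv> {p. p permutes S}"
definition N :: "((nat \<Rightarrow> 'a) \<times> (nat \<Rightarrow> nat)) set" where "N = Base \<times> {id}"

lemma finS [simp]: "finite S" by (simp add: S_def)

abbreviation "e \<equiv> \<lambda>i\<in>S. \<one>"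

definition W :: "((nat \<Rightarrow> 'a) \<times> (nat \<Rightarrow> nat)) monoid" where
  "W = wreath_product F n (carrier (sym_group n))"

abbreviation wmult (infixl "\<bullet>" 70) where "wmult \<equiv> monoid.mult W"
abbreviation "winv \<equiv> m_inv W"

lemma W_carrier: "carrier W = Base \<times> Perm"
  by (simp add: W_def wreath_carrier sym_group_def S_def)

lemma W_one: "\<one>\<^bsub>W\<^esub> = (e, id)"
  by (simp add: W_def wreath_one S_def)

lemma perm_S: "p permutes S \<Longrightarrow> i \<in> S \<Longrightarrow> p i \<in> S" "p permutes S \<Longrightarrow> i \<in> S \<Longrightarrow> inv' p i \<in> S"
  using permutes_in_image[of p S i] permutes_in_image[OF permutes_inv, of p S i] by blast+

lemma W_mult: "p permutes S \<Longrightarrow> (x, p) \<bullet> (y, q) = (\<lambda>i\<in>S. x i \<otimes> y (inv' p i), p \<circ> q)"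
  using perm_S(2)[of p] unfolding W_def wreath_mult S_def by (auto simp: fun_eq_iff)

lemma BaseD: "x \<in> Base \<Longrightarrow> i \<in> S \<Longrightarrow> x i \<in> carrier F"
  by (rule PiE_mem)

lemma Base_eqI: "x \<in> Base \<Longrightarrow> y \<in> Base \<Longrightarrow> (\<And>i. i \<in> S \<Longrightarrow> x i = y i) \<Longrightarrow> x = y"
  by (rule PiE_ext)

lemma e_Base: "e \<in> Base" by auto

lemma W_mult_closed: "x \<in> Base \<Longrightarrow> y \<in> Base \<Longrightarrow> p permutes S \<Longrightarrow> (\<lambda>i\<in>S. x i \<otimes> y (inv' p i)) \<in> Base"
  using BaseD perm_S by auto

lemma inv_comp_perm: "p permutes S \<Longrightarrow> q permutes S \<Longrightarrow> inv' (p \<circ> q) i = inv' q (inv' p i)"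
  using permutes_bij[of p S] permutes_bij[of q S] by (simp add: o_inv_distrib)

lemma W_inverse:
  assumes x: "x \<in> Base" and p: "p permutes S"
  shows "(\<lambda>i\<in>S. inv x (p i), inv' p) \<in> carrier W"
    "(\<lambda>i\<in>S. inv x (p i), inv' p) \<bullet> (x, p) = \<one>\<^bsub>W\<^esub>"
proof -
  show "(\<lambda>i\<in>S. inv x (p i), inv' p) \<in> carrier W"
    using x p perm_S by (auto simp: W_carrier permutes_inv BaseD)
  have "inv' (inv' p) = p" using p by (rule permutes_inv_inv)
  then show "(\<lambda>i\<in>S. inv x (p i), inv' p) \<bullet> (x, p) = \<one>\<^bsub>W\<^esub>"
    unfolding W_mult[OF permutes_inv[OF p]] W_one using perm_S(1)[OF p] x permutes_inv_o(2)[OF p]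
    by (auto simp: BaseD fun_eq_iff)
qed

lemma W_group: "group W"
proof (rule groupI)
  show "\<one>\<^bsub>W\<^esub> \<in> carrier W" by (simp add: W_one W_carrier permutes_id)
next
  fix g h assume "g \<in> carrier W" "h \<in> carrier W"
  then obtain x p y q where gh: "g = (x, p)" "h = (y, q)" "x \<in> Base" "y \<in> Base" "p permutes S" "q permutes S"
    unfolding W_carrier by blast
  show "g \<bullet> h \<in> carrier W"
    using gh W_mult_closed[OF gh(3,4,5)] permutes_compose by (simp add: W_mult W_carrier)
  fix k assume "k \<in> carrier W"
  then obtain z r where k: "k = (z, r)" "z \<in> Base" "r permutes S" unfolding W_carrier by blast
  have "(\<lambda>i\<in>S. (\<lambda>i\<in>S. x i \<otimes> y (inv' p i)) i \<otimes> z (inv' (p \<circ> q) i)) =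
      (\<lambda>i\<in>S. x i \<otimes> (\<lambda>i\<in>S. y i \<otimes> z (inv' q i)) (inv' p i))"
    using gh k perm_S by (intro restrict_ext) (simp add: inv_comp_perm BaseD F.m_assoc)
  then show "g \<bullet> h \<bullet> k = g \<bullet> (h \<bullet> k)"
    unfolding gh(1,2) k(1) using gh(5,6) by (simp add: W_mult permutes_compose comp_assoc)
next
  fix g assume "g \<in> carrier W"
  then obtain x p where g: "g = (x, p)" "x \<in> Base" "p permutes S" unfolding W_carrier by blast
  have "(\<lambda>i\<in>S. e i \<otimes> x (inv' id i)) = x"
    using g(2) by (intro Base_eqI) (auto simp: BaseD)
  then show "\<one>\<^bsub>W\<^esub> \<bullet> g = g" using g by (simp add: W_one W_mult permutes_id)
  show "\<exists>h\<in>carrier W. h \<bullet> g = \<one>\<^bsub>W\<^esub>" using W_inverse[OF g(2,3)] g(1) by blast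
qed

lemma W_inv: "x \<in> Base \<Longrightarrow> p permutes S \<Longrightarrow> winv (x, p) = (\<lambda>i\<in>S. inv x (p i), inv' p)"
  using W_inverse by (intro group.inv_equality[OF W_group]) (auto simp: W_carrier)

lemma W_finite: "finite (carrier W)"
  unfolding W_carrier using finF by (intro finite_cartesian_product finite_PiE finite_permutations) auto

lemma snd_W: "g \<in> carrier W \<Longrightarrow> h \<in> carrier W \<Longrightarrow> snd (g \<bullet> h) = snd g \<circ> snd h"
  "g \<in> carrier W \<Longrightarrow> snd (winv g) = inv' (snd g)"
  by (auto simp: W_carrier W_mult W_inv)

lemma subgroup_W:
  assumes B: "B \<subseteq> Perm" "id \<in> B" "\<And>p q. p \<in> B \<Longrightarrow> q \<in> B \<Longrightarrow> p \<circ> q \<in> B" "\<And>p. p \<in> B \<Longrightarrow> inv' p \<in> B"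
  shows "subgroup (Base \<times> B) W"
proof (rule group.subgroupI[OF W_group])
  show "Base \<times> B \<subseteq> carrier W" using B(1) by (auto simp: W_carrier)
  show "Base \<times> B \<noteq> {}" using B(2) e_Base by blast
  fix g assume g: "g \<in> Base \<times> B"
  then have gW: "g \<in> carrier W" using B(1) by (auto simp: W_carrier)
  have "winv g \<in> carrier W" using group.inv_closed[OF W_group gW] .
  then show "winv g \<in> Base \<times> B"
    using g snd_W(2)[OF gW] B(4) by (auto simp: W_carrier)
  fix h assume h: "h \<in> Base \<times> B"
  then have hW: "h \<in> carrier W" using B(1) by (auto simp: W_carrier)
  have "g \<bullet> h \<in> carrier W" using monoid.m_closed[OF group.is_monoid[OF W_group] gW hW] .
  then show "g \<bullet> h \<in> Base \<times> B"
    using g h snd_W(1)[OF gW hW] B(3) by (auto simp: W_carrier)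
qed

lemma conj_snd: "k \<in> carrier W \<Longrightarrow> g \<in> carrier W \<Longrightarrow>
    snd (k \<bullet> g \<bullet> winv k) = snd k \<circ> snd g \<circ> inv' (snd k)"
  using group.inv_closed[OF W_group] monoid.m_closed[OF group.is_monoid[OF W_group]] by (simp add: snd_W)

end

sublocale wreath \<subseteq> G: group_with_normal W N
proof (intro group_with_normal.intro group_with_subgroup.intro group_with_subgroup_axioms.intro
    group_with_normal_axioms.intro W_group W_finite)
  show "subgroup N W" unfolding N_def by (rule subgroup_W) (auto simp: permutes_id)
  fix g h assume g: "g \<in> carrier W" and h: "h \<in> N"
  have hW: "h \<in> carrier W" using h by (auto simp: W_carrier N_def permutes_id)
  have "g \<bullet> h \<bullet> winv g \<in> carrier W"
    using g hW group.inv_closed[OF W_group] monoid.m_closed[OF group.is_monoid[OF W_group]] by blast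
  moreover have "snd (g \<bullet> h \<bullet> winv g) = id"
    using conj_snd[OF g hW] g h permutes_inv_o(1)[of "snd g" S] by (auto simp: W_carrier N_def)
  ultimately show "g \<bullet> h \<bullet> winv g \<in> N" by (auto simp: W_carrier N_def)
qed

section \<open>The elements U p, their products and their coefficients\<close>

context wreath
begin

notation G.star (infixl "\<star>" 70)

definition pm :: "(nat \<Rightarrow> nat) \<Rightarrow> (nat \<Rightarrow> 'a) \<times> (nat \<Rightarrow> nat)" where
  "pm p = (e, p)"

definition U :: "(nat \<Rightarrow> nat) \<Rightarrow> (nat \<Rightarrow> 'a) \<times> (nat \<Rightarrow> nat) \<Rightarrow> complex" where
  "U p = G.u (pm p)"

lemma pm_W: "p permutes S \<Longrightarrow> pm p \<in> carrier W"
  by (simp add: pm_def W_carrier)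

lemma mult_pm: "m \<in> Base \<Longrightarrow> p permutes S \<Longrightarrow> (m, p) \<bullet> pm q = (m, p \<circ> q)"
  unfolding pm_def using perm_S(2)[of p]
  by (subst W_mult) (auto intro!: Base_eqI[of _ m] simp: BaseD)

lemma pm_mult: "p permutes S \<Longrightarrow> pm p \<bullet> pm q = pm (p \<circ> q)"
  using mult_pm[OF e_Base, of p q] by (simp add: pm_def)

lemma pm_id: "pm id = \<one>\<^bsub>W\<^esub>" by (simp add: pm_def W_one)

lemma pm_inv: "p permutes S \<Longrightarrow> winv (pm p) = pm (inv' p)"
  using W_inv[OF e_Base, of p] perm_S(1)[of p] by (auto simp: pm_def fun_eq_iff)

lemma conj_base:
  assumes h: "h \<in> Base" and m: "m \<in> Base" and p: "p permutes S"
  shows "(h, id) \<bullet> (m, p) \<bullet> winv (h, id) =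
    (\<lambda>i\<in>S. h i \<otimes> m i \<otimes> inv (h (inv' p i)), p)"
  using perm_S(2)[OF p] p by (auto simp: W_inv[OF h permutes_id] W_mult permutes_id fun_eq_iff)

text \<open>Conjugating (i j) by a base element inserts some x at i and x^-1 at j. Conjugating (m,
  p) (i j) by the base element that is x on C and trivial elsewhere has the same effect: m is
  trivial on the p-invariant set C, so the inserted entries cancel except where the transposition
  crosses the border of C. Hence \<open>u_star_u\<close> applies.\<close>

lemma u_mult_transposition:
  assumes m: "m \<in> Base" and p: "p permutes S" and C: "C \<subseteq> S" "p ` C = C"
    and ij: "i \<in> C" "j \<in> S" "j \<notin> C" and mC: "\<And>l. l \<in> C \<Longrightarrow> m l = \<one>"
  shows "G.u (m, p) \<star> U (transpose i j) = G.sc G.cN (G.u (m, p \<circ> transpose i j))"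
proof -
  let ?s = "transpose i j"
  have iS: "i \<in> S" using ij C by blast
  have s: "?s permutes S" using iS ij by (intro permutes_swap_id)
  have ps: "p \<circ> ?s permutes S" using s p by (rule permutes_compose)
  have mp: "(m, p) \<in> carrier W" using m p by (simp add: W_carrier)
  have "\<exists>k\<in>N. (m, p) \<bullet> (h \<bullet> pm ?s \<bullet> winv h) = k \<bullet> ((m, p) \<bullet> pm ?s) \<bullet> winv k"
    if "h \<in> N" for h
  proof -
    obtain \<eta> where h: "h = (\<eta>, id)" "\<eta> \<in> Base" using \<open>h \<in> N\<close> unfolding N_def by blast
    define x where "x = \<eta> i \<otimes> inv \<eta> j"
    have xF: "x \<in> carrier F" using BaseD[OF h(2)] iS ij(2) by (simp add: x_def)
    define \<kappa> where "\<kappa> = (\<lambda>l\<in>S. if l \<in> C then x else \<one>)"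
    have \<kappa>: "\<kappa> \<in> Base" using xF by (auto simp: \<kappa>_def)
    have inv_s: "inv' ?s = ?s" by (rule inv_unique_comp) simp_all
    have L: "(m, p) \<bullet> (h \<bullet> pm ?s \<bullet> winv h) =
        (\<lambda>l\<in>S. m l \<otimes> (\<eta> (inv' p l) \<otimes> inv (\<eta> (?s (inv' p l)))), p \<circ> ?s)"
      unfolding h(1) pm_def conj_base[OF h(2) e_Base s] W_mult[OF p] inv_s
      using perm_S(2)[OF p] BaseD[OF h(2)] by (auto simp: fun_eq_iff)
    have R: "(\<kappa>, id) \<bullet> ((m, p) \<bullet> pm ?s) \<bullet> winv (\<kappa>, id) =
        (\<lambda>l\<in>S. \<kappa> l \<otimes> m l \<otimes> inv (\<kappa> (?s (inv' p l))), p \<circ> ?s)"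
      unfolding mult_pm[OF m p] conj_base[OF \<kappa> m ps] inv_comp_perm[OF p s] inv_s ..
    have "m l \<otimes> (\<eta> (inv' p l) \<otimes> inv (\<eta> (?s (inv' p l)))) =
        \<kappa> l \<otimes> m l \<otimes> inv (\<kappa> (?s (inv' p l)))" if l: "l \<in> S" for l
    proof -
      define w where "w = inv' p l"
      have w: "w \<in> S" unfolding w_def using perm_S(2)[OF p l] .
      have pw: "p w = l" unfolding w_def using permutes_inverses(1)[OF p] .
      have wC: "w \<in> C \<longleftrightarrow> l \<in> C"
        using C(2) pw permutes_inj[OF p] by (metis imageE imageI injD)
      have mF: "m l \<in> carrier F" and \<eta>F: "\<eta> i \<in> carrier F" "\<eta> j \<in> carrier F" "\<eta> w \<in> carrier F"
        using BaseD[OF m l] BaseD[OF h(2)] iS ij(2) w by auto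
      consider "w = i" | "w = j" | "w \<noteq> i" "w \<noteq> j" by blast
      then show ?thesis
      proof cases
        case 1
        then show ?thesis
          using wC ij mC[of l] l xF \<eta>F by (simp add: w_def[symmetric] \<kappa>_def) (simp add: x_def)
      next
        case 2
        then show ?thesis
          using wC ij l iS xF \<eta>F mF by (simp add: w_def[symmetric] \<kappa>_def) (simp add: x_def F.inv_mult_group)
      next
        case 3
        then show ?thesis
          using wC l w xF \<eta>F mF mC[of l] by (simp add: w_def[symmetric] \<kappa>_def)
      qed
    qed
    then have "(\<lambda>l\<in>S. m l \<otimes> (\<eta> (inv' p l) \<otimes> inv (\<eta> (?s (inv' p l))))) =
        (\<lambda>l\<in>S. \<kappa> l \<otimes> m l \<otimes> inv (\<kappa> (?s (inv' p l))))" by (intro restrict_ext) simp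
    then show ?thesis using L R \<kappa> by (intro bexI[of _ "(\<kappa>, id)"]) (auto simp: N_def)
  qed
  then have "G.u (m, p) \<star> G.u (pm ?s) = G.sc G.cN (G.u ((m, p) \<bullet> pm ?s))"
    by (intro G.u_star_u mp pm_W s)
  then show ?thesis by (simp add: U_def mult_pm[OF m p])
qed

lemma U_mult_separated:
  assumes p: "p permutes S" and sep: "separated S p i j" and j: "j \<in> S"
  shows "U p \<star> U (transpose i j) = G.sc G.cN (U (p \<circ> transpose i j))"
proof -
  obtain C where C: "C \<subseteq> S" "p ` C = C" "i \<in> C" "j \<notin> C" using sep unfolding separated_def by blast
  have "e l = \<one>" if "l \<in> C" for l using C(1) that by auto
  then show ?thesis
    unfolding U_def pm_def using u_mult_transposition[OF e_Base p C(1,2,3) j C(4)] by (simp add: U_def pm_def)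
qed

lemma cN: "G.cN \<noteq> 0" by (rule G.cardK)

lemma U_id: "U id = G.sc G.cN (G.d \<one>\<^bsub>W\<^esub>)"
  unfolding U_def pm_id by (rule G.u_one)

lemma U_Inv [simp]: "U p \<in> G.Inv" unfolding U_def by simp

text \<open>When the fixed point i of p is inserted into a cycle, the entry at i can be conjugated
  to \<one>. Then \<open>u_mult_transposition\<close> with C = {i} factors u (m, p (i j)) through u
  (m, p), and the coefficient found for (m, p) serves again. For p = id the element u (m, id) itself
  lies in Z.\<close>

lemma u_in_Z_star_U:
  assumes "p permutes S" and "m \<in> Base"
  shows "\<exists>z\<in>G.Z. G.u (m, p) = z \<star> U p"
  using assms(1) finS assms(2)
proof (induction p arbitrary: m rule: permutes_fixed_induct)
  case id
  have z: "G.u (m, id) \<in> G.Z" using G.u_N[of "(m, id)"] id by (simp add: N_def)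
  have "G.sc (1 / G.cN) (G.u (m, id)) \<star> U id = G.u (m, id) \<star> G.d \<one>\<^bsub>W\<^esub>"
    unfolding U_id using cN by simp
  also have "\<dots> = G.u (m, id)"
    using G.Z_commute[OF G.d_one_Z, of "G.u (m, id)"] G.Z_CG[OF z] by simp
  finally show ?case using G.Z_sc[OF z, of "1 / G.cN"] by metis
next
  case (swap p i j)
  let ?s = "transpose i j"
  have s: "?s permutes S" using swap by (intro permutes_swap_id)
  have ps: "p \<circ> ?s permutes S" using s swap(1) by (rule permutes_compose)
  have sep: "separated S p i j" using swap(2,4,5) unfolding separated_def by (intro exI[of _ "{i}"]) auto
  have *: "\<exists>z\<in>G.Z. G.u (m, p \<circ> ?s) = z \<star> U (p \<circ> ?s)" if m: "m \<in> Base" and mi: "m i = \<one>" for m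
  proof -
    obtain z where z: "z \<in> G.Z" "G.u (m, p) = z \<star> U p" using swap(6)[OF m] by blast
    have "G.sc G.cN (G.u (m, p \<circ> ?s)) = G.u (m, p) \<star> U ?s"
      using u_mult_transposition[OF m swap(1), of "{i}" i j] swap mi by simp
    also have "\<dots> = z \<star> (U p \<star> U ?s)" unfolding z(2) by (rule G.star_assoc)
    also have "\<dots> = G.sc G.cN (z \<star> U (p \<circ> ?s))"
      using U_mult_separated[OF swap(1) sep swap(3)] by simp
    finally have "G.sc (1 / G.cN) (G.sc G.cN (G.u (m, p \<circ> ?s))) = G.sc (1 / G.cN) (G.sc G.cN (z \<star> U (p \<circ> ?s)))"
      by simp
    then show ?thesis using z(1) cN by auto
  qed
  \<comment> \<open>Conjugation by h cancels the entry of m at i from the left; its factor from the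
    right is trivial at i because \<open>p \<circ> ?s\<close> moves i.\<close>
  define h where "h = (\<lambda>l\<in>S. if l = i then inv m i else \<one>)"
  have h: "h \<in> Base" using BaseD[OF swap(7) swap(2)] by (auto simp: h_def)
  define m' where "m' = (\<lambda>l\<in>S. h l \<otimes> m l \<otimes> inv (h (inv' (p \<circ> ?s) l)))"
  have m': "m' \<in> Base"
    using BaseD[OF h] BaseD[OF swap(7)] perm_S(2)[OF ps] by (auto simp: m'_def)
  have "inv' (p \<circ> ?s) i \<noteq> i"
  proof
    assume "inv' (p \<circ> ?s) i = i"
    then have "(p \<circ> ?s) i = i" using permutes_inverses(1)[OF ps, of i] by simp
    then have "p j = p i" using swap(5) by simp
    then show False using swap(4) permutes_inj[OF swap(1)] by (auto dest: injD)
  qed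
  then have "m' i = \<one>"
    using swap(2) BaseD[OF swap(7) swap(2)] perm_S(2)[OF ps swap(2)] by (simp add: m'_def h_def)
  moreover have "G.u (m', p \<circ> ?s) = G.u (m, p \<circ> ?s)"
    using G.u_conj[of "(h, id)" "(m, p \<circ> ?s)"] h swap(7) ps
    by (simp add: conj_base[OF h swap(7) ps] m'_def W_carrier N_def)
  ultimately have "\<exists>z\<in>G.Z. G.u (m, p \<circ> ?s) = z \<star> U (p \<circ> ?s)" using *[OF m'] by simp
  then show ?case .
qed

text \<open>If p separates i and j, the coefficient is the scalar \<open>G.cN\<close>. Otherwise p
  (i j) separates them and U p is a multiple of U (p (i j)) U (i j), so that another factor U (i j)
  produces its square. This square lies in Z and is fixed by \<open>bar\<close>, as (i j) is an
  involution.\<close>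

lemma U_mult_transposition:
  assumes p: "p permutes S" and ij: "i \<in> S" "j \<in> S" "i \<noteq> j"
  shows "\<exists>r\<in>G.Z. G.bar r = r \<and> U p \<star> U (transpose i j) = r \<star> U (p \<circ> transpose i j)"
proof -
  let ?s = "transpose i j"
  have s: "?s permutes S" using ij by (intro permutes_swap_id)
  have ps: "p \<circ> ?s permutes S" using s p by (rule permutes_compose)
  have pss: "p \<circ> ?s \<circ> ?s = p" by (simp add: comp_assoc)
  consider "separated S p i j" | "separated S (p \<circ> ?s) i j" using separated_or[OF p finS ij] by blast
  then show ?thesis
  proof cases
    case 1
    have "U p \<star> U ?s = G.sc G.cN (G.d \<one>\<^bsub>W\<^esub>) \<star> U (p \<circ> ?s)"
      using U_mult_separated[OF p 1 ij(2)] G.Inv_CG[OF U_Inv] by simp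
    moreover have "G.bar (G.sc G.cN (G.d \<one>\<^bsub>W\<^esub>)) = G.sc G.cN (G.d \<one>\<^bsub>W\<^esub>)"
      by (simp add: G.bar_sc G.bar_d)
    ultimately show ?thesis using G.d_one_Z by (intro bexI[of _ "G.sc G.cN (G.d \<one>\<^bsub>W\<^esub>)"]) auto
  next
    case 2
    have "pm ?s \<bullet> pm ?s = \<one>\<^bsub>W\<^esub>" using pm_mult[OF s, of ?s] by (simp add: pm_id)
    then have sq: "U ?s \<star> U ?s \<in> G.Z" unfolding U_def by (intro G.u_square_Z pm_W s)
    have bU: "G.bar (U ?s) = U ?s"
      unfolding U_def using G.bar_u[OF pm_W[OF s]] pm_inv[OF s] by simp
    let ?r = "G.sc (1 / G.cN) (U ?s \<star> U ?s)"
    have "U p = G.sc (1 / G.cN) (U (p \<circ> ?s) \<star> U ?s)"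
      using U_mult_separated[OF ps 2 ij(2)] cN by (simp add: pss)
    then have "U p \<star> U ?s = G.sc (1 / G.cN) (U (p \<circ> ?s) \<star> (U ?s \<star> U ?s))"
      by (simp add: G.star_assoc)
    also have "\<dots> = ?r \<star> U (p \<circ> ?s)" by (simp add: G.Z_commute[OF sq])
    finally have "U p \<star> U ?s = ?r \<star> U (p \<circ> ?s)" .
    moreover have "G.bar ?r = ?r" by (simp add: G.bar_sc G.bar_star bU)
    ultimately show ?thesis using sq by (intro bexI[of _ ?r]) auto
  qed
qed

text \<open>Since q is built by inserting fixed points, U q is up to a scalar a product of elements
  U (i j). Each contributes one coefficient, and a product of \<open>bar\<close>-fixed elements of Z
  is \<open>bar\<close>-fixed because Z is commutative.\<close>

lemma U_mult:
  assumes q: "q permutes S" and p: "p permutes S"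
  shows "\<exists>r\<in>G.Z. G.bar r = r \<and> U p \<star> U q = r \<star> U (p \<circ> q)"
  using q finS p
proof (induction q arbitrary: p rule: permutes_fixed_induct)
  case id
  have "U p \<star> U id = G.sc G.cN (G.d \<one>\<^bsub>W\<^esub>) \<star> U (p \<circ> id)"
    unfolding U_id using G.Z_commute[OF G.d_one_Z U_Inv[of p]] by simp
  moreover have "G.bar (G.sc G.cN (G.d \<one>\<^bsub>W\<^esub>)) = G.sc G.cN (G.d \<one>\<^bsub>W\<^esub>)"
    by (simp add: G.bar_sc G.bar_d)
  ultimately show ?case using G.Z_sc[OF G.d_one_Z, of G.cN] by metis
next
  case (swap q i j)
  let ?s = "transpose i j"
  have pq: "p \<circ> q permutes S" using swap by (intro permutes_compose)
  obtain r where r: "r \<in> G.Z" "G.bar r = r" "U p \<star> U q = r \<star> U (p \<circ> q)" using swap(6)[OF swap(7)] by blast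
  obtain t where t: "t \<in> G.Z" "G.bar t = t" "U (p \<circ> q) \<star> U ?s = t \<star> U (p \<circ> q \<circ> ?s)"
    using U_mult_transposition[OF pq swap(2-4)] by blast
  have "separated S q i j" using swap(2,4,5) unfolding separated_def by (intro exI[of _ "{i}"]) auto
  then have "U (q \<circ> ?s) = G.sc (1 / G.cN) (U q \<star> U ?s)"
    using U_mult_separated[OF swap(1) _ swap(3)] cN by simp
  then have "U p \<star> U (q \<circ> ?s) = G.sc (1 / G.cN) (U p \<star> U q \<star> U ?s)"
    by (simp add: G.star_assoc)
  also have "\<dots> = G.sc (1 / G.cN) (r \<star> t) \<star> U (p \<circ> (q \<circ> ?s))"
    unfolding r(3) by (simp add: G.star_assoc t(3) comp_assoc)
  finally have "U p \<star> U (q \<circ> ?s) = G.sc (1 / G.cN) (r \<star> t) \<star> U (p \<circ> (q \<circ> ?s))" .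
  moreover have "G.bar (G.sc (1 / G.cN) (r \<star> t)) = G.sc (1 / G.cN) (r \<star> t)"
    using G.Z_commute[OF r(1) G.Z_Inv[OF t(1)]] by (simp add: G.bar_sc G.bar_star r(2) t(2))
  ultimately have "\<exists>r\<in>G.Z. G.bar r = r \<and> U p \<star> U (q \<circ> ?s) = r \<star> U (p \<circ> (q \<circ> ?s))"
    using G.Z_sc[OF G.Z_star[OF r(1) t(1)], of "1 / G.cN"] by blast
  then show ?case .
qed

lemma bar_U: "p permutes S \<Longrightarrow> G.bar (U p) = U (inv' p)"
  unfolding U_def by (simp add: G.bar_u pm_W pm_inv)

text \<open>\<open>bar\<close> reverses products and fixes r. That one r describes both products is
  what makes z U p -> z U (p^-1) reverse multiplication.\<close>

lemma U_mult_both: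
  assumes q: "q permutes S" and p: "p permutes S"
  shows "\<exists>r\<in>G.Z. U p \<star> U q = r \<star> U (p \<circ> q) \<and> U (inv' q) \<star> U (inv' p) = r \<star> U (inv' (p \<circ> q))"
proof -
  obtain r where r: "r \<in> G.Z" "G.bar r = r" "U p \<star> U q = r \<star> U (p \<circ> q)" using U_mult[OF q p] by blast
  have "U (inv' q) \<star> U (inv' p) = G.bar (U p \<star> U q)" by (simp add: G.bar_star bar_U p q)
  also have "\<dots> = U (inv' (p \<circ> q)) \<star> r"
    unfolding r(3) by (simp add: G.bar_star bar_U p q permutes_compose r(2))
  also have "\<dots> = r \<star> U (inv' (p \<circ> q))" by (simp add: G.Z_commute[OF r(1)])
  finally show ?thesis using r by blast
qed

text \<open>If i and j share a cycle of p, then (i j) p separates them, so U p is a multiple of U (i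
  j) U ((i j) p), and \<open>cj_star_u\<close> absorbs the conjugation at the left factor. The
  passage through inverses is due to the transposition standing on the right in
  \<open>U_mult_separated\<close>.\<close>

lemma cj_transposition_star_U:
  assumes p: "p permutes S" and ij: "i \<in> S" "j \<in> S" "i \<noteq> j" and ns: "\<not> separated S p i j" and z: "z \<in> G.Z"
  shows "G.cj (pm (transpose i j)) z \<star> U p = z \<star> U p"
proof -
  let ?s = "transpose i j"
  have s: "?s permutes S" using ij by (intro permutes_swap_id)
  have p': "inv' p permutes S" using permutes_inv[OF p] .
  have "\<not> separated S (inv' p) i j"
    using separated_inv[OF p', of i j] ns permutes_inv_inv[OF p] by auto
  then have "separated S (inv' p \<circ> ?s) i j" using separated_or[OF p' finS ij] by blast
  then have "U (inv' p \<circ> ?s) \<star> U ?s = G.sc G.cN (U (inv' p \<circ> ?s \<circ> ?s))"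
    using U_mult_separated[OF permutes_compose[OF s p'] _ ij(2)] by blast
  then have "G.bar (U (inv' p \<circ> ?s) \<star> U ?s) = G.bar (G.sc G.cN (U (inv' p)))"
    by (simp add: comp_assoc)
  then have eq: "U ?s \<star> U (inv' (inv' p \<circ> ?s)) = G.sc G.cN (U p)"
    using bar_U[OF permutes_compose[OF s p']] bar_U[OF s] bar_U[OF p'] permutes_inv_inv[OF p]
    by (simp add: G.bar_star G.bar_sc)
  then have eq': "U p = G.sc (1 / G.cN) (U ?s \<star> U (inv' (inv' p \<circ> ?s)))"
    using cN by simp
  have "G.cj (pm ?s) z \<star> U ?s = z \<star> U ?s"
    unfolding U_def using G.cj_star_u[OF z pm_W[OF s]] .
  then show ?thesis unfolding eq' by (simp add: G.star_assoc[symmetric])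
qed

text \<open>Such a q is a product of transpositions within cycles of p. In the induction step q
  fixes i, so \<open>q \<circ> ?s\<close> sends j to i; hence i and j lie in the same p-invariant
  sets, and q inherits the hypothesis.\<close>

lemma cj_star_U:
  assumes p: "p permutes S" and q: "q permutes S" and pres: "\<And>C. C \<subseteq> S \<Longrightarrow> p ` C = C \<Longrightarrow> q ` C = C"
    and z: "z \<in> G.Z"
  shows "G.cj (pm q) z \<star> U p = z \<star> U p"
  using q finS pres z
proof (induction q arbitrary: z rule: permutes_fixed_induct)
  case id
  then show ?case using G.cj_one[OF G.Z_CG[OF id(2)]] by (simp only: pm_id)
next
  case (swap q i j)
  let ?s = "transpose i j"
  have s: "?s permutes S" using swap by (intro permutes_swap_id)
  have same: "i \<in> C \<longleftrightarrow> j \<in> C" if C: "C \<subseteq> S" "p ` C = C" for C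
  proof -
    have im: "(q \<circ> ?s) ` C = C" using swap(7)[OF C] .
    have qj: "(q \<circ> ?s) j = i" using swap(5) by simp
    have "inj (q \<circ> ?s)" using permutes_inj[OF permutes_compose[OF s swap(1)]] .
    then show ?thesis using im qj by (metis imageE imageI injD)
  qed
  have "?s ` C = C" if C: "C \<subseteq> S" "p ` C = C" for C
    using same[OF C] by (simp add: transpose_image_eq)
  then have "q ` C = C" if "C \<subseteq> S" "p ` C = C" for C
    using swap(7)[OF that] that by (metis image_comp)
  then have IH: "G.cj (pm q) z' \<star> U p = z' \<star> U p" if "z' \<in> G.Z" for z'
    using swap(6)[OF _ that] by blast
  have ns: "\<not> separated S p i j" using same unfolding separated_def by blast
  have "G.cj (pm (q \<circ> ?s)) z = G.cj (pm q) (G.cj (pm ?s) z)"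
    using G.cj_cj[OF pm_W[OF swap(1)] pm_W[OF s]] pm_mult[OF swap(1)] by simp
  then have "G.cj (pm (q \<circ> ?s)) z \<star> U p = z \<star> U p"
    using IH[of "G.cj (pm ?s) z"] cj_transposition_star_U[OF p swap(2-4) ns swap(8)] swap(8) pm_W[OF s] by simp
  then show ?case .
qed

section \<open>Components above single permutations, and reflection p -> p^-1\<close>

definition rest :: "(nat \<Rightarrow> nat) \<Rightarrow> ((nat \<Rightarrow> 'a) \<times> (nat \<Rightarrow> nat) \<Rightarrow> complex) \<Rightarrow> (nat \<Rightarrow> 'a) \<times> (nat \<Rightarrow> nat) \<Rightarrow> complex" where
  "rest p x = (\<lambda>g. if snd g = p then x g else 0)"

lemma rest_sum: "rest p (\<Sum>i\<in>A. f i) = (\<Sum>i\<in>A. rest p (f i))"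
  by (rule ext) (simp add: rest_def sum_fun_apply)

lemma sum_rest:
  assumes "x \<in> G.CG"
  shows "x = (\<Sum>p\<in>Perm. rest p x)"
proof
  fix g
  have "(\<Sum>p\<in>Perm. rest p x) g = (\<Sum>p\<in>Perm. if p = snd g then x g else 0)"
    unfolding sum_fun_apply rest_def by (intro sum.cong) auto
  also have "\<dots> = x g"
  proof (cases "g \<in> carrier W")
    case True
    then show ?thesis by (simp add: W_carrier finite_permutations mem_Times_iff)
  next
    case False
    then have "x g = 0" using assms unfolding G.CG_def by blast
    then show ?thesis by (simp cong: if_cong)
  qed
  finally show "x g = (\<Sum>p\<in>Perm. rest p x) g" by simp
qed

lemma rest_U:
  assumes y: "y \<in> G.Z" and q: "q permutes S"
  shows "rest p (y \<star> U q) = (if p = q then y \<star> U q else 0)"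
proof -
  have "snd g = q" if nz: "(y \<star> U q) g \<noteq> 0" for g
  proof -
    have gW: "g \<in> carrier W" using nz by (auto simp: G.star_def split: if_splits)
    obtain h where h: "h \<in> carrier W" "y h \<noteq> 0" "U q (winv h \<bullet> g) \<noteq> 0"
      using G.star_supp[OF nz] by blast
    have "h \<in> N" using y h(2) unfolding G.Z_def by blast
    then have hs: "snd h = id" by (auto simp: N_def)
    obtain k where k: "k \<in> N" "winv h \<bullet> g = k \<bullet> pm q \<bullet> winv k"
      using G.u_supp[OF pm_W[OF q]] h(3) unfolding U_def by blast
    have "snd (winv h \<bullet> g) = snd g" using h(1) gW hs by (simp add: snd_W)
    moreover have "snd (k \<bullet> pm q \<bullet> winv k) = q"
      using conj_snd[OF G.K_carrier[OF k(1)] pm_W[OF q]] k(1) by (auto simp: pm_def N_def)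
    ultimately show ?thesis using k(2) by simp
  qed
  then have "rest p (y \<star> U q) g = (if p = q then y \<star> U q else 0) g" for g
    unfolding rest_def by (cases "(y \<star> U q) g = 0") auto
  then show ?thesis by (rule ext)
qed

text \<open>The component above p is invariant under N and so equals its average; averaging the
  point mass at (m, p) gives u (m, p), to which \<open>u_in_Z_star_U\<close> applies.\<close>

lemma rest_in_Z_star_U:
  assumes a: "a \<in> G.Inv" and p: "p permutes S"
  shows "\<exists>z\<in>G.Z. rest p a = z \<star> U p"
proof -
  obtain z where z: "\<And>m. m \<in> Base \<Longrightarrow> z m \<in> G.Z" "\<And>m. m \<in> Base \<Longrightarrow> G.u (m, p) = z m \<star> U p"
    using u_in_Z_star_U[OF p] by metis
  have finB: "finite Base" using finF by (intro finite_PiE) auto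
  have eq: "rest p a = (\<Sum>m\<in>Base. G.sc (a (m, p)) (G.d (m, p)))"
  proof
    fix g :: "(nat \<Rightarrow> 'a) \<times> (nat \<Rightarrow> nat)"
    obtain x q where g: "g = (x, q)" by (cases g)
    have "a g = 0" if "x \<notin> Base"
      using G.Inv_CG[OF a] that unfolding G.CG_def W_carrier g by auto
    then show "rest p a g = (\<Sum>m\<in>Base. G.sc (a (m, p)) (G.d (m, p))) g"
      using finB by (auto simp: rest_def g sum_fun_apply G.sc_def G.d_def if_distrib[of "\<lambda>c. _ * c"] cong: if_cong)
  qed
  have rI: "rest p a \<in> G.Inv"
  proof -
    have "G.cj h (rest p a) g = rest p a g" if h: "h \<in> N" for h g
    proof (cases "g \<in> carrier W")
      case True
      have hW: "h \<in> carrier W" and hs: "snd h = id" using h G.K_carrier by (auto simp: N_def)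
      have "snd (winv h \<bullet> g \<bullet> h) = snd g"
        using hW True hs by (simp add: snd_W)
      moreover have "a (winv h \<bullet> g \<bullet> h) = a g"
      proof -
        have "G.cj h a g = a g" using a h unfolding G.Inv_def by simp
        then show ?thesis using True by (simp add: G.cj_def)
      qed
      ultimately show ?thesis using True by (simp add: G.cj_def rest_def)
    next
      case False
      then have "a g = 0" using G.Inv_CG[OF a] unfolding G.CG_def by blast
      then show ?thesis using False by (simp add: G.cj_def rest_def)
    qed
    moreover have "rest p a \<in> G.CG" using G.Inv_CG[OF a] by (auto simp: rest_def G.CG_def)
    ultimately show ?thesis unfolding G.Inv_def by auto
  qed
  have "rest p a = G.sc (1 / G.cN) (G.E (rest p a))" using G.E_of_Inv[OF rI] cN by simp
  also have "\<dots> = G.sc (1 / G.cN) (\<Sum>m\<in>Base. G.sc (a (m, p)) (G.u (m, p)))"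
    unfolding eq G.E_sum G.E_sc G.u_def ..
  also have "\<dots> = G.sc (1 / G.cN) (\<Sum>m\<in>Base. G.sc (a (m, p)) (z m)) \<star> U p"
    by (simp add: G.star_sum_left z(2))
  finally have "rest p a = G.sc (1 / G.cN) (\<Sum>m\<in>Base. G.sc (a (m, p)) (z m)) \<star> U p" .
  moreover have "G.sc (1 / G.cN) (\<Sum>m\<in>Base. G.sc (a (m, p)) (z m)) \<in> G.Z"
    using z(1) by (intro G.Z_sc G.Z_sum)
  ultimately show ?thesis by blast
qed

text \<open>Conjugation by q carries the component above p to the one above p^-1 and z to its
  conjugate. As q preserves the cycles, \<open>cj_star_U\<close> replaces the conjugate by z
  again.\<close>

lemma rest_inverse:
  assumes c: "c \<in> G.CG" and p: "p permutes S" and q: "q permutes S"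
    and conj: "q \<circ> p \<circ> inv' q = inv' p" and pres: "\<And>C. C \<subseteq> S \<Longrightarrow> p ` C = C \<Longrightarrow> q ` C = C"
    and inv: "G.cj (pm q) c = c" and z: "z \<in> G.Z" "rest p c = z \<star> U p"
  shows "rest (inv' p) c = z \<star> U (inv' p)"
proof -
  have qW: "pm q \<in> carrier W" using pm_W[OF q] .
  have "rest (inv' p) c = G.cj (pm q) (rest p c)"
  proof
    fix g
    show "rest (inv' p) c g = G.cj (pm q) (rest p c) g"
    proof (cases "g \<in> carrier W")
      case True
      have gS: "snd g permutes S" using True by (auto simp: W_carrier)
      have "snd (winv (pm q) \<bullet> g \<bullet> pm q) = inv' q \<circ> snd g \<circ> q"
        using True qW by (simp add: snd_W pm_def)
      moreover have "inv' q \<circ> snd g \<circ> q = p \<longleftrightarrow> snd g = inv' p"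
      proof
        assume "inv' q \<circ> snd g \<circ> q = p"
        then have "q \<circ> (inv' q \<circ> snd g \<circ> q) \<circ> inv' q = inv' p" using conj by simp
        then have "(q \<circ> inv' q) \<circ> snd g \<circ> (q \<circ> inv' q) = inv' p" by (simp only: comp_assoc)
        then show "snd g = inv' p" by (simp add: permutes_inv_o(1)[OF q])
      next
        assume "snd g = inv' p"
        then have "inv' q \<circ> snd g \<circ> q = (inv' q \<circ> q) \<circ> p \<circ> (inv' q \<circ> q)"
          unfolding conj[symmetric] by (simp only: comp_assoc)
        then show "inv' q \<circ> snd g \<circ> q = p" by (simp add: permutes_inv_o(2)[OF q])
      qed
      moreover have "c (winv (pm q) \<bullet> g \<bullet> pm q) = c g"
        using fun_cong[OF inv, of g] True by (simp add: G.cj_def)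
      ultimately show ?thesis using True by (simp add: rest_def G.cj_def)
    next
      case False
      then have "c g = 0" using c unfolding G.CG_def by blast
      then show ?thesis using False by (simp add: rest_def G.cj_def)
    qed
  qed
  also have "\<dots> = G.cj (pm q) z \<star> G.cj (pm q) (U p)" unfolding z(2) using qW by (rule G.cj_star)
  also have "G.cj (pm q) (U p) = U (inv' p)"
    unfolding U_def using G.cj_u[OF qW pm_W[OF p]] pm_mult q p conj
    by (simp add: pm_inv permutes_compose)
  also have "G.cj (pm q) z \<star> U (inv' p) = z \<star> U (inv' p)"
  proof (rule cj_star_U[OF permutes_inv[OF p] q _ z(1)])
    fix C assume C: "C \<subseteq> S" "inv' p ` C = C"
    have "p ` (inv' p ` C) = C" using permutes_inverses(1)[OF p] by (simp add: image_image)
    then show "q ` C = C" using pres[OF C(1)] C(2) by simp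
  qed
  finally show ?thesis .
qed

text \<open>
  Linearly, \<open>z \<star> U p \<mapsto> z \<star> U (inv' p)\<close> is an anti-automorphism of the centralizer of the base group.
  It fixes every \<open>B\<close>-invariant element, hence these commute.
\<close>

theorem invariants_commute:
  assumes a: "a \<in> G.Inv" and b: "b \<in> G.Inv"
    and inva: "\<And>q. q \<in> B \<Longrightarrow> G.cj (pm q) a = a" and invb: "\<And>q. q \<in> B \<Longrightarrow> G.cj (pm q) b = b"
    and BP: "B \<subseteq> Perm"
    and B: "\<And>p. p permutes S \<Longrightarrow> \<exists>q\<in>B. q \<circ> p \<circ> inv' q = inv' p \<and>
      (\<forall>C. C \<subseteq> S \<and> p ` C = C \<longrightarrow> q ` C = C)"
  shows "a \<star> b = b \<star> a"
proof -
  have finP: "finite Perm" by (simp add: finite_permutations)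
  \<comment> \<open>The coefficient z is arbitrary: this is the form in which the reflection is well
    defined.\<close>
  have reflect: "rest (inv' p) c = z \<star> U (inv' p)"
    if c: "c \<in> G.CG" "\<And>q. q \<in> B \<Longrightarrow> G.cj (pm q) c = c" and p: "p permutes S"
      and z: "z \<in> G.Z" "rest p c = z \<star> U p" for c z p
  proof -
    obtain q where q: "q \<in> B" "q permutes S" "q \<circ> p \<circ> inv' q = inv' p" "\<forall>C. C \<subseteq> S \<and> p ` C = C \<longrightarrow> q ` C = C"
      using B[OF p] BP by blast
    show ?thesis by (rule rest_inverse[OF c(1) p q(2,3) _ c(2)[OF q(1)] z]) (use q(4) in blast)
  qed
  obtain x where "\<forall>p\<in>Perm. x p \<in> G.Z \<and> rest p a = x p \<star> U p"
    using bchoice[of Perm "\<lambda>p z. z \<in> G.Z \<and> rest p a = z \<star> U p"] rest_in_Z_star_U[OF a] by blast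
  then have x: "x p \<in> G.Z" "rest p a = x p \<star> U p" if "p permutes S" for p using that by auto
  obtain y where "\<forall>p\<in>Perm. y p \<in> G.Z \<and> rest p b = y p \<star> U p"
    using bchoice[of Perm "\<lambda>p z. z \<in> G.Z \<and> rest p b = z \<star> U p"] rest_in_Z_star_U[OF b] by blast
  then have y: "y p \<in> G.Z" "rest p b = y p \<star> U p" if "p permutes S" for p using that by auto
  define r where "r p q = (SOME r. r \<in> G.Z \<and> U p \<star> U q = r \<star> U (p \<circ> q) \<and>
    U (inv' q) \<star> U (inv' p) = r \<star> U (inv' (p \<circ> q)))" for p q
  have r: "r p q \<in> G.Z \<and> U p \<star> U q = r p q \<star> U (p \<circ> q) \<and>
    U (inv' q) \<star> U (inv' p) = r p q \<star> U (inv' (p \<circ> q))" if "p permutes S" "q permutes S" for p q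
    using someI_ex[OF U_mult_both[OF that(2,1), unfolded Bex_def]] unfolding r_def .
  have xi: "rest (inv' p) a = x p \<star> U (inv' p)" if "p permutes S" for p
    by (rule reflect[OF G.Inv_CG[OF a] inva that x(1)[OF that] x(2)[OF that]])
  have yi: "rest (inv' p) b = y p \<star> U (inv' p)" if "p permutes S" for p
    by (rule reflect[OF G.Inv_CG[OF b] invb that y(1)[OF that] y(2)[OF that]])
  define w where "w p q = x p \<star> y q \<star> r p q" for p q
  have wZ: "w p q \<in> G.Z" if "p permutes S" "q permutes S" for p q
    unfolding w_def using x(1) y(1) r that by simp
  have prod: "(x p \<star> U p) \<star> (y q \<star> U q) = w p q \<star> U (p \<circ> q)" if pq: "p permutes S" "q permutes S" for p q
  proof -
    have "(x p \<star> U p) \<star> (y q \<star> U q) = x p \<star> (U p \<star> y q) \<star> U q" by (simp add: G.star_assoc)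
    also have "\<dots> = x p \<star> y q \<star> (U p \<star> U q)" by (simp add: G.Z_commute y(1) pq G.star_assoc)
    finally show ?thesis using r[OF pq] by (simp add: w_def G.star_assoc)
  qed
  have prod': "(y q \<star> U (inv' q)) \<star> (x p \<star> U (inv' p)) = w p q \<star> U (inv' (p \<circ> q))"
    if pq: "p permutes S" "q permutes S" for p q
  proof -
    have "(y q \<star> U (inv' q)) \<star> (x p \<star> U (inv' p)) = y q \<star> (U (inv' q) \<star> x p) \<star> U (inv' p)"
      by (simp add: G.star_assoc)
    also have "\<dots> = y q \<star> x p \<star> (U (inv' q) \<star> U (inv' p))"
      by (simp add: G.Z_commute x(1) pq G.star_assoc)
    also have "y q \<star> x p = x p \<star> y q" using G.Z_commute[OF x(1)[OF pq(1)] G.Z_Inv[OF y(1)[OF pq(2)]]] .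
    finally show ?thesis using r[OF pq] by (simp add: w_def G.star_assoc)
  qed
  have ab: "a \<star> b = (\<Sum>p\<in>Perm. \<Sum>q\<in>Perm. w p q \<star> U (p \<circ> q))"
  proof -
    have "a \<star> b = (\<Sum>p\<in>Perm. rest p a) \<star> (\<Sum>q\<in>Perm. rest q b)"
      using sum_rest[OF G.Inv_CG[OF a]] sum_rest[OF G.Inv_CG[OF b]] by simp
    also have "\<dots> = (\<Sum>p\<in>Perm. \<Sum>q\<in>Perm. rest p a \<star> rest q b)"
      by (simp only: G.star_sum_left, simp only: G.star_sum_right)
    finally show ?thesis by (simp add: x(2) y(2) prod)
  qed
  have invP: "(\<Sum>p\<in>Perm. f (inv' p)) = (\<Sum>p\<in>Perm. f p)"
    for f :: "_ \<Rightarrow> (nat \<Rightarrow> 'a) \<times> (nat \<Rightarrow> nat) \<Rightarrow> complex"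
    by (rule sum.reindex_bij_witness[where i=inv' and j=inv']) (auto simp: permutes_inv permutes_inv_inv)
  have ba: "b \<star> a = (\<Sum>p\<in>Perm. \<Sum>q\<in>Perm. w p q \<star> U (inv' (p \<circ> q)))"
  proof -
    \<comment> \<open>Both sums are written over inverses so that, by \<open>reflect\<close>, the
      coefficients x p and y q used for a and b above p and q reappear.\<close>
    have "b \<star> a = (\<Sum>q\<in>Perm. rest (inv' q) b) \<star> (\<Sum>p\<in>Perm. rest (inv' p) a)"
      using sum_rest[OF G.Inv_CG[OF a]] sum_rest[OF G.Inv_CG[OF b]] invP[of "\<lambda>p. rest p a"] invP[of "\<lambda>p. rest p b"]
      by simp
    also have "\<dots> = (\<Sum>p\<in>Perm. \<Sum>q\<in>Perm. rest (inv' q) b \<star> rest (inv' p) a)"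
      by (simp only: G.star_sum_right, simp only: G.star_sum_left)
    finally show ?thesis by (simp add: xi yi prod')
  qed
  \<comment> \<open>\<open>Y t\<close> collects the coefficients of U t in a * b. As a * b is
    invariant too, \<open>reflect\<close> applies to it with this coefficient and turns its
    expansion into that of b * a.\<close>
  define Y where "Y t = (\<Sum>p\<in>Perm. \<Sum>q\<in>Perm. if p \<circ> q = t then w p q else 0)" for t
  have YZ: "Y t \<in> G.Z" for t
  proof -
    have "0 \<in> G.Z" using G.Z_sum[of "{}" "\<lambda>_. 0"] by simp
    then show ?thesis unfolding Y_def using wZ by (intro G.Z_sum) auto
  qed
  have zero_star: "0 \<star> v = 0" for v using G.star_sum_left[of "\<lambda>_. 0" "{}" v] by simp
  have YU: "Y t \<star> U t' = (\<Sum>p\<in>Perm. \<Sum>q\<in>Perm. if p \<circ> q = t then w p q \<star> U t' else 0)" for t t'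
    unfolding Y_def G.star_sum_left by (intro sum.cong refl) (simp add: zero_star)
  have restab: "rest t (a \<star> b) = Y t \<star> U t" for t
    unfolding ab rest_sum YU using wZ by (intro sum.cong refl) (simp add: rest_U permutes_compose)
  have "a \<star> b = (\<Sum>t\<in>Perm. rest (inv' t) (a \<star> b))"
    using sum_rest[of "a \<star> b"] invP[of "\<lambda>p. rest p (a \<star> b)"] by simp
  also have "\<dots> = (\<Sum>t\<in>Perm. Y t \<star> U (inv' t))"
  proof (rule sum.cong[OF refl])
    fix t assume "t \<in> Perm"
    then show "rest (inv' t) (a \<star> b) = Y t \<star> U (inv' t)"
    proof (intro reflect[OF _ _ _ YZ restab])
      fix q assume "q \<in> B"
      then show "G.cj (pm q) (a \<star> b) = a \<star> b"
        using inva invb BP by (subst G.cj_star) (auto intro: pm_W)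
    qed auto
  qed
  also have "\<dots> = (\<Sum>t\<in>Perm. \<Sum>p\<in>Perm. \<Sum>q\<in>Perm. if t = p \<circ> q then w p q \<star> U (inv' t) else 0)"
    unfolding YU by (intro sum.cong refl) auto
  also have "\<dots> = (\<Sum>p\<in>Perm. \<Sum>q\<in>Perm. \<Sum>t\<in>Perm. if t = p \<circ> q then w p q \<star> U (inv' t) else 0)"
    by (subst sum.swap, rule sum.cong[OF refl], rule sum.swap)
  also have "\<dots> = b \<star> a"
    unfolding ba using finP by (intro sum.cong refl) (simp add: permutes_compose)
  finally show ?thesis .
qed

end


section \<open>Criteria for subgroups that contain the base group\<close>

context wreath
begin

lemma group_with_subgroup_W:
  assumes "B \<subseteq> Perm" "id \<in> B" "\<And>p q. p \<in> B \<Longrightarrow> q \<in> B \<Longrightarrow> p \<circ> q \<in> B" "\<And>p. p \<in> B \<Longrightarrow> inv' p \<in> B"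
  shows "group_with_subgroup W (Base \<times> B)"
  by (intro group_with_subgroup.intro group_with_subgroup_axioms.intro W_group W_finite subgroup_W assms)

theorem strong_gelfand_pair_if_inverting:
  assumes B: "B \<subseteq> Perm" "id \<in> B" "\<And>p q. p \<in> B \<Longrightarrow> q \<in> B \<Longrightarrow> p \<circ> q \<in> B" "\<And>p. p \<in> B \<Longrightarrow> inv' p \<in> B"
    and inverting: "\<And>p. p permutes S \<Longrightarrow> \<exists>q\<in>B. q \<circ> p \<circ> inv' q = inv' p \<and>
      (\<forall>C. C \<subseteq> S \<and> p ` C = C \<longrightarrow> q ` C = C)"
  shows "strong_gelfand_pair W (Base \<times> B)"
proof -
  interpret K: group_with_subgroup W "Base \<times> B" by (rule group_with_subgroup_W[OF B])
  \<comment> \<open>\<open>conj_invariant\<close> says nothing outside the carrier, whereas elements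
    of \<open>G.Inv\<close> vanish there.\<close>
  define ext where "ext x g = (if g \<in> carrier W then x g else 0)"
    for x :: "(nat \<Rightarrow> 'a) \<times> (nat \<Rightarrow> nat) \<Rightarrow> complex" and g
  have cj: "G.cj k (ext x) = ext x" if x: "conj_invariant W (Base \<times> B) x" and k: "k \<in> Base \<times> B" for x k
  proof
    fix g
    show "G.cj k (ext x) g = ext x g"
    proof (cases "g \<in> carrier W")
      case True
      have kW: "k \<in> carrier W" using K.K_carrier[OF k] .
      have "x (winv k \<bullet> g \<bullet> winv (winv k)) = x g"
        using bspec[OF bspec[OF x[unfolded conj_invariant_def] K.K_closed(2)[OF k]] True] .
      then show ?thesis using True kW by (simp add: G.cj_def ext_def)
    qed (simp add: G.cj_def ext_def)
  qed
  have pmB: "pm q \<in> Base \<times> B" if "q \<in> B" for q using that by (auto simp: pm_def)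
  have Inv: "ext x \<in> G.Inv" if x: "conj_invariant W (Base \<times> B) x" for x
  proof -
    have "ext x \<in> G.CG" by (auto simp: G.CG_def ext_def)
    moreover have "h \<in> Base \<times> B" if "h \<in> N" for h using that B(2) by (auto simp: N_def)
    ultimately show ?thesis using cj[OF x] unfolding G.Inv_def by blast
  qed
  show ?thesis
  proof (rule K.strong_gelfand_pairI)
    fix x y g
    assume x: "conj_invariant W (Base \<times> B) x" and y: "conj_invariant W (Base \<times> B) y" and g: "g \<in> carrier W"
    have "ext x \<star> ext y = ext y \<star> ext x"
      by (rule invariants_commute[OF Inv[OF x] Inv[OF y] cj[OF x pmB] cj[OF y pmB] B(1) inverting])
    then have "(ext x \<star> ext y) g = (ext y \<star> ext x) g" by simp
    moreover have "(ext x \<star> ext y) g = conv W x y g" for x y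
      using g by (simp add: G.star_def conv_def ext_def)
    ultimately show "conv W x y g = conv W y x g" by simp
  qed
qed

text \<open>A condition on the permutation part alone is unaffected by conjugation with the base
  group, so obstructions can be found among permutations.\<close>

lemma strong_gelfand_pair_perm_product:
  assumes B: "B \<subseteq> Perm" "id \<in> B" "\<And>p q. p \<in> B \<Longrightarrow> q \<in> B \<Longrightarrow> p \<circ> q \<in> B" "\<And>p. p \<in> B \<Longrightarrow> inv' p \<in> B"
    and sg: "strong_gelfand_pair W (Base \<times> B)"
    and P: "\<And>q p. q \<in> B \<Longrightarrow> P p \<Longrightarrow> P (q \<circ> p \<circ> inv' q)"
    and Q: "\<And>q p. q \<in> B \<Longrightarrow> Q p \<Longrightarrow> Q (q \<circ> p \<circ> inv' q)"
    and pq: "p permutes S" "q permutes S" "P p" "Q q"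
  shows "\<exists>p' q'. P p' \<and> Q q' \<and> q' \<circ> p' = p \<circ> q"
proof -
  interpret K: group_with_subgroup W "Base \<times> B" by (rule group_with_subgroup_W[OF B])
  have conj: "R (snd (k \<bullet> g \<bullet> winv k))"
    if "\<And>q p. q \<in> B \<Longrightarrow> R p \<Longrightarrow> R (q \<circ> p \<circ> inv' q)" "k \<in> Base \<times> B" "g \<in> carrier W" "R (snd g)" for R k g
    using that K.K_carrier[OF that(2)] by (auto simp: conj_snd)
  obtain g' h' where g': "g' \<in> carrier W" "h' \<in> carrier W" "P (snd g')" "Q (snd h')"
    "h' \<bullet> g' = pm p \<bullet> pm q"
    by (rule K.strong_gelfand_pair_set_product[OF sg, of "\<lambda>g. P (snd g)" "\<lambda>g. Q (snd g)" "pm p" "pm q"])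
      (use conj[where R=P, OF P] conj[where R=Q, OF Q] pm_W pq in \<open>auto simp: pm_def\<close>)
  have "snd h' \<circ> snd g' = p \<circ> q"
    using arg_cong[OF g'(5), of snd] g'(1,2) pm_W[OF pq(1)] pm_W[OF pq(2)] by (simp add: snd_W) (simp add: pm_def)
  then show ?thesis using g'(3,4) by blast
qed

end

section \<open>Young subgroups\<close>

lemma sum_list_take_mono: "i \<le> j \<Longrightarrow> sum_list (take i lam) \<le> (sum_list (take j lam) :: nat)"
  by (metis le_add1 le_add_diff_inverse sum_list_append take_add)

lemma block_disjoint: "i < j \<Longrightarrow> x \<in> block lam i \<Longrightarrow> x \<notin> block lam j"
  unfolding block_def using sum_list_take_mono[of "Suc i" j lam] by auto

lemma block_subset: "block lam i \<subseteq> {1..sum_list lam}"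
  \<comment> \<open>The index i may lie beyond the list; a prefix of \<open>max\<close> length is
    the whole list and still extends the one of length \<open>Suc i\<close>.\<close>
  unfolding block_def using sum_list_take_mono[of "Suc i" "max (Suc i) (length lam)" lam] by auto

lemma block_eq: "i < length lam \<Longrightarrow> block lam i = {sum_list (take i lam) <.. sum_list (take i lam) + lam ! i}"
  unfolding block_def by (simp add: take_Suc_conv_app_nth)

lemma young_perm: "q \<in> young_subgroup lam \<Longrightarrow> q permutes {1..sum_list lam}"
  by (simp add: young_subgroup_def sym_group_def)

lemma young_block: "q \<in> young_subgroup lam \<Longrightarrow> i < length lam \<Longrightarrow> x \<in> block lam i \<Longrightarrow> q x \<in> block lam i"
  unfolding young_subgroup_def by blast

lemma young_subgroup_closed:
  "young_subgroup lam \<subseteq> {p. p permutes {1..sum_list lam}}" "id \<in> young_subgroup lam"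
  "p \<in> young_subgroup lam \<Longrightarrow> q \<in> young_subgroup lam \<Longrightarrow> p \<circ> q \<in> young_subgroup lam"
  "p \<in> young_subgroup lam \<Longrightarrow> inv' p \<in> young_subgroup lam"
proof -
  show "young_subgroup lam \<subseteq> {p. p permutes {1..sum_list lam}}" using young_perm by blast
  show "id \<in> young_subgroup lam" by (simp add: young_subgroup_def sym_group_def permutes_id)
  show "p \<circ> q \<in> young_subgroup lam" if "p \<in> young_subgroup lam" "q \<in> young_subgroup lam"
  proof -
    have "(p \<circ> q) ` block lam i = block lam i" if "i < length lam" for i
    proof -
      have "(p \<circ> q) ` block lam i = p ` (q ` block lam i)" by (rule image_comp[symmetric])
      then show ?thesis
        using \<open>p \<in> young_subgroup lam\<close> \<open>q \<in> young_subgroup lam\<close> that by (simp add: young_subgroup_def)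
    qed
    then show ?thesis
      using permutes_compose[OF young_perm[OF that(2)] young_perm[OF that(1)]]
      unfolding young_subgroup_def by (simp add: sym_group_def del: comp_apply)
  qed
  show "inv' p \<in> young_subgroup lam" if p: "p \<in> young_subgroup lam"
  proof -
    have "inv' p ` block lam i = block lam i" if "i < length lam" for i
    proof -
      have "inv' p ` block lam i = inv' p ` (p ` block lam i)"
        using p that by (simp add: young_subgroup_def)
      then show ?thesis using permutes_inverses(2)[OF young_perm[OF p]] by (simp add: image_image)
    qed
    then show ?thesis using permutes_inv[OF young_perm[OF p]] by (simp add: young_subgroup_def sym_group_def)
  qed
qed

text \<open>The two points controlled by \<open>inverting_permutation\<close> are taken to be the
  second block; preserving it as a set also preserves its complement, the first block.\<close>

lemma young_inverting:
  assumes part: "is_partition lam n" and n: "n > 0" and len: "length lam \<le> 2" "second_part lam \<in> {0, 1, 2}"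
    and p: "p permutes {1..n}"
  shows "\<exists>q\<in>young_subgroup lam. q \<circ> p \<circ> inv' q = inv' p \<and> (\<forall>C. C \<subseteq> {1..n} \<and> p ` C = C \<longrightarrow> q ` C = C)"
proof -
  have sum: "sum_list lam = n" and pos: "\<forall>x\<in>set lam. 0 < x" using part unfolding is_partition_def by auto
  have "lam \<noteq> []" using sum n by auto
  then consider a where "lam = [a]" | a b where "lam = [a, b]"
    using len(1) by (cases lam rule: remdups_adj.cases) auto
  then show ?thesis
  proof cases
    case 1
    have S: "block lam 0 = {1..n}" using sum unfolding 1 block_def by auto
    \<comment> \<open>A single block is preserved by every permutation, so both base points may be
      the same arbitrary point.\<close>
    have one: "1 \<in> {1..n}" using n by simp
    obtain q where q: "q permutes {1..n}" "q \<circ> p \<circ> inv' q = inv' p"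
      "\<forall>C. C \<subseteq> {1..n} \<and> p ` C = C \<longrightarrow> q ` C = C" "q 1 = 1 \<and> q 1 = 1 \<or> q 1 = 1 \<and> q 1 = 1"
      using inverting_permutation[OF p finite_atLeastAtMost one one] .
    have "q \<in> young_subgroup lam"
      unfolding young_subgroup_def sum using q(1) S permutes_image[OF q(1)] 1 by (simp add: sym_group_def)
    then show ?thesis using q by blast
  next
    case 2
    have b: "b = 1 \<or> b = 2" using len(2) pos unfolding 2 second_part_def by auto
    have n': "n = a + b" using sum 2 by simp
    \<comment> \<open>For b = 1 the two base points coincide, n being \<open>Suc a\<close>, and the
      pair is a singleton; one description covers both sizes.\<close>
    have b0: "block lam 0 = {1..a}" and b1: "block lam 1 = {Suc a, n}"
      using b n' unfolding 2 block_def by auto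
    have mem: "Suc a \<in> {1..n}" "n \<in> {1..n}" using b n' by auto
    obtain q where q: "q permutes {1..n}" "q \<circ> p \<circ> inv' q = inv' p"
      "\<forall>C. C \<subseteq> {1..n} \<and> p ` C = C \<longrightarrow> q ` C = C"
      "q (Suc a) = Suc a \<and> q n = n \<or> q (Suc a) = n \<and> q n = Suc a"
      using inverting_permutation[OF p finite_atLeastAtMost mem] .
    have i1: "q ` {Suc a, n} = {Suc a, n}" using q(4) by auto
    have diff: "{1..a} = {1..n} - {Suc a, n}" using b n' by auto
    have i0: "q ` {1..a} = {1..a}"
      unfolding diff using image_set_diff[OF permutes_inj[OF q(1)]] permutes_image[OF q(1)] i1 by simp
    have "q ` block lam i = block lam i" if "i < length lam" for i
      using that i0 i1 b0 b1 2 by (cases i) auto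
    then have "q \<in> young_subgroup lam"
      unfolding young_subgroup_def sum using q(1) by (simp add: sym_group_def)
    then show ?thesis using q by blast
  qed
qed

section \<open>Obstructions from three blocks or two large blocks\<close>

lemma conj_transpose:
  assumes "bij q"
  shows "q \<circ> transpose a b \<circ> inv' q = transpose (q a) (q b)"
proof
  fix x
  obtain y where x: "x = q y" using bij_pointE[OF assms] by blast
  have "inv' q (q y) = y" using assms by (simp add: bij_is_inj)
  moreover have "q u = q v \<longleftrightarrow> u = v" for u v using bij_is_inj[OF assms] by (auto dest: injD)
  ultimately show "(q \<circ> transpose a b \<circ> inv' q) x = transpose (q a) (q b) x"
    unfolding x by (simp add: transpose_def)
qed

lemma conj_comp:
  assumes "bij q"
  shows "q \<circ> (f \<circ> g) \<circ> inv' q = (q \<circ> f \<circ> inv' q) \<circ> (q \<circ> g \<circ> inv' q)"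
  using assms by (auto simp: fun_eq_iff bij_is_inj)

text \<open>
  With \<open>A\<close>, \<open>B\<close> the two blocks, the product of a 3-cycle of type \<open>AAB\<close> and a 4-cycle of type \<open>ABAB\<close> can be
  a 6-cycle of type \<open>AABABB\<close>, but with the factors in the other order it never is.
\<close>

lemma no_reversed_factorization:
  assumes disj: "A \<inter> B = {}"
    and gA: "g1 \<in> A" "g2 \<in> A" "g4 \<in> A" and gB: "g3 \<in> B" "g5 \<in> B" "g6 \<in> B"
    and dist: "distinct [g1, g2, g4]" "distinct [g3, g5, g6]"
    and pA: "p \<in> A" "q \<in> A" "s \<in> A" "u \<in> A" and rB: "r \<in> B" "t \<in> B" "v \<in> B" and pq: "p \<noteq> q" "s \<noteq> u" "t \<noteq> v"
    and eq: "(transpose s t \<circ> transpose t u \<circ> transpose u v) \<circ> (transpose p q \<circ> transpose q r) =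
      (transpose g1 g2 \<circ> transpose g2 g6) \<circ> (transpose g2 g3 \<circ> transpose g3 g4 \<circ> transpose g4 g5)"
  shows False
proof -
  define x where "x = transpose p q \<circ> transpose q r"
  define y where "y = transpose s t \<circ> transpose t u \<circ> transpose u v"
  have AB: "a \<noteq> b" if "a \<in> A" "b \<in> B" for a b using that disj by blast
  have x: "x p = q" "x q = r" "x r = p" "\<And>z. z \<noteq> p \<Longrightarrow> z \<noteq> q \<Longrightarrow> z \<noteq> r \<Longrightarrow> x z = z"
    using AB[OF pA(1) rB(1)] AB[OF pA(2) rB(1)] pq by (auto simp: x_def transpose_def)
  have y: "y s = t" "y t = u" "y u = v" "y v = s"
    "\<And>z. z \<noteq> s \<Longrightarrow> z \<noteq> t \<Longrightarrow> z \<noteq> u \<Longrightarrow> z \<noteq> v \<Longrightarrow> y z = z"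
    using AB[OF pA(3) rB(2)] AB[OF pA(3) rB(3)] AB[OF pA(4) rB(2)] AB[OF pA(4) rB(3)] pq
    by (auto simp: y_def transpose_def)
  define c where "c = (transpose g1 g2 \<circ> transpose g2 g6) \<circ> (transpose g2 g3 \<circ> transpose g3 g4 \<circ> transpose g4 g5)"
  have yx: "y (x z) = c z" for z
    using fun_cong[OF eq, of z] by (simp add: x_def y_def c_def)
  have c: "c g1 = g2" "c g2 = g3" "c g3 = g4" "c g4 = g5" "c g5 = g6" "c g6 = g1"
    using dist AB[OF gA(1) gB(1)] AB[OF gA(1) gB(2)] AB[OF gA(1) gB(3)] AB[OF gA(2) gB(1)] AB[OF gA(2) gB(2)]
      AB[OF gA(2) gB(3)] AB[OF gA(3) gB(1)] AB[OF gA(3) gB(2)] AB[OF gA(3) gB(3)]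
    by (auto simp: c_def transpose_def)
  have inj: "z = w" if "c z = c w" for z w
  proof -
    have "bij c" unfolding c_def by (intro bij_comp) auto
    then show ?thesis using that by (auto dest: injD[OF bij_is_inj])
  qed
  \<comment> \<open>The 6-cycle c moves three points of B, while x and y together move only r, t and
    v there. So these three are distinct, y fixes r, and the predecessor of r under c is q.\<close>
  have inB: "z = r \<or> z = t \<or> z = v" if "z \<in> B" "c z \<noteq> z" for z
    using that x(4)[of z] y(5)[of z] yx[of z] AB pA by metis
  have g_rtv: "g3 = r \<or> g3 = t \<or> g3 = v" "g5 = r \<or> g5 = t \<or> g5 = v" "g6 = r \<or> g6 = t \<or> g6 = v"
    using inB[of g3] inB[of g5] inB[of g6] gB c dist AB gA by auto
  have r: "r \<noteq> t" "r \<noteq> v" and r3: "r = g3 \<or> r = g5 \<or> r = g6" using g_rtv dist(2) by auto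
  have "y r = r" using y(5)[of r] r AB[OF pA(3) rB(1)] AB[OF pA(4) rB(1)] by metis
  then have cq: "c q = r" using yx[of q] x(2) by simp
  have cr: "c r = y p" using yx[of r] x(3) by simp
  have yA: "y z \<in> B \<longleftrightarrow> z = s \<or> z = u" if "z \<in> A" for z
    using that y AB rB by metis
  \<comment> \<open>The 4-cycle y alternates between the blocks and never moves a point of A to
    another point of A. The step of c from g1 to g2 inside A therefore involves x, which puts g1
    into {p, q}.\<close>
  have yA': "y z = z" if "z \<in> A" "y z \<in> A" for z
    using that y AB rB by metis
  have notB: "z \<notin> B" if "z \<in> A" for z using AB[OF that] by blast
  have c1: "g1 = p \<or> g1 = q"
  proof (rule ccontr)
    assume "\<not> ?thesis"
    then have "x g1 = g1" using x(4)[of g1] AB[OF gA(1) rB(1)] by metis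
    then have "y g1 = g2" using yx[of g1] c(1) by simp
    then show False using yA'[OF gA(1)] gA(2) dist(1) by simp
  qed
  \<comment> \<open>For r = g3, q = g2 and p = g4, which leaves no place for g1. For r = g5, q = g4
    and p = g1, so y would move g4 to g2 within A. For r = g6, the predecessor q would be g5, a
    point of B.\<close>
  from r3 show False
  proof (elim disjE)
    assume r: "r = g3"
    then have "q = g2" using cq c(2) inj by simp
    moreover have "y p = g4" using cr c(3) r by simp
    then have "p = g4" using yA'[OF pA(1)] gA(3) by simp
    ultimately show False using c1 dist(1) by simp
  next
    assume r: "r = g5"
    then have q: "q = g4" using cq c(4) inj by simp
    then have p: "p = g1" using c1 dist(1) by auto
    have "y q = g2" using yx[of p] x(1) c(1) p by simp
    then show False using yA'[OF pA(2)] gA(2) q dist(1) by simp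
  next
    assume "r = g6"
    then have "q = g5" using cq c(5) inj by simp
    then show False using AB[OF pA(2) gB(2)] by simp
  qed
qed

context wreath
begin

text \<open>For i, j, k in the first three blocks, (i j) (j k) is a 3-cycle that runs through the
  blocks in the order 0, 1, 2. With the two types of transposition interchanged, the product is a
  3-cycle in the order 0, 2, 1, or it has two disjoint factors.\<close>

lemma not_strong_gelfand_three_blocks:
  assumes len: "3 \<le> length lam" and pos: "\<forall>x\<in>set lam. 0 < x" and sum: "sum_list lam = n"
  shows "\<not> strong_gelfand_pair W (Base \<times> young_subgroup lam)"
proof
  assume sg: "strong_gelfand_pair W (Base \<times> young_subgroup lam)"
  have S': "S = {1..sum_list lam}" by (simp add: S_def sum)
  define P where "P p \<longleftrightarrow> (\<exists>a\<in>block lam 0. \<exists>b\<in>block lam 1. p = transpose a b)" for p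
  define Q where "Q p \<longleftrightarrow> (\<exists>a\<in>block lam 1. \<exists>b\<in>block lam 2. p = transpose a b)" for p
  have len': "0 < length lam" "1 < length lam" "2 < length lam" using len by linarith+
  have ex: "\<exists>x. x \<in> block lam i" if "i < length lam" for i
    using block_eq[OF that] bspec[OF pos nth_mem[OF that]]
    by (intro exI[of _ "Suc (sum_list (take i lam))"]) simp
  obtain i j k where ijk: "i \<in> block lam 0" "j \<in> block lam 1" "k \<in> block lam 2"
    using ex[OF len'(1)] ex[OF len'(2)] ex[OF len'(3)] by blast
  have bS: "x \<in> S" if "x \<in> block lam l" for x l using block_subset that unfolding S' by blast
  have bij: "bij q" if "q \<in> young_subgroup lam" for q using young_perm[OF that] permutes_bij by blast
  have "\<exists>p' q'. P p' \<and> Q q' \<and> q' \<circ> p' = transpose i j \<circ> transpose j k"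
  proof (rule strong_gelfand_pair_perm_product[OF _ _ _ _ sg])
    show "young_subgroup lam \<subseteq> Perm" using young_subgroup_closed(1)[of lam] unfolding S' .
    show "P (q \<circ> p \<circ> inv' q)" if q: "q \<in> young_subgroup lam" and "P p" for q p
      using that young_block[OF q len'(1)] young_block[OF q len'(2)]
      unfolding P_def by (metis conj_transpose[OF bij[OF q]])
    show "Q (q \<circ> p \<circ> inv' q)" if q: "q \<in> young_subgroup lam" and "Q p" for q p
      using that young_block[OF q len'(2)] young_block[OF q len'(3)]
      unfolding Q_def by (metis conj_transpose[OF bij[OF q]])
    show "transpose i j permutes S" "transpose j k permutes S" using ijk bS by (auto intro: permutes_swap_id)
    show "P (transpose i j)" "Q (transpose j k)" using ijk unfolding P_def Q_def by blast+
  qed (use young_subgroup_closed in auto)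
  then obtain a b' b c where abc: "a \<in> block lam 0" "b' \<in> block lam 1" "b \<in> block lam 1" "c \<in> block lam 2"
    and eq: "transpose b c \<circ> transpose a b' = transpose i j \<circ> transpose j k"
    unfolding P_def Q_def by blast
  have d01: "x \<noteq> y" if "x \<in> block lam 0" "y \<in> block lam 1" for x y
    using block_disjoint[of 0 1 x lam] that by auto
  have d02: "x \<noteq> y" if "x \<in> block lam 0" "y \<in> block lam 2" for x y
    using block_disjoint[of 0 2 x lam] that by auto
  have d12: "x \<noteq> y" if "x \<in> block lam 1" "y \<in> block lam 2" for x y
    using block_disjoint[of 1 2 x lam] that by auto
  note ne = d01[OF ijk(1,2)] d02[OF ijk(1,3)] d12[OF ijk(2,3)] d01[OF abc(1,2)] d01[OF abc(1,3)] d02[OF abc(1,4)]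
    d12[OF abc(2,4)] d12[OF abc(3,4)] d01[OF ijk(1) abc(2)] d01[OF ijk(1) abc(3)] d02[OF ijk(1) abc(4)]
    d12[OF ijk(2) abc(4)]
  have i: "transpose b c (transpose a b' i) = j" and j: "transpose b c (transpose a b' j) = k"
    using fun_cong[OF eq, of i] fun_cong[OF eq, of j] ne by (simp_all add: transpose_def)
  have "a = i" using i ne by (auto simp: transpose_def split: if_splits)
  moreover from this have "b' = j" using i ne by (auto simp: transpose_def split: if_splits)
  ultimately show False using j ne by (auto simp: transpose_def split: if_splits)
qed

text \<open>\<open>P\<close> and \<open>Q\<close> fix only the block pattern of a 3-cycle and of a
  4-cycle, so they are invariant under the Young subgroup. Blocks of size three leave just enough
  room for a product with pattern AABABB.\<close>

lemma not_strong_gelfand_two_big_blocks: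
  assumes lam: "lam = [a, b]" "3 \<le> a" "3 \<le> b" and sum: "sum_list lam = n"
  shows "\<not> strong_gelfand_pair W (Base \<times> young_subgroup lam)"
proof
  assume sg: "strong_gelfand_pair W (Base \<times> young_subgroup lam)"
  have S': "S = {1..sum_list lam}" by (simp add: S_def sum)
  define A where "A = block lam 0"
  define B where "B = block lam 1"
  have disj: "A \<inter> B = {}" using block_disjoint[of 0 1 _ lam] unfolding A_def B_def by auto
  have A: "1 \<in> A" "2 \<in> A" "3 \<in> A" and B: "Suc a \<in> B" "a + 2 \<in> B" "a + 3 \<in> B"
    using lam by (auto simp: A_def B_def block_def)
  define P where "P x \<longleftrightarrow> (\<exists>p\<in>A. \<exists>q\<in>A. \<exists>r\<in>B. p \<noteq> q \<and> x = transpose p q \<circ> transpose q r)" for x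
  define Q where "Q y \<longleftrightarrow> (\<exists>s\<in>A. \<exists>t\<in>B. \<exists>u\<in>A. \<exists>v\<in>B. s \<noteq> u \<and> t \<noteq> v \<and>
    y = transpose s t \<circ> transpose t u \<circ> transpose u v)" for y
  have AS: "x \<in> S" if "x \<in> A \<union> B" for x using block_subset that unfolding S' A_def B_def by blast
  have bij: "bij q" if "q \<in> young_subgroup lam" for q using young_perm[OF that] permutes_bij by blast
  have inj: "q x = q y \<longleftrightarrow> x = y" if "q \<in> young_subgroup lam" for q x y
    using bij_is_inj[OF bij[OF that]] by (auto dest: injD)
  have yA: "q x \<in> A" if "q \<in> young_subgroup lam" "x \<in> A" for q x
    using young_block[OF that(1), of 0] that(2) lam(1) by (simp add: A_def)
  have yB: "q x \<in> B" if "q \<in> young_subgroup lam" "x \<in> B" for q x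
    using young_block[OF that(1), of 1] that(2) lam(1) by (simp add: B_def)
  \<comment> \<open>\<open>?x\<close> is the cycle 1 -> 2 -> a+3 and \<open>?y\<close> the cycle 2
    -> a+1 -> 3 -> a+2. Their product is 1 -> 2 -> a+1 -> 3 -> a+2 -> a+3 -> 1, which gives g1, ...,
    g6 in this order.\<close>
  let ?x = "transpose 1 2 \<circ> transpose 2 (a + 3)"
  let ?y = "transpose 2 (Suc a) \<circ> transpose (Suc a) 3 \<circ> transpose 3 (a + 2)"
  have "\<exists>p' q'. P p' \<and> Q q' \<and> q' \<circ> p' = ?x \<circ> ?y"
  proof (rule strong_gelfand_pair_perm_product[OF _ _ _ _ sg])
    show "young_subgroup lam \<subseteq> Perm" using young_subgroup_closed(1)[of lam] unfolding S' .
    show "P (g \<circ> x \<circ> inv' g)" if g: "g \<in> young_subgroup lam" and P: "P x" for g x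
    proof -
      obtain p q r where pqr: "p \<in> A" "q \<in> A" "r \<in> B" "p \<noteq> q" "x = transpose p q \<circ> transpose q r"
        using P unfolding P_def by blast
      have "g \<circ> x \<circ> inv' g = transpose (g p) (g q) \<circ> transpose (g q) (g r)"
        unfolding pqr(5) conj_comp[OF bij[OF g]] conj_transpose[OF bij[OF g]] ..
      moreover have "g p \<noteq> g q" using inj[OF g] pqr(4) by simp
      ultimately show ?thesis unfolding P_def using yA[OF g] yB[OF g] pqr(1-3) by blast
    qed
    show "Q (g \<circ> y \<circ> inv' g)" if g: "g \<in> young_subgroup lam" and Q: "Q y" for g y
    proof -
      obtain s t u v where st: "s \<in> A" "t \<in> B" "u \<in> A" "v \<in> B" "s \<noteq> u" "t \<noteq> v"
        "y = transpose s t \<circ> transpose t u \<circ> transpose u v"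
        using Q unfolding Q_def by blast
      have "g \<circ> y \<circ> inv' g = transpose (g s) (g t) \<circ> transpose (g t) (g u) \<circ> transpose (g u) (g v)"
        unfolding st(7) conj_comp[OF bij[OF g]] conj_transpose[OF bij[OF g]] ..
      moreover have "g s \<noteq> g u" "g t \<noteq> g v" using inj[OF g] st(5,6) by simp_all
      ultimately show ?thesis unfolding Q_def using yA[OF g] yB[OF g] st(1-4) by blast
    qed
    show "?x permutes S" "?y permutes S"
      using A B AS by (auto intro!: permutes_compose permutes_swap_id)
    show "P ?x" unfolding P_def by (rule bexI[OF bexI[OF bexI[OF conjI[OF _ refl] B(3)] A(2)] A(1)]) simp
    show "Q ?y" unfolding Q_def
      by (rule bexI[OF bexI[OF bexI[OF bexI[OF conjI[OF _ conjI[OF _ refl]] B(2)] A(3)] B(1)] A(2)]) simp_all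
  qed (use young_subgroup_closed in auto)
  then obtain p q r s t u v where "p \<in> A" "q \<in> A" "s \<in> A" "u \<in> A" "r \<in> B" "t \<in> B" "v \<in> B"
    "p \<noteq> q" "s \<noteq> u" "t \<noteq> v"
    "(transpose s t \<circ> transpose t u \<circ> transpose u v) \<circ> (transpose p q \<circ> transpose q r) = ?x \<circ> ?y"
    unfolding P_def Q_def by blast
  from no_reversed_factorization[OF disj A B(1,2,3) _ _ this] show False by simp
qed

end

theorem mainTheorem1:
  fixes F :: "('a, 'm) monoid_scheme" and n :: nat and lam :: "nat list"
  assumes "group F" and "finite (carrier F)"
    and "n > 0"
    and "is_partition lam n"
  shows "strong_gelfand_pair
           (wreath_product F n (carrier (sym_group n)))
           (carrier (wreath_product F n (young_subgroup lam)))
         \<longleftrightarrow> length lam \<le> 2 \<and> second_part lam \<in> {0, 1, 2}"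
proof -
  interpret wreath F n using assms(1,2) by (intro wreath.intro wreath_axioms.intro)
  have sum: "sum_list lam = n" and pos: "\<forall>x\<in>set lam. 0 < x" and sorted: "sorted_wrt (\<ge>) lam"
    using assms(4) unfolding is_partition_def by auto
  have S': "S = {1..sum_list lam}" by (simp add: S_def sum)
  have K: "carrier (wreath_product F n (young_subgroup lam)) = Base \<times> young_subgroup lam"
    by (simp add: wreath_carrier S_def)
  have "strong_gelfand_pair W (Base \<times> young_subgroup lam) \<longleftrightarrow> length lam \<le> 2 \<and> second_part lam \<in> {0, 1, 2}"
  proof
    assume lam: "length lam \<le> 2 \<and> second_part lam \<in> {0, 1, 2}"
    show "strong_gelfand_pair W (Base \<times> young_subgroup lam)"
    proof (rule strong_gelfand_pair_if_inverting)
      show "young_subgroup lam \<subseteq> Perm" using young_subgroup_closed(1)[of lam] unfolding S' .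
      show "\<exists>q\<in>young_subgroup lam. q \<circ> p \<circ> inv' q = inv' p \<and> (\<forall>C. C \<subseteq> S \<and> p ` C = C \<longrightarrow> q ` C = C)"
        if "p permutes S" for p
        using young_inverting[OF assms(4,3)] lam that unfolding S_def by blast
    qed (use young_subgroup_closed in auto)
  next
    assume sg: "strong_gelfand_pair W (Base \<times> young_subgroup lam)"
    have len: "length lam \<le> 2"
    proof (rule ccontr)
      assume "\<not> ?thesis"
      then have "3 \<le> length lam" by simp
      then show False using not_strong_gelfand_three_blocks[OF _ pos sum] sg by simp
    qed
    have "second_part lam \<in> {0, 1, 2}"
    proof (rule ccontr)
      assume sp: "second_part lam \<notin> {0, 1, 2}"
      then have "length lam = 2" using len by (auto simp: second_part_def split: if_splits)
      then obtain a b where ab: "lam = [a, b]" by (auto simp: length_Suc_conv numeral_2_eq_2)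
      then have "3 \<le> b" "b \<le> a" using sp sorted by (auto simp: second_part_def)
      then show False using not_strong_gelfand_two_big_blocks[OF ab _ _ sum] sg by auto
    qed
    with len show "length lam \<le> 2 \<and> second_part lam \<in> {0, 1, 2}" by blast
  qed
  then show ?thesis unfolding W_def K by simp
qed

end
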